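(* Let $A$ be a quantum nilpotent algebra in $N$ generators, $A'=\mathbb{K}_\Lambda[T_1,\dots,T_N]$ the quantum affine space obtained from it by the deleting derivations algorithm, and $\psi:\mathrm{C.Spec}(A)\to\mathrm{C.Spec}(A')$ the canonical embedding. Let $w\in\mathcal{W}'$, $P\in\mathrm{C.Spec}_w(A)$ and $Q=\psi(P)\in\mathrm{C.Spec}_w(A')$. Let $t_i$ be the canonical image of $T_i$ in $A'/Q$, let $\bar w=\{1,\dots,N\}\setminus w$, and let $\Sigma$ be the multiplicatively closed subset of $A'/Q$ generated by the $t_i$ with $i\in\bar w$. Identify $A'/Q$ with a subalgebra of $\mathrm{Frac}(A/P)$ as described in the context. Then: (i) $\Sigma$ is a multiplicatively closed set of regular, normal elements in $A'/Q$. (ii) There exists a multiplicatively closed set $\Gamma$ of regular elements of $A/P$ which satisfies the two-sided Ore condition in $A/P$ and such that $(A/P)\Gamma^{-1}=(A'/Q)\Sigma^{-1}$. (iii) $\mathrm{Frac}(A/P)=\mathrm{Frac}(A'/Q)$. Furthermore, $A/P$ and $A'/Q$ are PI algebras if all $\lambda_{i,j}$ with $i,j\in\bar w$ are roots of unity, and in this case $\mathrm{PI\text{-}deg}(A/P)=\mathrm{PI\text{-}deg}(A'/Q)$.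
   Context: Notation: $\mathbb{K}$ is a field; $[\![a,b]\!]$ is the set of integers from $a$ to $b$. $\mathbb{K}_\Lambda[T_1,\dots,T_N]$ is the algebra generated by $T_1,\dots,T_N$ with defining relations $T_iT_j=\lambda_{i,j}T_jT_i$. For a prime PI algebra $R$ that is a domain, $\mathrm{PI\text{-}deg}(R)$ is the square root of the dimension of $\mathrm{Frac}(R)$ over its centre. Ore extensions: in $R[x;\sigma,\delta]$, $\sigma$ is a $\mathbb{K}$-algebra automorphism of $R$, $\delta$ is a $\mathbb{K}$-linear $\sigma$-derivation, $\delta(ab)=\sigma(a)\delta(b)+\delta(a)b$, and $xr=\sigma(r)x+\delta(r)$. Higher skew derivations: for $1\ne q\in\mathbb{K}^*$, $\delta$ extends to a higher $q$-skew $\sigma$-derivation $\{d_n\}_{n\ge0}$ on $R$ if the $d_n$ are $\mathbb{K}$-linear operators on $R$ with $d_0=\mathrm{id}$, $d_1=\delta$, $d_n(rs)=\sum_{i=0}^n\sigma^{n-i}d_i(r)\,d_{n-i}(s)$ and $d_n\circ\sigma=q^n\sigma\circ d_n$ for all $n$. It is locally nilpotent if for each $r\in R$ there is $n_r\ge0$ with $d_n(r)=0$ for all $n\ge n_r$, and iterative if $d_nd_m=\binom{n+m}{m}_q d_{n+m}$ for all $n,m$. Quantum nilpotent algebra: $A=\mathbb{K}[X_1][X_2;\sigma_2,\delta_2]\cdots[X_N;\sigma_N,\delta_N]$ with $A_{i}=\mathbb{K}\langle X_1,\dots,X_i\rangle$ such that: (1) $\sigma_i(X_l)=\lambda_{i,l}X_l$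 for $l<i$, $\lambda_{i,l}\in\mathbb{K}^*$; (2) $\Lambda=(\lambda_{i,j})\in M_N(\mathbb{K}^* )$ is multiplicatively antisymmetric ($\lambda_{i,l}=\lambda_{l,i}^{-1}$, $\lambda_{i,i}=1$); (3) for $2\le i\le N$ there is $1\ne q_i\in\mathbb{K}^*$ with $\delta_i\circ\sigma_i=q_i\sigma_i\circ\delta_i$; (4) for $2\le i\le N$, $\delta_i$ extends to a (fixed) locally nilpotent, iterative higher $q_i$-skew $\sigma_i$-derivation $\{d_{i,n}\}_{n\ge0}$ on $A_{i-1}$, and $\sigma_l\circ d_{i,n}=\lambda_{l,i}^n d_{i,n}\circ\sigma_l$ on $A_{i-1}$ for all $n\ge0$, $i+1\le l\le N$. Such an $A$ is a Noetherian domain. Deleting derivations algorithm: put $X_i^{(N+1)}=X_i$, and let $A^{(j)}$ be the subalgebra of $\mathrm{Frac}(A)$ generated by $X_1^{(j)},\dots,X_N^{(j)}$. For $j=N,N-1,\dots,2$ write $x_i=X_i^{(j+1)}$, $y_i=X_i^{(j)}$. There is a $\mathbb{K}$-algebra isomorphism $A^{(j+1)}\to\mathbb{K}[X_1]\cdots[X_j;\sigma_j,\delta_j][X_{j+1};\sigma_{j+1}^{(j+1)}]\cdots[X_N;\sigma_N^{(j+1)}]$, $x_i\mapsto X_i$, with $\sigma_i^{(j+1)}(X_l)=\lambda_{i,l}X_l$ for $l<i$; via it $\sigma_j$ and $d_{j,n}$ are regarded as maps on $\mathbb{K}\langle x_1,\dots,x_{j-1}\rangle\cong A_{j-1}$.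 Then $y_l=x_l$ for $l\ge j$ and $y_l=\sum_{n\ge0}q_j^{n(n+1)/2}(q_j-1)^{-n}d_{j,n}\circ\sigma_j^{-n}(x_l)\,x_j^{-n}$ (a finite sum) for $l<j$. The set $S_j=\{x_j^n\}_{n\ge0}=\{y_j^n\}_{n\ge0}$ is a two-sided Ore set of regular elements in $A^{(j)}$ and $A^{(j+1)}$, and $A^{(j)}S_j^{-1}=A^{(j+1)}S_j^{-1}$. Put $A'=A^{(2)}$, $T_i=X_i^{(2)}$; then $A'=\mathbb{K}_\Lambda[T_1,\dots,T_N]$. Canonical embedding: $\mathrm{C.Spec}(R)$ is the set of completely prime ideals of $R$ (ideals $P$ with $R/P$ a domain). There is a surjective homomorphism $g_j:A^{(j)}\to A^{(j+1)}/\langle x_j\rangle$, $y_i\mapsto x_i+\langle x_j\rangle$. The injective map $\psi_j:\mathrm{C.Spec}(A^{(j+1)})\to\mathrm{C.Spec}(A^{(j)})$ is $\psi_j(P)=PS_j^{-1}\cap A^{(j)}$ if $x_j\notin P$ and $\psi_j(P)=g_j^{-1}(P/\langle x_j\rangle)$ if $x_j\in P$; and $\psi=\psi_2\circ\cdots\circ\psi_N$. Partition: for $w\subseteq[\![1,N]\!]$, $\mathrm{C.Spec}_w(A')=\{Q\in\mathrm{C.Spec}(A')\mid Q\cap\{T_1,\dots,T_N\}=\{T_i\mid i\in w\}\}$, $\mathrm{C.Spec}_w(A)=\psi^{-1}(\mathrm{C.Spec}_w(A'))$, and $\mathcal{W}'$ is the set of $w$ with $\mathrm{C.Spec}_w(A)\ne\emptyset$.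 Identification: for $P\in\mathrm{C.Spec}(A)$ put $P_{N+1}=P$, $P_j=\psi_j\circ\cdots\circ\psi_N(P)$, $B^{(j)}=A^{(j)}/P_j$ (so $B^{(N+1)}=A/P$, $B^{(2)}=A'/\psi(P)$). If $x_j\in P_{j+1}$, $g_j$ induces an isomorphism $B^{(j)}\cong B^{(j+1)}$, used to identify these algebras. If $x_j\notin P_{j+1}$, then $P_jS_j^{-1}=P_{j+1}S_j^{-1}=:\Theta$ in $\Omega:=A^{(j)}S_j^{-1}=A^{(j+1)}S_j^{-1}$, and both $B^{(j)}$ and $B^{(j+1)}$ embed naturally in $\Omega/\Theta$, which is the localisation of each of them at the powers of the image of $x_j$. Composing, every $B^{(j)}$ is regarded as a subalgebra of $\mathrm{Frac}(A/P)$. *)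

theory Defs
  imports Complex_Main "HOL-Algebra.QuotRing" "HOL-Algebra.Embedded_Algebras"
begin

text \<open>
  Division rings of fractions are types of class \<open>division_ring\<close>; their subrings become
  HOL-Algebra rings (so that ideals, quotients and homomorphisms are those of HOL-Algebra)
  via the following record.
\<close>

definition ring_of :: "'a::ring_1 set \<Rightarrow> 'a ring"
  where "ring_of S = \<lparr>carrier = S, monoid.mult = (*), one = 1, zero = 0, add = (+)\<rparr>"


section \<open>Noncommutative rings\<close>

text \<open>The locale \<open>domain\<close> of HOL-Algebra is restricted to commutative rings.\<close>

definition nc_domain :: "('a, 'b) ring_scheme \<Rightarrow> bool"
  where "nc_domain R \<longleftrightarrow> ring R \<and> \<one>\<^bsub>R\<^esub> \<noteq> \<zero>\<^bsub>R\<^esub> \<and>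
    (\<forall>a\<in>carrier R. \<forall>b\<in>carrier R. a \<otimes>\<^bsub>R\<^esub> b = \<zero>\<^bsub>R\<^esub> \<longrightarrow> a = \<zero>\<^bsub>R\<^esub> \<or> b = \<zero>\<^bsub>R\<^esub>)"

definition CSpec :: "('a, 'b) ring_scheme \<Rightarrow> 'a set set"
  where "CSpec R = {P. ideal P R \<and> nc_domain (R Quot P)}"

definition regular_elt :: "('a, 'b) ring_scheme \<Rightarrow> 'a \<Rightarrow> bool"
  where "regular_elt R a \<longleftrightarrow> a \<in> carrier R \<and>
    (\<forall>b\<in>carrier R. (a \<otimes>\<^bsub>R\<^esub> b = \<zero>\<^bsub>R\<^esub> \<longrightarrow> b = \<zero>\<^bsub>R\<^esub>) \<and> (b \<otimes>\<^bsub>R\<^esub> a = \<zero>\<^bsub>R\<^esub> \<longrightarrow> b = \<zero>\<^bsub>R\<^esub>))"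

definition normal_elt :: "('a, 'b) ring_scheme \<Rightarrow> 'a \<Rightarrow> bool"
  where "normal_elt R a \<longleftrightarrow> a \<in> carrier R \<and>
    {a \<otimes>\<^bsub>R\<^esub> r | r. r \<in> carrier R} = {r \<otimes>\<^bsub>R\<^esub> a | r. r \<in> carrier R}"

definition two_sided_Ore :: "('a, 'b) ring_scheme \<Rightarrow> 'a set \<Rightarrow> bool"
  where "two_sided_Ore R S \<longleftrightarrow>
    (\<forall>a\<in>carrier R. \<forall>s\<in>S.
       (\<exists>b\<in>carrier R. \<exists>t\<in>S. a \<otimes>\<^bsub>R\<^esub> t = s \<otimes>\<^bsub>R\<^esub> b) \<and>
       (\<exists>b\<in>carrier R. \<exists>t\<in>S. t \<otimes>\<^bsub>R\<^esub> a = b \<otimes>\<^bsub>R\<^esub> s))"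

definition mult_generated :: "('a, 'b) ring_scheme \<Rightarrow> 'a set \<Rightarrow> 'a set"
  where "mult_generated R S = (\<lambda>M. submonoid M R) hull S"

text \<open>
  For an embedding \<open>f\<close> of \<open>R\<close> into a division ring, \<open>loc R f S\<close> is \<open>R S\<inverse>\<close> and
  \<open>Frac_in R f\<close> is \<open>Frac R\<close>, both as subsets of the division ring.
\<close>

definition loc :: "('a, 'b) ring_scheme \<Rightarrow> ('a \<Rightarrow> 'g::division_ring) \<Rightarrow> 'a set \<Rightarrow> 'g set"
  where "loc R f S = {f a * inverse (f s) | a s. a \<in> carrier R \<and> s \<in> S}"

definition Frac_in :: "('a, 'b) ring_scheme \<Rightarrow> ('a \<Rightarrow> 'g::division_ring) \<Rightarrow> 'g set"
  where "Frac_in R f = loc R f (carrier R - {\<zero>\<^bsub>R\<^esub>})"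

text \<open>
  The division ring \<open>'g\<close>, with \<open>R\<close> embedded in it by \<open>f\<close>, is the (two-sided) division ring of
  fractions of \<open>R\<close>. It is determined by \<open>R\<close> up to a unique isomorphism over \<open>R\<close>.
\<close>

definition is_Frac :: "('a, 'b) ring_scheme \<Rightarrow> ('a \<Rightarrow> 'g::division_ring) \<Rightarrow> bool"
  where "is_Frac R f \<longleftrightarrow>
    f \<in> ring_hom R (ring_of UNIV) \<and> inj_on f (carrier R) \<and>
    Frac_in R f = UNIV \<and>
    {inverse (f s) * f a | a s. a \<in> carrier R \<and> s \<in> carrier R - {\<zero>\<^bsub>R\<^esub>}} = UNIV"

text \<open>
  A PI ring satisfies a monic polynomial identity over the integers. A polynomial in noncommuting
  variables \<open>x\<^sub>0, x\<^sub>1, \<dots>\<close> is a finitely supported function on words; it is monic if some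
  monomial of highest degree has coefficient 1.
\<close>

definition PI_ring :: "('a, 'b) ring_scheme \<Rightarrow> bool"
  where "PI_ring R \<longleftrightarrow> (\<exists>p :: nat list \<Rightarrow> int.
    finite {u. p u \<noteq> 0} \<and>
    (\<exists>u. p u = 1 \<and> (\<forall>v. p v \<noteq> 0 \<longrightarrow> length v \<le> length u)) \<and>
    (\<forall>r. range r \<subseteq> carrier R \<longrightarrow>
       (\<Oplus>\<^bsub>R\<^esub>u\<in>{u. p u \<noteq> 0}. [p u] \<cdot>\<^bsub>R\<^esub> foldr (\<lambda>i a. r i \<otimes>\<^bsub>R\<^esub> a) u \<one>\<^bsub>R\<^esub>) = \<zero>\<^bsub>R\<^esub>))"

definition centre :: "'g::division_ring set \<Rightarrow> 'g set"
  where "centre D = {z \<in> D. \<forall>d\<in>D. z * d = d * z}"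

definition PI_deg :: "('a, 'b) ring_scheme \<Rightarrow> ('a \<Rightarrow> 'g::division_ring) \<Rightarrow> real"
  where "PI_deg R f =
    sqrt (real (ring.dim (ring_of UNIV) (centre (Frac_in R f)) (Frac_in R f)))"


section \<open>Iterated Ore extensions and higher skew derivations\<close>

text \<open>The parameter \<open>s\<close> is the scalar multiplication of an ambient \<open>\<bbbK>\<close>-algebra.\<close>

definition K_algebra :: "('k::field \<Rightarrow> 'f::ring_1 \<Rightarrow> 'f) \<Rightarrow> bool"
  where "K_algebra s \<longleftrightarrow> vector_space s \<and>
    (\<forall>c x y. s c (x * y) = s c x * y \<and> s c (x * y) = x * s c y)"

definition subalg :: "('k::field \<Rightarrow> 'f::ring_1 \<Rightarrow> 'f) \<Rightarrow> 'f set \<Rightarrow> bool"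
  where "subalg s B \<longleftrightarrow> 1 \<in> B \<and> (\<forall>x\<in>B. \<forall>y\<in>B. x + y \<in> B \<and> x * y \<in> B) \<and> (\<forall>c. \<forall>x\<in>B. s c x \<in> B)"

definition K_linear_on :: "('k::field \<Rightarrow> 'f::ring_1 \<Rightarrow> 'f) \<Rightarrow> 'f set \<Rightarrow> ('f \<Rightarrow> 'f) \<Rightarrow> bool"
  where "K_linear_on s R h \<longleftrightarrow>
    (\<forall>x\<in>R. \<forall>y\<in>R. h (x + y) = h x + h y) \<and> (\<forall>c. \<forall>x\<in>R. h (s c x) = s c (h x))"

text \<open>
  \<open>S = R[x; \<sigma>, \<delta>]\<close>, as an internal statement: \<open>S\<close> is a free left \<open>R\<close>-module on the powers
  of \<open>x\<close>, with the commutation rule \<open>x r = \<sigma>(r) x + \<delta>(r)\<close>.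
\<close>

definition Ore_extension ::
    "('k::field \<Rightarrow> 'f::ring_1 \<Rightarrow> 'f) \<Rightarrow> 'f set \<Rightarrow> 'f \<Rightarrow> ('f \<Rightarrow> 'f) \<Rightarrow> ('f \<Rightarrow> 'f) \<Rightarrow> 'f set \<Rightarrow> bool"
  where "Ore_extension s R x \<sigma> \<delta> S \<longleftrightarrow>
    subalg s R \<and> subalg s S \<and> R \<subseteq> S \<and> x \<in> S \<and>
    \<sigma> \<in> ring_iso (ring_of R) (ring_of R) \<and> K_linear_on s R \<sigma> \<and>
    \<delta> ` R \<subseteq> R \<and> K_linear_on s R \<delta> \<and>
    (\<forall>a\<in>R. \<forall>b\<in>R. \<delta> (a * b) = \<sigma> a * \<delta> b + \<delta> a * b) \<and>
    (\<forall>r\<in>R. x * r = \<sigma> r * x + \<delta> r) \<and>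
    (\<forall>y\<in>S. \<exists>!f :: nat \<Rightarrow> 'f.
       finite {n. f n \<noteq> 0} \<and> range f \<subseteq> R \<and> y = (\<Sum>n | f n \<noteq> 0. f n * x ^ n))"

text \<open>Gaussian binomial coefficients, by the q-Pascal rule, so that \<open>q\<close> may be a root of unity.\<close>

fun qbinom :: "'k::field \<Rightarrow> nat \<Rightarrow> nat \<Rightarrow> 'k"
  where
    "qbinom q n 0 = 1"
  | "qbinom q 0 (Suc m) = 0"
  | "qbinom q (Suc n) (Suc m) = qbinom q n m + q ^ Suc m * qbinom q n (Suc m)"

definition higher_skew_derivation ::
    "('k::field \<Rightarrow> 'f::ring_1 \<Rightarrow> 'f) \<Rightarrow> 'f set \<Rightarrow> 'k \<Rightarrow> ('f \<Rightarrow> 'f) \<Rightarrow> ('f \<Rightarrow> 'f) \<Rightarrow> (nat \<Rightarrow> 'f \<Rightarrow> 'f) \<Rightarrow> bool"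
  where "higher_skew_derivation s R q \<sigma> \<delta> d \<longleftrightarrow>
    (\<forall>n. d n ` R \<subseteq> R \<and> K_linear_on s R (d n)) \<and>
    (\<forall>r\<in>R. d 0 r = r \<and> d 1 r = \<delta> r) \<and>
    (\<forall>n. \<forall>a\<in>R. \<forall>b\<in>R. d n (a * b) = (\<Sum>i\<le>n. (\<sigma> ^^ (n - i)) (d i a) * d (n - i) b)) \<and>
    (\<forall>n. \<forall>r\<in>R. d n (\<sigma> r) = s (q ^ n) (\<sigma> (d n r)))"

definition locally_nilpotent :: "'f::ring_1 set \<Rightarrow> (nat \<Rightarrow> 'f \<Rightarrow> 'f) \<Rightarrow> bool"
  where "locally_nilpotent R d \<longleftrightarrow> (\<forall>r\<in>R. \<exists>m. \<forall>n\<ge>m. d n r = 0)"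

definition iterative ::
    "('k::field \<Rightarrow> 'f::ring_1 \<Rightarrow> 'f) \<Rightarrow> 'f set \<Rightarrow> 'k \<Rightarrow> (nat \<Rightarrow> 'f \<Rightarrow> 'f) \<Rightarrow> bool"
  where "iterative s R q d \<longleftrightarrow>
    (\<forall>n m. \<forall>r\<in>R. d n (d m r) = s (qbinom q (n + m) m) (d (n + m) r))"


section \<open>Quantum nilpotent algebras\<close>

text \<open>
  The data of a quantum nilpotent algebra \<open>A\<close> lying in its division ring of fractions \<open>'f\<close>.
  All indices are 1-based; \<open>aut\<close>, \<open>der\<close>, \<open>hder\<close> and \<open>qpar\<close> are meaningful for
  indices \<open>2, \<dots>, num\<close> only, and \<open>aut i\<close>, \<open>der i\<close>, \<open>hder i n\<close> act on \<open>A\<^bsub>i-1\<^esub>\<close>.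
\<close>

record ('k, 'f) qna =
  scal :: "'k \<Rightarrow> 'f \<Rightarrow> 'f"
  num  :: nat
  var  :: "nat \<Rightarrow> 'f"
  aut  :: "nat \<Rightarrow> 'f \<Rightarrow> 'f"
  der  :: "nat \<Rightarrow> 'f \<Rightarrow> 'f"
  hder :: "nat \<Rightarrow> nat \<Rightarrow> 'f \<Rightarrow> 'f"
  lam  :: "nat \<Rightarrow> nat \<Rightarrow> 'k"
  qpar :: "nat \<Rightarrow> 'k"

definition base :: "('k::field, 'f::division_ring) qna \<Rightarrow> nat \<Rightarrow> 'f set"
  where "base D i = subalg (scal D) hull (var D ` {1..i})"

definition quantum_nilpotent_algebra :: "('k::field, 'f::division_ring) qna \<Rightarrow> bool"
  where "quantum_nilpotent_algebra D \<longleftrightarrow>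
    K_algebra (scal D) \<and> 1 \<le> num D \<and>
    Ore_extension (scal D) (base D 0) (var D 1) (\<lambda>r. r) (\<lambda>r. 0) (base D 1) \<and>
    (\<forall>i\<in>{2..num D}.
       Ore_extension (scal D) (base D (i - 1)) (var D i) (aut D i) (der D i) (base D i)) \<and>
    (\<forall>i\<in>{2..num D}. \<forall>l\<in>{1..<i}. aut D i (var D l) = scal D (lam D i l) (var D l)) \<and>
    (\<forall>i\<in>{1..num D}. \<forall>l\<in>{1..num D}. lam D i l \<noteq> 0 \<and> lam D i l = inverse (lam D l i)) \<and>
    (\<forall>i\<in>{1..num D}. lam D i i = 1) \<and>
    (\<forall>i\<in>{2..num D}. qpar D i \<noteq> 0 \<and> qpar D i \<noteq> 1 \<and>
       (\<forall>r\<in>base D (i - 1). der D i (aut D i r) = scal D (qpar D i) (aut D i (der D i r)))) \<and>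
    (\<forall>i\<in>{2..num D}.
       higher_skew_derivation (scal D) (base D (i - 1)) (qpar D i) (aut D i) (der D i) (hder D i) \<and>
       locally_nilpotent (base D (i - 1)) (hder D i) \<and>
       iterative (scal D) (base D (i - 1)) (qpar D i) (hder D i) \<and>
       (\<forall>n. \<forall>l\<in>{i+1..num D}. \<forall>r\<in>base D (i - 1).
          aut D l (hder D i n r) = scal D (lam D l i ^ n) (hder D i n (aut D l r))))"


section \<open>The deleting derivations algorithm\<close>

text \<open>
  Given \<open>x\<^sub>i = X\<^sub>i\<^bsup>(j+1)\<^esup>\<close>, the algebra isomorphism
  \<open>A\<^bsub>j-1\<^esub> \<cong> \<bbbK>\<langle>x\<^sub>1, \<dots>, x\<^bsub>j-1\<^esub>\<rangle>\<close>, \<open>X\<^sub>i \<mapsto> x\<^sub>i\<close>. Its values on \<open>A\<^bsub>j-1\<^esub>\<close> are determined,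
  since the \<open>X\<^sub>i\<close> generate that algebra.
\<close>

definition transport :: "('k::field, 'f::division_ring) qna \<Rightarrow> nat \<Rightarrow> (nat \<Rightarrow> 'f) \<Rightarrow> 'f \<Rightarrow> 'f"
  where "transport D j x = (SOME h.
    h \<in> ring_hom (ring_of (base D (j - 1))) (ring_of UNIV) \<and>
    K_linear_on (scal D) (base D (j - 1)) h \<and> (\<forall>i\<in>{1..<j}. h (var D i) = x i))"

text \<open>
  One step \<open>x = X\<^bsup>(j+1)\<^esup> \<mapsto> y = X\<^bsup>(j)\<^esup>\<close>. The map \<open>d\<^bsub>j,n\<^esub> \<circ> \<sigma>\<^sub>j\<^bsup>-n\<^esup>\<close> transported to
  \<open>\<bbbK>\<langle>x\<^sub>1, \<dots>, x\<^bsub>j-1\<^esub>\<rangle>\<close> sends \<open>x\<^sub>l\<close> to the transport of \<open>d\<^bsub>j,n\<^esub>(\<sigma>\<^sub>j\<^bsup>-n\<^esup>(X\<^sub>l))\<close>.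
\<close>

definition delete_step :: "('k::field, 'f::division_ring) qna \<Rightarrow> nat \<Rightarrow> (nat \<Rightarrow> 'f) \<Rightarrow> nat \<Rightarrow> 'f"
  where "delete_step D j x l =
    (if l < j then
       let q = qpar D j;
           t = (\<lambda>n. hder D j n ((inv_into (base D (j - 1)) (aut D j) ^^ n) (var D l)))
       in \<Sum>n | t n \<noteq> 0.
            scal D (q ^ (n * (n + 1) div 2) * inverse ((q - 1) ^ n))
              (transport D j x (t n) * inverse (x j) ^ n)
     else x l)"

text \<open>
  \<open>rev [j..<num D + 1]\<close> is the list \<open>[N, N - 1, \<dots>, j]\<close>; folding over it runs the steps from
  stage \<open>N + 1\<close> down to stage \<open>j\<close>. Thus \<open>gen D j i\<close> is \<open>X\<^sub>i\<^bsup>(j)\<^esup>\<close> and \<open>alg D j\<close> is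
  \<open>A\<^bsup>(j)\<^esup>\<close>; in particular \<open>alg D (num D + 1)\<close> is \<open>A\<close>, \<open>alg D 2\<close> is \<open>A'\<close> and
  \<open>gen D 2 i\<close> is \<open>T\<^sub>i\<close>.
\<close>

definition gen :: "('k::field, 'f::division_ring) qna \<Rightarrow> nat \<Rightarrow> nat \<Rightarrow> 'f"
  where "gen D j = fold (delete_step D) (rev [j..<num D + 1]) (var D)"

definition alg :: "('k::field, 'f::division_ring) qna \<Rightarrow> nat \<Rightarrow> 'f ring"
  where "alg D j = ring_of (subalg (scal D) hull (gen D j ` {1..num D}))"


section \<open>The canonical embedding\<close>

definition x_ideal :: "('k::field, 'f::division_ring) qna \<Rightarrow> nat \<Rightarrow> 'f set"
  where "x_ideal D j = Idl\<^bsub>alg D (j + 1)\<^esub> {gen D (j + 1) j}"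

text \<open>
  The homomorphism \<open>g\<^sub>j : A\<^bsup>(j)\<^esup> \<rightarrow> A\<^bsup>(j+1)\<^esup> / \<langle>x\<^sub>j\<rangle>\<close> of \<open>\<bbbK>\<close>-algebras; for a ring homomorphism,
  \<open>\<bbbK>\<close>-linearity amounts to \<open>c\<cdot>1\<close> being sent to the class of \<open>c\<cdot>1\<close>.
\<close>

definition g_map :: "('k::field, 'f::division_ring) qna \<Rightarrow> nat \<Rightarrow> 'f \<Rightarrow> 'f set"
  where "g_map D j = (SOME g.
    g \<in> ring_hom (alg D j) (alg D (j + 1) Quot x_ideal D j) \<and>
    (\<forall>c. g (scal D c 1) = x_ideal D j +>\<^bsub>alg D (j + 1)\<^esub> scal D c 1) \<and>
    (\<forall>i\<in>{1..num D}. g (gen D j i) = x_ideal D j +>\<^bsub>alg D (j + 1)\<^esub> gen D (j + 1) i))"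

definition psi_step :: "('k::field, 'f::division_ring) qna \<Rightarrow> nat \<Rightarrow> 'f set \<Rightarrow> 'f set"
  where "psi_step D j P =
    (let x = gen D (j + 1) j in
     if x \<notin> P
     then {p * inverse x ^ n | p n. p \<in> P} \<inter> carrier (alg D j)
     else {a \<in> carrier (alg D j). g_map D j a \<in> {x_ideal D j +>\<^bsub>alg D (j + 1)\<^esub> p | p. p \<in> P}})"

text \<open>\<open>prime_at D P j\<close> is \<open>P\<^sub>j = (\<psi>\<^sub>j \<circ> \<dots> \<circ> \<psi>\<^sub>N)(P)\<close>.\<close>

definition prime_at :: "('k::field, 'f::division_ring) qna \<Rightarrow> 'f set \<Rightarrow> nat \<Rightarrow> 'f set"
  where "prime_at D P j = fold (psi_step D) (rev [j..<num D + 1]) P"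

definition psi :: "('k::field, 'f::division_ring) qna \<Rightarrow> 'f set \<Rightarrow> 'f set"
  where "psi D P = prime_at D P 2"

definition CSpec_w' :: "('k::field, 'f::division_ring) qna \<Rightarrow> nat set \<Rightarrow> 'f set set"
  where "CSpec_w' D w =
    {Q \<in> CSpec (alg D 2). Q \<inter> gen D 2 ` {1..num D} = gen D 2 ` w}"

definition CSpec_w :: "('k::field, 'f::division_ring) qna \<Rightarrow> nat set \<Rightarrow> 'f set set"
  where "CSpec_w D w = {P \<in> CSpec (alg D (num D + 1)). psi D P \<in> CSpec_w' D w}"

definition W' :: "('k::field, 'f::division_ring) qna \<Rightarrow> nat set set"
  where "W' D = {w. w \<subseteq> {1..num D} \<and> CSpec_w D w \<noteq> {}}"


section \<open>Identification of the quotients inside the division ring of fractions\<close>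

text \<open>
  \<open>B\<^bsup>(j)\<^esup> = A\<^bsup>(j)\<^esup> / P\<^sub>j\<close>. From an embedding \<open>f\<close> of \<open>B\<^bsup>(j+1)\<^esup>\<close> in \<open>Frac(A/P)\<close> one
  obtains an embedding of \<open>B\<^bsup>(j)\<^esup>\<close>. If \<open>x\<^sub>j \<in> P\<^bsub>j+1\<^esub>\<close> it is \<open>f\<close> composed with the isomorphism
  \<open>B\<^bsup>(j)\<^esup> \<cong> B\<^bsup>(j+1)\<^esup>\<close> induced by \<open>g\<^sub>j\<close>, which sends the class of \<open>a\<close> to the class of any
  representative of \<open>g\<^sub>j(a)\<close>. Otherwise it is the restriction to \<open>B\<^bsup>(j)\<^esup> \<subseteq> \<Omega>/\<Theta>\<close> of the unique
  extension of \<open>f\<close> to the localisation \<open>\<Omega>/\<Theta>\<close> of \<open>B\<^bsup>(j+1)\<^esup>\<close> at the powers of the image of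
  \<open>x\<^sub>j\<close>: the class of \<open>a = b x\<^sub>j\<^bsup>-n\<^esup>\<close> goes to \<open>f(b) f(x\<^sub>j)\<^bsup>-n\<^esup>\<close>.
\<close>

definition ident_step ::
    "('k::field, 'f::division_ring) qna \<Rightarrow> 'f set \<Rightarrow> nat \<Rightarrow> ('f set \<Rightarrow> 'g::division_ring) \<Rightarrow> 'f set \<Rightarrow> 'g"
  where "ident_step D P j f C =
    (let x = gen D (j + 1) j;
         cls = (\<lambda>b. prime_at D P (j + 1) +>\<^bsub>alg D (j + 1)\<^esub> b) in
     if x \<in> prime_at D P (j + 1)
     then (THE v. \<exists>a\<in>C. \<exists>b\<in>g_map D j a. v = f (cls b))
     else (THE v. \<exists>a\<in>C. \<exists>b\<in>carrier (alg D (j + 1)). \<exists>n.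
             a = b * inverse x ^ n \<and> v = f (cls b) * inverse (f (cls x)) ^ n))"

text \<open>
  The embedding of \<open>B\<^bsup>(2)\<^esup> = A'/\<psi>(P)\<close> obtained from an embedding \<open>f\<close> of \<open>A/P\<close> into its
  division ring of fractions.
\<close>

definition ident ::
    "('k::field, 'f::division_ring) qna \<Rightarrow> 'f set \<Rightarrow> ('f set \<Rightarrow> 'g::division_ring) \<Rightarrow> 'f set \<Rightarrow> 'g"
  where "ident D P f = fold (ident_step D P) (rev [2..<num D + 1]) f"

definition root_of_unity :: "'k::field \<Rightarrow> bool"
  where "root_of_unity c \<longleftrightarrow> (\<exists>n>0. c ^ n = 1)"

end

(* Write x_i = X_i^(j+1) and y_i = X_i^(j). For l < j, y_l = theta(X_l), where
   theta(a) = sum_n c_n d_n(sigma^-n(a)) x_j^-n satisfies x_j theta(a) = theta(sigma(a)) x_j.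
   Multiplicativity of theta follows at once from this relation, and nilpotency gives an inverse
   formula, so A^(j) and A^(j+1) have the same localisation at the powers of x_j.

   All quotients A^(j)/P_j then become subrings R_j of Frac(A/P). Either R_j = R_{j+1}, or the two
   have the same localisation at the powers of the image of x_j. Since x_j = T_j, the element
   inverted in the second case is some t_j with j not in w, which is a unit of
   M = (A'/Q) Sigma^-1. Hence M is a localisation of every R_j, and Gamma may be taken to be the set
   of all elements of A/P that are units of M. If the lambda_{i,j} are roots of unity, then a common
   power of the t_i is central, so that M lies in the span of finitely many monomials over the
   centre of Frac(A/P), and a standard identity holds. *)
theory Submission
  imports Defs "HOL-Combinatorics.Permutations"
begin

section \<open>Subalgebras and algebra homomorphisms\<close>

text \<open>Since \<open>q\<close> may be a root of unity, no q-factorial may be inverted. The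
  coefficients satisfy c_(n+1) (q - 1) = c_n q^(n+1), and this suffices for \<theta> to commute with
  x_j up to \<sigma>. The map g_j is specified by a choice, so its existence has to be proved,
  although A^(j) is not presented by generators and relations. The way out is an invariant kept at
  every stage: the powers of each later generator are left independent over the algebra of the
  preceding ones. Then g_j can be built one generator at a time, as a relation between elements and
  representatives. Conjugation by x_j preserves A^(j), but it need not preserve A^(j+1), where x_j
  still carries a derivation. This makes clearing denominators harder in one direction than in the
  other. No Ore set is carried from stage to stage: every R_j uses as denominators those of its
  elements that are units of one fixed M. With the whole division ring in place of M, and the stages
  run in the opposite order, the same argument gives (iii). In the torus, inverses need no new
  monomials, because t_i^-1 = t_i^(n-1) (t_i^n)^-1 with t_i^n central.\<close>

lemma subalg_hull [simp]: "subalg s (subalg s hull S)"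
  by (rule hull_in) (auto simp: subalg_def)

lemma subalg_hull_induct [consumes 1, case_names gen one add mult scale]:
  assumes "x \<in> subalg s hull S"
    and "\<And>x. x \<in> S \<Longrightarrow> P x"
    and "P 1"
    and "\<And>x y. x \<in> subalg s hull S \<Longrightarrow> y \<in> subalg s hull S \<Longrightarrow> P x \<Longrightarrow> P y \<Longrightarrow> P (x + y)"
    and "\<And>x y. x \<in> subalg s hull S \<Longrightarrow> y \<in> subalg s hull S \<Longrightarrow> P x \<Longrightarrow> P y \<Longrightarrow> P (x * y)"
    and "\<And>c x. x \<in> subalg s hull S \<Longrightarrow> P x \<Longrightarrow> P (s c x)"
  shows "P x"
proof -
  have "subalg s hull S \<subseteq> {x \<in> subalg s hull S. P x}"
    using subalg_hull[of s S]
    by (intro hull_minimal) (auto intro: assms hull_inc simp: subalg_def)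
  with assms(1) show ?thesis by blast
qed

text \<open>The target is the whole ambient ring, because the copies of an algebra made at later
  stages need not lie inside the algebra itself.\<close>

definition alg_hom :: "('k::field \<Rightarrow> 'f::ring_1 \<Rightarrow> 'f) \<Rightarrow> 'f set \<Rightarrow> ('f \<Rightarrow> 'f) \<Rightarrow> bool"
  where "alg_hom s R h \<longleftrightarrow> h 1 = 1 \<and>
    (\<forall>a\<in>R. \<forall>b\<in>R. h (a + b) = h a + h b \<and> h (a * b) = h a * h b) \<and> (\<forall>c. \<forall>a\<in>R. h (s c a) = s c (h a))"

lemma alg_hom_iff:
  "alg_hom s R h \<longleftrightarrow> h \<in> ring_hom (ring_of R) (ring_of UNIV) \<and> K_linear_on s R h"
  by (auto simp: alg_hom_def ring_hom_def ring_of_def K_linear_on_def)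

lemma alg_hom_subset: "alg_hom s R h \<Longrightarrow> R' \<subseteq> R \<Longrightarrow> alg_hom s R' h"
  unfolding alg_hom_def by blast

lemma alg_hom_eqI:
  assumes "alg_hom s (subalg s hull S) g" "alg_hom s (subalg s hull S) h"
    and "\<And>x. x \<in> S \<Longrightarrow> g x = h x" "a \<in> subalg s hull S"
  shows "g a = h a"
  using assms(4)
  by (induction rule: subalg_hull_induct) (use assms(1-3) in \<open>auto simp: alg_hom_def\<close>)

lemma alg_hom_image_hull:
  assumes "alg_hom s (subalg s hull S) h"
  shows "h ` (subalg s hull S) = subalg s hull (h ` S)"
proof
  show "h ` (subalg s hull S) \<subseteq> subalg s hull (h ` S)"
  proof safe
    fix a assume "a \<in> subalg s hull S"
    then show "h a \<in> subalg s hull (h ` S)"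
    proof (induction rule: subalg_hull_induct)
      case (gen x) then show ?case by (auto intro: hull_inc)
    qed (use assms subalg_hull[of s "h ` S", unfolded subalg_def[of s "subalg s hull (h ` S)"]]
        in \<open>auto simp: alg_hom_def\<close>)
  qed
  have "subalg s (h ` (subalg s hull S))"
  proof -
    note A = assms[unfolded alg_hom_def] and S = subalg_hull[of s S, unfolded subalg_def[of s "subalg s hull S"]]
    have "1 \<in> h ` (subalg s hull S)" using A S by (metis imageI)
    moreover have "h a + h b \<in> h ` (subalg s hull S) \<and> h a * h b \<in> h ` (subalg s hull S) \<and>
        s c (h a) \<in> h ` (subalg s hull S)"
      if ab: "a \<in> subalg s hull S" "b \<in> subalg s hull S" for a b c
    proof -
      have "h (a + b) = h a + h b" "h (a * b) = h a * h b" "h (s c a) = s c (h a)" using A ab by simp_all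
      moreover have "a + b \<in> subalg s hull S" "a * b \<in> subalg s hull S" "s c a \<in> subalg s hull S"
        using S ab by simp_all
      ultimately show ?thesis by (metis imageI)
    qed
    ultimately show ?thesis unfolding subalg_def[of s "h ` _"] by blast
  qed
  then show "subalg s hull (h ` S) \<subseteq> h ` (subalg s hull S)"
    by (intro hull_minimal) (auto intro: hull_inc)
qed

text \<open>The uniqueness half of freeness over \<open>R\<close>. It makes maps given by expansions
  in powers of \<open>x\<close> well defined; that such maps are total will follow from
  generation.\<close>

definition pow_indep :: "'f::ring_1 set \<Rightarrow> 'f \<Rightarrow> bool"
  where "pow_indep R x \<longleftrightarrow> (\<forall>m a. (\<forall>n. a n \<in> R) \<longrightarrow> (\<Sum>n<m. a n * x ^ n) = 0 \<longrightarrow> (\<forall>n<m. a n = 0))"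

lemma pow_indepD:
  "pow_indep R x \<Longrightarrow> (\<And>n. a n \<in> R) \<Longrightarrow> (\<Sum>n<m. a n * x ^ n) = 0 \<Longrightarrow> n < m \<Longrightarrow> a n = 0"
  unfolding pow_indep_def by blast

section \<open>Central elements of a division ring and q-commutation\<close>

lemma centre_iff: "z \<in> centre UNIV \<longleftrightarrow> (\<forall>d. z * d = d * z)"
  by (simp add: centre_def)

lemma centreD: "z \<in> centre UNIV \<Longrightarrow> z * d = d * z"
  by (simp add: centre_iff)

lemma centre_left_commute: "z \<in> centre UNIV \<Longrightarrow> a * (z * b) = z * (a * b)"
  by (metis centreD mult.assoc)

lemma centre_closed:
  shows "0 \<in> centre UNIV" "1 \<in> centre UNIV"
    and "y \<in> centre UNIV \<Longrightarrow> z \<in> centre UNIV \<Longrightarrow> y * z \<in> centre UNIV"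
    and "z \<in> centre UNIV \<Longrightarrow> z ^ n \<in> centre UNIV"
    and "z \<in> centre UNIV \<Longrightarrow> inverse z \<in> centre (UNIV :: 'g::division_ring set)"
proof -
  show "0 \<in> centre UNIV" and 1: "1 \<in> centre UNIV" by (simp_all add: centre_iff)
  show 2: "y \<in> centre UNIV \<Longrightarrow> z \<in> centre UNIV \<Longrightarrow> y * z \<in> centre UNIV" for y z :: 'g
    unfolding centre_iff[of "y * z"] using centreD[of z] centre_left_commute[of y] by (simp add: mult.assoc)
  show "z \<in> centre UNIV \<Longrightarrow> z ^ n \<in> centre UNIV" by (induction n) (use 1 2 in auto)
  show "inverse z \<in> centre UNIV" if "z \<in> centre UNIV" for z :: 'g
  proof (cases "z = 0")
    case True then show ?thesis by (simp add: centre_iff)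
  next
    case False
    have "inverse z * d = d * inverse z" for d
    proof -
      have "inverse z * d = inverse z * (d * z) * inverse z" using False by (simp add: mult.assoc)
      also have "\<dots> = inverse z * (z * d) * inverse z" using centreD[OF that] by simp
      also have "\<dots> = d * inverse z" using False by (simp add: mult.assoc[symmetric])
      finally show ?thesis .
    qed
    then show ?thesis by (simp add: centre_iff)
  qed
qed

text \<open>The factor is a central element rather than a scalar, so that the rule also applies in
  Frac(A/P), a division ring without a declared scalar multiplication.\<close>

lemma q_commute_power:
  assumes uv: "u * v = z * (v * u)" and z: "z \<in> centre UNIV"
  shows "u ^ n * v ^ m = z ^ (n * m) * (v ^ m * u ^ n)"
proof -
  note lc = centre_left_commute[OF centre_closed(4)[OF z]]
  have 1: "u * v ^ m = z ^ m * (v ^ m * u)" for m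
  proof (induction m)
    case (Suc m)
    have "u * v ^ Suc m = z * (v * (u * v ^ m))" by (simp add: mult.assoc[symmetric] uv)
    then show ?case by (simp add: Suc lc mult.assoc)
  qed simp
  show ?thesis
  proof (induction n)
    case (Suc n)
    have "u ^ Suc n * v ^ m = z ^ (n * m) * (u * v ^ m * u ^ n)" by (simp add: mult.assoc Suc lc)
    then show ?case by (simp add: 1 mult.assoc[symmetric] power_add[symmetric] add.commute)
  qed simp
qed

section \<open>Algebras over a field inside a division ring\<close>

locale k_algebra =
  fixes s :: "'k::field \<Rightarrow> 'f::division_ring \<Rightarrow> 'f"
  assumes K_algebra: "K_algebra s"
begin

sublocale vector_space s
  using K_algebra by (simp add: K_algebra_def)

lemma mult_scale_left: "s c x * y = s c (x * y)"
  and mult_scale_right: "x * s c y = s c (x * y)"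
  using K_algebra by (metis K_algebra_def)+

lemmas mult_scale = mult_scale_left mult_scale_right

lemma scale_power: "(s c x) ^ n = s (c ^ n) (x ^ n)"
  by (induction n) (auto simp: mult_scale)

lemma scale_commute_power:
  assumes "u * v = s c (v * u)"
  shows "u ^ n * v ^ m = s (c ^ (n * m)) (v ^ m * u ^ n)"
proof -
  have "s c 1 \<in> centre UNIV" by (simp add: centre_iff mult_scale)
  then show ?thesis
    using q_commute_power[of u v "s c 1" n m] assms by (simp add: mult_scale scale_power)
qed

lemma subalgD:
  assumes "subalg s R"
  shows "1 \<in> R" "0 \<in> R" "a \<in> R \<Longrightarrow> b \<in> R \<Longrightarrow> a + b \<in> R" "a \<in> R \<Longrightarrow> b \<in> R \<Longrightarrow> a * b \<in> R"
    "a \<in> R \<Longrightarrow> s c a \<in> R" "a \<in> R \<Longrightarrow> - a \<in> R" "a \<in> R \<Longrightarrow> b \<in> R \<Longrightarrow> a - b \<in> R" "a \<in> R \<Longrightarrow> a ^ n \<in> R"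
proof -
  note A = assms[unfolded subalg_def]
  show 1: "1 \<in> R" "a \<in> R \<Longrightarrow> b \<in> R \<Longrightarrow> a + b \<in> R" "a \<in> R \<Longrightarrow> b \<in> R \<Longrightarrow> a * b \<in> R" for a b
    using A by auto
  show 2: "a \<in> R \<Longrightarrow> s c a \<in> R" for a c using A by auto
  show "0 \<in> R" using 2[OF 1(1), of 0] by simp
  show 3: "a \<in> R \<Longrightarrow> - a \<in> R" for a using 2[of a "-1"] by simp
  show "a \<in> R \<Longrightarrow> b \<in> R \<Longrightarrow> a - b \<in> R" using 1(2)[of a "-b"] 3[of b] by simp
  show "a \<in> R \<Longrightarrow> a ^ n \<in> R" by (induction n) (auto intro: 1)
qed

lemma subalg_sum: "subalg s R \<Longrightarrow> (\<And>i. i \<in> I \<Longrightarrow> f i \<in> R) \<Longrightarrow> sum f I \<in> R"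
  by (induction I rule: infinite_finite_induct) (auto intro: subalgD)

lemma alg_hom_zero: "alg_hom s R h \<Longrightarrow> subalg s R \<Longrightarrow> h 0 = 0"
  unfolding alg_hom_def using subalgD(1)[of R] by (metis scale_zero_left)

lemma alg_hom_diff: "alg_hom s R h \<Longrightarrow> subalg s R \<Longrightarrow> a \<in> R \<Longrightarrow> b \<in> R \<Longrightarrow> h (a - b) = h a - h b"
  unfolding alg_hom_def by (metis subalgD(7) add_diff_cancel diff_add_cancel)

lemma alg_hom_sum:
  "alg_hom s R h \<Longrightarrow> subalg s R \<Longrightarrow> (\<And>i. i \<in> I \<Longrightarrow> f i \<in> R) \<Longrightarrow> h (sum f I) = (\<Sum>i\<in>I. h (f i))"
proof (induction I rule: infinite_finite_induct)
  case (insert i I)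
  then have "sum f I \<in> R" by (auto intro: subalg_sum)
  then show ?case using insert by (auto simp: alg_hom_def)
qed (auto simp: alg_hom_zero)

lemma alg_hom_power: "alg_hom s R h \<Longrightarrow> subalg s R \<Longrightarrow> a \<in> R \<Longrightarrow> h (a ^ n) = h a ^ n"
  by (induction n) (auto simp: alg_hom_def subalgD)

end

lemma sum_nonzero_index_eq:
  fixes f :: "nat \<Rightarrow> 'a::comm_monoid_add"
  assumes "\<And>n. n \<ge> m \<Longrightarrow> t n = 0" "\<And>n. t n = (0::'b::zero) \<Longrightarrow> f n = 0"
  shows "(\<Sum>n | t n \<noteq> 0. f n) = (\<Sum>n<m. f n)"
  by (rule sum.mono_neutral_left) (use assms in \<open>auto simp: not_le[symmetric]\<close>)

section \<open>The deleting derivations homomorphism\<close>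

text \<open>One deletion step with \<open>R\<close> the original A_(j-1). The maps
  \<open>\<sigma>\<close> and \<open>d\<close> stay on \<open>R\<close>; \<open>h\<close> carries
  their values to the copy of \<open>R\<close> present at the current stage, where \<open>x\<close>
  lives.\<close>

locale skew_step = k_algebra s for s :: "'k::field \<Rightarrow> 'f::division_ring \<Rightarrow> 'f" +
  fixes R :: "'f set" and \<sigma> \<delta> :: "'f \<Rightarrow> 'f" and d :: "nat \<Rightarrow> 'f \<Rightarrow> 'f" and q :: 'k
    and h :: "'f \<Rightarrow> 'f" and x :: 'f
  assumes subalg: "subalg s R"
    and \<sigma>_iso: "\<sigma> \<in> ring_iso (ring_of R) (ring_of R)" and \<sigma>_lin: "K_linear_on s R \<sigma>"
    and hsd: "higher_skew_derivation s R q \<sigma> \<delta> d"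
    and nilpotent: "locally_nilpotent R d" and iter: "iterative s R q d"
    and q: "q \<noteq> 0" "q \<noteq> 1"
    and h: "alg_hom s R h"
    and x: "x \<noteq> 0" and x_comm: "\<And>r. r \<in> R \<Longrightarrow> x * h r = h (\<sigma> r) * x + h (\<delta> r)"
begin

definition \<sigma>i where "\<sigma>i = inv_into R \<sigma>"
definition c :: "nat \<Rightarrow> 'k" where "c n = q ^ (n * (n + 1) div 2) * inverse ((q - 1) ^ n)"
definition t where "t n a = d n ((\<sigma>i ^^ n) a)"
definition \<theta> where "\<theta> a = (\<Sum>n | t n a \<noteq> 0. s (c n) (h (t n a) * inverse x ^ n))"
text \<open>An explicit bound, so that sums for several elements can share one finite range.\<close>

definition nilp where "nilp a m \<longleftrightarrow> a \<in> R \<and> (\<forall>n\<ge>m. d n a = 0)"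

lemmas R = subalgD[OF subalg]

lemma bij: "bij_betw \<sigma> R R" and \<sigma>_add: "a \<in> R \<Longrightarrow> b \<in> R \<Longrightarrow> \<sigma> (a + b) = \<sigma> a + \<sigma> b"
  and \<sigma>_mult: "a \<in> R \<Longrightarrow> b \<in> R \<Longrightarrow> \<sigma> (a * b) = \<sigma> a * \<sigma> b" and \<sigma>_one: "\<sigma> 1 = 1"
  and \<sigma>_scale: "a \<in> R \<Longrightarrow> \<sigma> (s k a) = s k (\<sigma> a)"
  using \<sigma>_iso \<sigma>_lin by (auto simp: ring_iso_def ring_hom_def ring_of_def K_linear_on_def)

lemma \<sigma>_in [simp, intro]: "a \<in> R \<Longrightarrow> \<sigma> a \<in> R"
  and \<sigma>i_in [simp, intro]: "a \<in> R \<Longrightarrow> \<sigma>i a \<in> R"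
  and \<sigma>_\<sigma>i [simp]: "a \<in> R \<Longrightarrow> \<sigma> (\<sigma>i a) = a"
  and \<sigma>i_\<sigma> [simp]: "a \<in> R \<Longrightarrow> \<sigma>i (\<sigma> a) = a"
  using bij unfolding bij_betw_def \<sigma>i_def
  by (auto intro: inv_into_into simp: f_inv_into_f)

lemma \<sigma>i_eqI: "a \<in> R \<Longrightarrow> \<sigma> a = b \<Longrightarrow> \<sigma>i b = a"
  by auto

lemma \<sigma>i_add: "a \<in> R \<Longrightarrow> b \<in> R \<Longrightarrow> \<sigma>i (a + b) = \<sigma>i a + \<sigma>i b"
  and \<sigma>i_mult: "a \<in> R \<Longrightarrow> b \<in> R \<Longrightarrow> \<sigma>i (a * b) = \<sigma>i a * \<sigma>i b"
  and \<sigma>i_scale: "a \<in> R \<Longrightarrow> \<sigma>i (s k a) = s k (\<sigma>i a)"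
  by (auto intro!: \<sigma>i_eqI simp: \<sigma>_add \<sigma>_mult \<sigma>_one \<sigma>_scale R)

lemma \<sigma>n_in [simp, intro]: "a \<in> R \<Longrightarrow> (\<sigma> ^^ n) a \<in> R"
  and \<sigma>in_in [simp, intro]: "a \<in> R \<Longrightarrow> (\<sigma>i ^^ n) a \<in> R"
  by (induction n) auto

lemma \<sigma>in_add: "a \<in> R \<Longrightarrow> b \<in> R \<Longrightarrow> (\<sigma>i ^^ n) (a + b) = (\<sigma>i ^^ n) a + (\<sigma>i ^^ n) b"
  and \<sigma>in_mult: "a \<in> R \<Longrightarrow> b \<in> R \<Longrightarrow> (\<sigma>i ^^ n) (a * b) = (\<sigma>i ^^ n) a * (\<sigma>i ^^ n) b"
  and \<sigma>in_scale: "a \<in> R \<Longrightarrow> (\<sigma>i ^^ n) (s k a) = s k ((\<sigma>i ^^ n) a)"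
  by (induction n) (auto simp: \<sigma>i_add \<sigma>i_mult \<sigma>i_scale)

lemma \<sigma>n_\<sigma>in: "a \<in> R \<Longrightarrow> (\<sigma> ^^ n) ((\<sigma>i ^^ (n + m)) a) = (\<sigma>i ^^ m) a"
proof (induction n)
  case (Suc n)
  have "(\<sigma> ^^ Suc n) ((\<sigma>i ^^ (Suc n + m)) a) = (\<sigma> ^^ n) (\<sigma> (\<sigma>i ((\<sigma>i ^^ (n + m)) a)))"
    by (simp only: funpow_Suc_right[of n \<sigma>] o_apply add_Suc funpow.simps(2)[of _ \<sigma>i])
  then show ?case using Suc by simp
qed simp

lemma \<sigma>_zero: "\<sigma> 0 = 0" and \<sigma>i_zero: "\<sigma>i 0 = 0"
  using \<sigma>_scale[of 1 0] \<sigma>i_scale[of 1 0] R by auto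

lemma d_in [simp, intro]: "a \<in> R \<Longrightarrow> d n a \<in> R"
  and d_add: "a \<in> R \<Longrightarrow> b \<in> R \<Longrightarrow> d n (a + b) = d n a + d n b"
  and d_scale: "a \<in> R \<Longrightarrow> d n (s k a) = s k (d n a)"
  and d_0: "a \<in> R \<Longrightarrow> d 0 a = a" and d_1: "a \<in> R \<Longrightarrow> d (Suc 0) a = \<delta> a"
  and d_mult: "a \<in> R \<Longrightarrow> b \<in> R \<Longrightarrow> d n (a * b) = (\<Sum>i\<le>n. (\<sigma> ^^ (n - i)) (d i a) * d (n - i) b)"
  and d_\<sigma>: "a \<in> R \<Longrightarrow> d n (\<sigma> a) = s (q ^ n) (\<sigma> (d n a))"
  using hsd by (auto simp: higher_skew_derivation_def K_linear_on_def image_subset_iff)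

lemma d_d: "a \<in> R \<Longrightarrow> d n (d m a) = s (qbinom q (n + m) m) (d (n + m) a)"
  using iter by (auto simp: iterative_def)

lemma \<delta>_in [simp, intro]: "a \<in> R \<Longrightarrow> \<delta> a \<in> R"
  by (metis d_in d_1)

lemma h_add: "a \<in> R \<Longrightarrow> b \<in> R \<Longrightarrow> h (a + b) = h a + h b"
  and h_mult: "a \<in> R \<Longrightarrow> b \<in> R \<Longrightarrow> h (a * b) = h a * h b"
  and h_one: "h 1 = 1" and h_scale: "a \<in> R \<Longrightarrow> h (s k a) = s k (h a)"
  using h by (auto simp: alg_hom_def)

lemma h_zero: "h 0 = 0"
  using h subalg by (rule alg_hom_zero)

lemmas h_sum = alg_hom_sum[OF h subalg]

lemma d_\<sigma>i: "a \<in> R \<Longrightarrow> d n (\<sigma>i a) = s (inverse (q ^ n)) (\<sigma>i (d n a))"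
proof -
  assume a: "a \<in> R"
  have "\<sigma>i (d n a) = \<sigma>i (d n (\<sigma> (\<sigma>i a)))" using a by simp
  also have "\<dots> = s (q ^ n) (d n (\<sigma>i a))" using a by (subst d_\<sigma>) (auto simp: \<sigma>i_scale)
  finally show ?thesis using q by simp
qed

lemma d_\<sigma>n: "a \<in> R \<Longrightarrow> d i ((\<sigma> ^^ k) a) = s (q ^ (i * k)) ((\<sigma> ^^ k) (d i a))"
  by (induction k) (auto simp: d_\<sigma> \<sigma>_scale power_add)

lemma nilp_in: "nilp a m \<Longrightarrow> a \<in> R"
  by (simp add: nilp_def)

lemma nilp_ex: "a \<in> R \<Longrightarrow> \<exists>m. nilp a m"
  using nilpotent by (auto simp: nilp_def locally_nilpotent_def)

lemma nilp_mono: "nilp a m \<Longrightarrow> m \<le> m' \<Longrightarrow> nilp a m'"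
  by (auto simp: nilp_def)

lemma nilp_\<sigma>: "nilp a m \<Longrightarrow> nilp (\<sigma> a) m"
  by (auto simp: nilp_def d_\<sigma> \<sigma>_zero)

lemma nilp_\<sigma>i: "nilp a m \<Longrightarrow> nilp (\<sigma>i a) m"
  by (auto simp: nilp_def d_\<sigma>i \<sigma>i_zero)

lemma nilp_\<sigma>in: "nilp a m \<Longrightarrow> nilp ((\<sigma>i ^^ k) a) m"
  by (induction k) (auto simp: nilp_\<sigma>i)

text \<open>Iterativity makes \<open>d n (d k a)\<close> a multiple of \<open>d (n + k) a\<close>.
  This drop of the bound drives the induction that inverts \<open>\<theta>\<close>.\<close>

lemma nilp_d: "nilp a m \<Longrightarrow> nilp (d k a) (m - k)"
  by (auto simp: nilp_def d_d)

lemma nilp_zero: "nilp a 0 \<Longrightarrow> a = 0"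
  using d_0[of a] unfolding nilp_def by (metis zero_le)

lemma nilp_mult: "nilp a m \<Longrightarrow> nilp b m \<Longrightarrow> nilp (a * b) (m + m)"
proof -
  assume *: "nilp a m" "nilp b m"
  have "(\<sigma> ^^ k) 0 = 0" for k by (induction k) (auto simp: \<sigma>_zero)
  moreover have "i \<ge> m \<or> n - i \<ge> m" if "n \<ge> m + m" for i n :: nat using that by arith
  ultimately show ?thesis
    using * by (auto simp: nilp_def d_mult R intro!: sum.neutral) (metis mult_zero_left mult_zero_right)
qed

lemma t_in [simp, intro]: "a \<in> R \<Longrightarrow> t n a \<in> R"
  by (auto simp: t_def)

lemma t_nilp: "nilp a m \<Longrightarrow> n \<ge> m \<Longrightarrow> t n a = 0"
  using nilp_\<sigma>in[of a m n] by (auto simp: t_def nilp_def)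

lemma t_0: "a \<in> R \<Longrightarrow> t 0 a = a"
  by (simp add: t_def d_0)

lemma c_0 [simp]: "c 0 = 1"
  by (simp add: c_def)

lemma \<theta>_eq: "nilp a m \<Longrightarrow> \<theta> a = (\<Sum>n<m. s (c n) (h (t n a) * inverse x ^ n))"
  unfolding \<theta>_def by (rule sum_nonzero_index_eq) (auto simp: t_nilp h_zero)

lemma \<theta>_add:
  assumes "a \<in> R" "b \<in> R"
  shows "\<theta> (a + b) = \<theta> a + \<theta> b"
proof -
  obtain m1 m2 where "nilp a m1" "nilp b m2" using assms nilp_ex by meson
  then have m: "nilp a (max m1 m2)" "nilp b (max m1 m2)" using nilp_mono by fastforce+
  then have "nilp (a + b) (max m1 m2)" by (auto simp: nilp_def R d_add)
  then show ?thesis using m assms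
    by (simp add: \<theta>_eq t_def \<sigma>in_add d_add h_add distrib_right scale_right_distrib sum.distrib)
qed

lemma \<theta>_scale:
  assumes "a \<in> R"
  shows "\<theta> (s k a) = s k (\<theta> a)"
proof -
  obtain m where m: "nilp a m" using assms nilp_ex by meson
  then have "nilp (s k a) m" using assms by (auto simp: nilp_def R d_scale)
  then show ?thesis using m assms
    by (simp add: \<theta>_eq t_def \<sigma>in_scale d_scale h_scale mult_scale scale_sum_right mult.commute)
qed

text \<open>Expanding 1 = 1 * 1 by the twisted Leibniz rule, the induction hypothesis kills the
  middle terms and leaves d_n(1) = d_n(1) + d_n(1).\<close>

lemma d_one: "n > 0 \<Longrightarrow> d n 1 = 0"
proof (induction n rule: less_induct)
  case (less n)
  have z: "(\<sigma> ^^ k) 0 = 0" for k by (induction k) (auto simp: \<sigma>_zero)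
  have o: "(\<sigma> ^^ k) 1 = 1" for k by (induction k) (auto simp: \<sigma>_one)
  have "d n 1 = d n (1 * 1)" by simp
  also have "\<dots> = (\<Sum>i\<le>n. (\<sigma> ^^ (n - i)) (d i 1) * d (n - i) 1)"
    by (rule d_mult) (auto simp: R)
  also have "\<dots> = (\<Sum>i\<in>{0, n}. (\<sigma> ^^ (n - i)) (d i 1) * d (n - i) 1)"
    by (rule sum.mono_neutral_right) (use less in \<open>auto simp: z\<close>)
  also have "\<dots> = d n 1 + d n 1" using less.prems by (auto simp: d_0 R o)
  finally show ?case by simp
qed

lemma \<theta>_one: "\<theta> 1 = 1"
proof -
  have "nilp 1 1" by (auto simp: nilp_def R d_one)
  then show ?thesis by (simp add: \<theta>_eq t_0 R h_one)
qed

section \<open>Gaussian binomials and the coefficients of the deleting derivations map\<close>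

lemma qbinom_gt: "m > n \<Longrightarrow> qbinom q n m = 0"
  by (induction q n m rule: qbinom.induct) auto

lemma qbinom_n_n: "qbinom q n n = 1"
  by (induction n) (simp_all add: qbinom_gt)

text \<open>The coefficient is the q-integer 1 + q + ... + q^n, which is all that iterativity
  contributes when \<open>d 1\<close> meets \<open>d n\<close>.\<close>

lemma qbinom_Suc_self: "qbinom q (Suc n) n * (q - 1) = q ^ Suc n - 1"
proof (induction n)
  case 0 then show ?case by simp
next
  case (Suc n)
  have "qbinom q (Suc (Suc n)) (Suc n) = qbinom q (Suc n) n + q ^ Suc n"
    by (simp add: qbinom_n_n qbinom_gt)
  then show ?case using Suc by (simp add: algebra_simps)
qed

text \<open>The origin of \<open>c\<close>: this recursion with \<open>c 0 = 1\<close> determines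
  it, and it is what the comparison of coefficients in \<open>\<theta>_coeff\<close> needs. It
  divides by q - 1 only, never by a q-integer that could vanish.\<close>

lemma c_Suc: "c (Suc n) * (q - 1) = c n * q ^ Suc n"
proof -
  have "Suc n * (Suc n + 1) div 2 = n * (n + 1) div 2 + Suc n" by simp
  then show ?thesis using q by (simp add: c_def power_add field_simps)
qed

text \<open>The exponent n(n + 1)/2 is quadratic, so a cross term q^(i m) appears. It pays for
  moving \<open>d i\<close> past \<open>\<sigma>^m\<close> in the proof of multiplicativity.\<close>

lemma c_add: "c (i + m) = c i * c m * q ^ (i * m)"
proof -
  have "(i + m) * (i + m + 1) = i * (i + 1) + m * (m + 1) + 2 * (i * m)" by (simp add: algebra_simps)
  moreover obtain a b where "i * (i + 1) = 2 * a" "m * (m + 1) = 2 * b"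
    by (metis dvd_def even_mult_iff even_plus_one_iff)
  ultimately have "(i + m) * (i + m + 1) div 2 = i * (i + 1) div 2 + m * (m + 1) div 2 + i * m"
    by simp
  then show ?thesis by (simp add: c_def power_add algebra_simps)
qed

text \<open>Compares the coefficients of \<open>x\<^bsup>-n\<^esup>\<close> in \<open>x \<theta>(a)\<close> and \<open>\<theta>(\<sigma>(a)) x\<close>.\<close>

lemma \<theta>_coeff:
  assumes a: "a \<in> R"
  shows "s (c (Suc n)) (\<sigma> (t (Suc n) a)) + s (c n) (\<delta> (t n a)) = s (c (Suc n)) (t (Suc n) (\<sigma> a))"
proof -
  let ?w = "\<sigma> (t (Suc n) a)"
  have t': "t (Suc n) (\<sigma> a) = s (q ^ Suc n) ?w"
  proof -
    have "t (Suc n) (\<sigma> a) = d (Suc n) ((\<sigma>i ^^ n) a)"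
      using a by (simp add: t_def funpow_swap1)
    also have "\<dots> = d (Suc n) (\<sigma> ((\<sigma>i ^^ Suc n) a))" using a by simp
    finally show ?thesis using a by (subst (asm) d_\<sigma>) (auto simp: t_def)
  qed
  have "\<delta> (t n a) = d 1 (d n ((\<sigma>i ^^ n) a))" using a by (simp add: t_def d_1)
  also have "\<dots> = s (qbinom q (Suc n) n) (d (Suc n) ((\<sigma>i ^^ n) a))" using a by (simp add: d_d)
  also have "\<dots> = s (qbinom q (Suc n) n) (d (Suc n) (\<sigma> ((\<sigma>i ^^ Suc n) a)))" using a by simp
  also have "\<dots> = s (qbinom q (Suc n) n * q ^ Suc n) ?w"
    using a by (subst d_\<sigma>) (auto simp: t_def)
  finally have \<delta>t: "\<delta> (t n a) = s (qbinom q (Suc n) n * q ^ Suc n) ?w" .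
  have "(c (Suc n) + c n * (qbinom q (Suc n) n * q ^ Suc n)) * (q - 1)
      = c (Suc n) * (q - 1) + c n * q ^ Suc n * (qbinom q (Suc n) n * (q - 1))"
    by (simp add: algebra_simps)
  also have "\<dots> = c (Suc n) * (q - 1) + c (Suc n) * (q - 1) * (q ^ Suc n - 1)"
    by (simp only: qbinom_Suc_self c_Suc)
  also have "\<dots> = c (Suc n) * q ^ Suc n * (q - 1)" by (simp add: algebra_simps)
  finally have "c (Suc n) + c n * (qbinom q (Suc n) n * q ^ Suc n) = c (Suc n) * q ^ Suc n"
    using q by simp
  then show ?thesis
    by (simp only: t' \<delta>t scale_scale scale_left_distrib[symmetric])
qed

text \<open>Moving \<open>x\<close> to the right past \<open>h\<close> yields a twisted term and a
  derivation term. The derivation term at x^-n meets the twisted term of index n + 1, whose extra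
  \<open>x\<close> has cancelled one denominator, and \<open>\<theta>_coeff\<close> adds the
  two.\<close>

lemma x_\<theta>:
  assumes a: "a \<in> R"
  shows "x * \<theta> a = \<theta> (\<sigma> a) * x"
proof -
  obtain m where m: "nilp a m" using a nilp_ex by meson
  \<comment> \<open>One surplus index: after shifting, the twisted sum runs over n < m, and the
    derivation sum loses its last term because \<open>t m a = 0\<close>.\<close>
  then have m1: "nilp a (Suc m)" and m2: "nilp (\<sigma> a) (Suc m)" using nilp_mono nilp_\<sigma> by (meson le_SucI order_refl)+
  let ?y = "inverse x"
  have xy: "h r * ?y ^ n * x = h r * x * ?y ^ n" for r n
    using power_commuting_commutes[of ?y x n] x by (simp add: mult.assoc)
  have xyS: "r * x * ?y ^ Suc n = r * ?y ^ n" for r n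
    using x by (simp add: mult.assoc[symmetric]) (simp add: mult.assoc)
  have "x * \<theta> a = (\<Sum>n<Suc m. s (c n) (h (\<sigma> (t n a)) * x * ?y ^ n)) + (\<Sum>n<Suc m. s (c n) (h (\<delta> (t n a)) * ?y ^ n))"
    unfolding \<theta>_eq[OF m1] sum_distrib_left sum.distrib[symmetric]
    by (rule sum.cong)
      (use a in \<open>simp_all add: mult_scale x_comm mult.assoc[symmetric] distrib_right scale_right_distrib\<close>)
  also have "(\<Sum>n<Suc m. s (c n) (h (\<sigma> (t n a)) * x * ?y ^ n)) =
      h (\<sigma> a) * x + (\<Sum>n<m. s (c (Suc n)) (h (\<sigma> (t (Suc n) a)) * ?y ^ n))"
    unfolding sum.lessThan_Suc_shift xyS using a by (simp add: t_0)
  also have "(\<Sum>n<Suc m. s (c n) (h (\<delta> (t n a)) * ?y ^ n)) = (\<Sum>n<m. s (c n) (h (\<delta> (t n a)) * ?y ^ n))"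
    using t_nilp[OF m, of m] d_1[of 0] d_scale[of 0 1 0] R by (simp add: h_zero)
  also have "h (\<sigma> a) * x + (\<Sum>n<m. s (c (Suc n)) (h (\<sigma> (t (Suc n) a)) * ?y ^ n)) + \<dots>
      = h (\<sigma> a) * x + (\<Sum>n<m. h (s (c (Suc n)) (\<sigma> (t (Suc n) a)) + s (c n) (\<delta> (t n a))) * ?y ^ n)"
    unfolding add.assoc sum.distrib[symmetric]
    by (intro arg_cong2[where f="(+)"] sum.cong)
      (use a in \<open>simp_all add: h_add h_scale R mult_scale distrib_right\<close>)
  also have "\<dots> = h (\<sigma> a) * x + (\<Sum>n<m. s (c (Suc n)) (h (t (Suc n) (\<sigma> a)) * ?y ^ n))"
    using a by (simp add: \<theta>_coeff h_scale mult_scale)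
  also have "\<dots> = (\<Sum>n<Suc m. s (c n) (h (t n (\<sigma> a)) * x * ?y ^ n))"
    unfolding sum.lessThan_Suc_shift xyS using a by (simp add: t_0)
  also have "\<dots> = \<theta> (\<sigma> a) * x"
    unfolding \<theta>_eq[OF m2] sum_distrib_right
    by (rule sum.cong) (simp_all add: mult_scale xy)
  finally show ?thesis .
qed

lemma inverse_x_\<theta>: "a \<in> R \<Longrightarrow> inverse x * \<theta> a = \<theta> (\<sigma>i a) * inverse x"
proof -
  assume a: "a \<in> R"
  have "inverse x * (\<theta> a * x) * inverse x = inverse x * (x * \<theta> (\<sigma>i a)) * inverse x"
    using x_\<theta>[of "\<sigma>i a"] a by simp
  then show ?thesis using x by (simp add: mult.assoc) (simp add: mult.assoc[symmetric])
qed

lemma inverse_x_power_\<theta>: "a \<in> R \<Longrightarrow> inverse x ^ n * \<theta> a = \<theta> ((\<sigma>i ^^ n) a) * inverse x ^ n"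
proof (induction n arbitrary: a)
  case (Suc n)
  have "inverse x ^ Suc n * \<theta> a = inverse x ^ n * (inverse x * \<theta> a)"
    by (simp add: power_Suc2 mult.assoc del: power_Suc)
  also have "\<dots> = inverse x ^ n * \<theta> (\<sigma>i a) * inverse x"
    using Suc.prems by (simp add: inverse_x_\<theta> mult.assoc)
  also have "\<dots> = \<theta> ((\<sigma>i ^^ n) (\<sigma>i a)) * inverse x ^ n * inverse x"
    using Suc.prems by (subst Suc.IH) auto
  also have "\<dots> = \<theta> ((\<sigma>i ^^ Suc n) a) * inverse x ^ Suc n"
    by (simp add: power_Suc2 mult.assoc funpow_Suc_right del: power_Suc funpow.simps(2))
  finally show ?case .
qed simp

text \<open>Each x^-i is moved across the whole of \<open>\<theta> b\<close>, where no derivation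
  term arises, instead of across the single coefficients of \<open>\<theta> b\<close>. What remains
  is the Leibniz rule for \<open>d n\<close>, coefficient by coefficient.\<close>

lemma \<theta>_mult:
  assumes a: "a \<in> R" and b: "b \<in> R"
  shows "\<theta> (a * b) = \<theta> a * \<theta> b"
proof -
  obtain m1 m2 where "nilp a m1" "nilp b m2" using assms nilp_ex by meson
  then obtain M where M: "nilp a M" "nilp b M" using nilp_mono max.cobounded1 max.cobounded2 by metis
  let ?y = "inverse x"
  define F where "F i m = s (c i * c m) (h (t i a) * (h (t m ((\<sigma>i ^^ i) b)) * ?y ^ (m + i)))" for i m
  have "\<theta> a * \<theta> b = (\<Sum>i<M. s (c i) (h (t i a) * (?y ^ i * \<theta> b)))"
    by (simp add: \<theta>_eq[OF M(1)] sum_distrib_right mult_scale mult.assoc)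
  also have "\<dots> = (\<Sum>i<M. s (c i) (h (t i a) * (\<theta> ((\<sigma>i ^^ i) b) * ?y ^ i)))"
    using b by (simp add: inverse_x_power_\<theta>)
  also have "\<dots> = (\<Sum>i<M. \<Sum>m<M. F i m)"
    by (simp add: \<theta>_eq[OF nilp_\<sigma>in[OF M(2)]] sum_distrib_right sum_distrib_left mult_scale
        scale_sum_right F_def power_add mult.assoc mult.commute)
  also have "\<dots> = (\<Sum>(i, m)\<in>{..<M} \<times> {..<M}. F i m)"
    by (simp add: sum.cartesian_product)
  \<comment> \<open>The square is enlarged to a triangle so that the terms can be grouped by n = i +
    m; the added terms vanish by nilpotency.\<close>
  also have "\<dots> = (\<Sum>(i, m)\<in>{(i, m). i + m < M + M}. F i m)"
  proof (rule sum.mono_neutral_left)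
    have "{(i, m). i + m < M + M} \<subseteq> {..<M+M} \<times> {..<M+M}" by auto
    then show "finite {(i, m). i + m < M + M}" by (rule finite_subset) auto
    have "F i m = 0" if "i \<ge> M \<or> m \<ge> M" for i m
      using that t_nilp[OF M(1), of i] t_nilp[OF nilp_\<sigma>in[OF M(2), of i], of m] by (auto simp: F_def h_zero)
    then show "\<forall>p\<in>{(i, m). i + m < M + M} - {..<M} \<times> {..<M}. (case p of (i, m) \<Rightarrow> F i m) = 0"
      by (auto simp: not_less[symmetric])
  qed auto
  also have "\<dots> = (\<Sum>n<M + M. \<Sum>i\<le>n. F i (n - i))"
    by (rule sum.triangle_reindex)
  also have "\<dots> = (\<Sum>n<M + M. s (c n) (h (t n (a * b)) * ?y ^ n))"
  proof (rule sum.cong)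
    fix n
    have "F i (n - i) = s (c n) (h ((\<sigma> ^^ (n - i)) (d i ((\<sigma>i ^^ n) a)) * d (n - i) ((\<sigma>i ^^ n) b)) * ?y ^ n)"
      if i: "i \<le> n" for i
    proof -
      obtain m where n: "n = m + i" using i by (metis le_add_diff_inverse2)
      have 1: "t m ((\<sigma>i ^^ i) b) = d m ((\<sigma>i ^^ n) b)" by (simp add: t_def n funpow_add)
      \<comment> \<open>Writing \<open>\<sigma>^-i\<close> as \<open>\<sigma>^m\<close> after
        \<open>\<sigma>^-n\<close> lets both factors start from \<open>\<sigma>^-n\<close>. Pulling
        \<open>\<sigma>^m\<close> out of \<open>d i\<close> costs q^(i m), exactly the factor by
        which \<open>c n\<close> differs from \<open>c i * c m\<close>.\<close>
      have "t i a = d i ((\<sigma> ^^ m) ((\<sigma>i ^^ n) a))" using a by (simp add: t_def n \<sigma>n_\<sigma>in)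
      also have "\<dots> = s (q ^ (i * m)) ((\<sigma> ^^ m) (d i ((\<sigma>i ^^ n) a)))"
        using a by (simp add: d_\<sigma>n)
      finally have 2: "t i a = s (q ^ (i * m)) ((\<sigma> ^^ m) (d i ((\<sigma>i ^^ n) a)))" .
      have 3: "c i * c m * q ^ (i * m) = c n" by (simp add: n c_add[symmetric] add.commute)
      show ?thesis
        unfolding F_def using a b i
        by (simp add: n, subst 1[unfolded n], subst 2[unfolded n])
          (simp add: h_scale h_mult mult_scale 3[unfolded n, symmetric] mult.assoc)
    qed
    then have "(\<Sum>i\<le>n. F i (n - i)) =
       (\<Sum>i\<le>n. s (c n) (h ((\<sigma> ^^ (n - i)) (d i ((\<sigma>i ^^ n) a)) * d (n - i) ((\<sigma>i ^^ n) b)) * ?y ^ n))"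
      by (intro sum.cong) auto
    also have "\<dots> = s (c n) (h (t n (a * b)) * ?y ^ n)"
      unfolding t_def using a b by (simp add: \<sigma>in_mult d_mult h_sum R sum_distrib_right scale_sum_right)
    finally show "(\<Sum>i\<le>n. F i (n - i)) = s (c n) (h (t n (a * b)) * ?y ^ n)" .
  qed simp
  also have "\<dots> = \<theta> (a * b)"
    using \<theta>_eq[OF nilp_mult[OF M]] by simp
  finally show ?thesis ..
qed

lemma alg_hom_\<theta>: "alg_hom s R \<theta>"
  by (simp add: alg_hom_def \<theta>_one \<theta>_add \<theta>_mult \<theta>_scale)

text \<open>Inversion of \<open>\<theta>\<close> by induction on the nilpotency degree: the lower terms of \<open>\<theta>(a)\<close> involve
  \<open>d\<^sub>n(\<sigma>\<^bsup>-n\<^esup>(a))\<close> with \<open>n \<ge> 1\<close>, which have a smaller degree than \<open>a\<close>.\<close>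

lemma h_in_span_\<theta>:
  assumes V: "\<And>u v. u \<in> V \<Longrightarrow> v \<in> V \<Longrightarrow> u + v \<in> V" "\<And>k u. u \<in> V \<Longrightarrow> s k u \<in> V"
    and \<theta>V: "\<And>b. b \<in> R \<Longrightarrow> \<theta> b \<in> V" and VX: "\<And>u. u \<in> V \<Longrightarrow> u * inverse x \<in> V"
    and a: "a \<in> R"
  shows "h a \<in> V"
proof -
  have "0 \<in> V" using V(2)[OF \<theta>V[OF R(1)], of 0] by simp
  have Vn: "u \<in> V \<Longrightarrow> u * inverse x ^ n \<in> V" for u n
  proof (induction n)
    case (Suc n)
    then show ?case using VX[of "u * inverse x ^ n"] by (simp only: mult.assoc power_Suc2)
  qed simp
  have VS: "(\<And>i. i \<in> I \<Longrightarrow> f i \<in> V) \<Longrightarrow> sum f I \<in> V" for I and f :: "nat \<Rightarrow> 'f"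
    by (induction I rule: infinite_finite_induct) (auto intro: V \<open>0 \<in> V\<close>)
  have "nilp a m \<Longrightarrow> h a \<in> V" for m
  proof (induction m arbitrary: a rule: less_induct)
    case (less m)
    show ?case
    proof (cases m)
      case 0
      then have "a = 0" using less.prems nilp_zero by simp
      then show ?thesis using \<open>0 \<in> V\<close> by (simp add: h_zero)
    next
      case (Suc m')
      have a: "a \<in> R" using less.prems by (rule nilp_in)
      let ?S = "\<Sum>n<m'. s (c (Suc n)) (h (t (Suc n) a) * inverse x ^ Suc n)"
      have "\<theta> a = h a + ?S"
        unfolding \<theta>_eq[OF less.prems] Suc sum.lessThan_Suc_shift using a by (simp add: t_0)
      moreover have "?S \<in> V"
      proof (rule VS, rule V(2), rule Vn, rule less.IH)
        fix n show "nilp (t (Suc n) a) (m - Suc n)"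
          using less.prems unfolding t_def by (intro nilp_d nilp_\<sigma>in)
        show "m - Suc n < m" using Suc by simp
      qed
      then have "s (-1) ?S \<in> V" by (rule V(2))
      ultimately show ?thesis using V(1)[OF \<theta>V[OF a], of "s (-1) ?S"] by simp
    qed
  qed
  then show ?thesis using nilp_ex[OF a] by blast
qed

lemma \<theta>_x_power:
  assumes "nilp a m"
  shows "\<theta> a * x ^ m = (\<Sum>n<m. s (c n) (h (t n a) * x ^ (m - n)))"
proof -
  have "inverse x ^ n * x ^ m = x ^ (m - n)" if "n < m" for n
  proof -
    have "x ^ m = x ^ n * x ^ (m - n)" using that by (simp flip: power_add)
    then show ?thesis using x by (simp add: power_inverse mult.assoc[symmetric])
  qed
  then show ?thesis
    unfolding \<theta>_eq[OF assms] sum_distrib_right by (intro sum.cong) (auto simp: mult_scale mult.assoc)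
qed

text \<open>The coefficient of the highest power of \<open>x\<close> in \<open>\<Sum>\<^sub>n \<theta>(a\<^sub>n) x\<^sup>n\<close> is \<open>h(a\<^sub>n)\<close> for the largest \<open>n\<close>.\<close>

lemma \<theta>_indep:
  assumes indep: "\<And>m a. (\<And>n. a n \<in> R) \<Longrightarrow> (\<Sum>n<m. h (a n) * x ^ n) = 0 \<Longrightarrow> \<forall>n<m. a n = 0"
    and "\<And>n. a n \<in> R" "(\<Sum>n<m. \<theta> (a n) * x ^ n) = 0"
  shows "\<forall>n<m. a n = 0"
  using assms(2,3)
proof (induction m)
  case (Suc m)
  \<comment> \<open>Polynomials in \<open>x\<close> of degree below \<open>p\<close> with
    coefficients in the copy of \<open>R\<close>: the error terms of the leading coefficient
    argument.\<close>
  define low where "low p v \<longleftrightarrow> (\<exists>b. (\<forall>n. b n \<in> R) \<and> v = (\<Sum>n<p. h (b n) * x ^ n))" for p v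
  have low_mono: "low p' v" if "low p v" "p \<le> p'" for p p' v
  proof -
    obtain b where b: "\<forall>n. b n \<in> R" "v = (\<Sum>n<p. h (b n) * x ^ n)" using \<open>low p v\<close> by (auto simp: low_def)
    have "v = (\<Sum>n<p'. h (if n < p then b n else 0) * x ^ n)"
      unfolding b(2) by (rule sum.mono_neutral_cong_left) (use that(2) in \<open>auto simp: h_zero\<close>)
    then show ?thesis unfolding low_def using b(1) R by (intro exI[of _ "\<lambda>n. if n < p then b n else 0"]) auto
  qed
  have low_add: "low p (u + v)" if uv: "low p u" "low p v" for p u v
  proof -
    obtain a b where "\<forall>n. a n \<in> R" "u = (\<Sum>n<p. h (a n) * x ^ n)" "\<forall>n. b n \<in> R" "v = (\<Sum>n<p. h (b n) * x ^ n)"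
      using uv unfolding low_def by blast
    then show ?thesis unfolding low_def
      by (intro exI[of _ "\<lambda>n. a n + b n"]) (auto simp: R h_add distrib_right sum.distrib)
  qed
  have low_0: "low p 0" for p unfolding low_def using R by (intro exI[of _ "\<lambda>n. 0"]) (auto simp: h_zero)
  have low_sum: "(\<And>i. i \<in> I \<Longrightarrow> low p (g i)) \<Longrightarrow> low p (sum g I)" for p I and g :: "nat \<Rightarrow> 'f"
    by (induction I rule: infinite_finite_induct) (auto intro: low_add low_0)
  have low_monom: "low p (h r * x ^ k)" if "r \<in> R" "k < p" for p r k
    unfolding low_def using that R
    by (intro exI[of _ "\<lambda>n. if n = k then r else 0"]) (auto simp: h_zero if_distrib if_distribR sum.delta cong: if_cong)
  obtain f where f: "\<And>n. nilp (a n) (f n)" using nilp_ex[OF Suc.prems(1)] by metis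
  \<comment> \<open>A common nilpotency bound, used as the power of \<open>x\<close> that clears all
    denominators. \<open>Suc\<close> makes it positive, so that the term of index 0, which carries
    the leading coefficient, can be split off.\<close>
  define M where "M = Suc (sum f {..m})"
  have M: "nilp (a n) M" if "n \<le> m" for n
    by (rule nilp_mono[OF f]) (use that in \<open>auto simp: M_def intro!: le_SucI member_le_sum\<close>)
  have expand: "\<theta> (a n) * x ^ n * x ^ M = (\<Sum>k<M. h (s (c k) (t k (a n))) * x ^ (n + M - k))" if "n \<le> m" for n
  proof -
    have "\<theta> (a n) * x ^ M * x ^ n = (\<Sum>k<M. h (s (c k) (t k (a n))) * x ^ (n + M - k))"
      unfolding \<theta>_x_power[OF M[OF that]] sum_distrib_right using Suc.prems(1)
      by (intro sum.cong) (auto simp: h_scale mult_scale mult.assoc power_add[symmetric] add.commute)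
    then show ?thesis by (simp add: mult.assoc power_add[symmetric] add.commute)
  qed
  have "low (m + M) (\<theta> (a n) * x ^ n * x ^ M)" if "n < m" for n
    unfolding expand[OF less_imp_le[OF that]] using that Suc.prems(1) by (intro low_sum low_monom) (auto intro: R)
  then have 1: "low (m + M) (\<Sum>n<m. \<theta> (a n) * x ^ n * x ^ M)" by (intro low_sum) auto
  define e where "e = (\<Sum>k<M - 1. h (s (c (Suc k)) (t (Suc k) (a m))) * x ^ (m + M - Suc k))"
  define v where "v = (\<Sum>n<m. \<theta> (a n) * x ^ n * x ^ M) + e"
  have "low (m + M) e"
    unfolding e_def using Suc.prems(1) by (intro low_sum low_monom) (auto intro: R simp: M_def)
  then have "low (m + M) v" unfolding v_def by (rule low_add[OF 1])
  have "\<theta> (a m) * x ^ m * x ^ M = h (a m) * x ^ (m + M) + e"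
  proof -
    obtain M' where "M = Suc M'" by (simp add: M_def)
    then show ?thesis
      unfolding expand[OF order_refl] e_def using Suc.prems(1)
      by (simp add: sum.lessThan_Suc_shift t_0 del: sum.lessThan_Suc)
  qed
  then have v: "(\<Sum>n<Suc m. \<theta> (a n) * x ^ n) * x ^ M = v + h (a m) * x ^ (m + M)"
    by (simp add: v_def distrib_right sum_distrib_right add_ac)
  obtain b where b: "\<And>n. b n \<in> R" "v = (\<Sum>n<m + M. h (b n) * x ^ n)"
    using \<open>low (m + M) v\<close> unfolding low_def by blast
  \<comment> \<open>Putting \<open>a m\<close> in the top position m + M gives a vanishing
    polynomial with coefficients in the copy of \<open>R\<close>, so its top coefficient is
    zero.\<close>
  have "(\<Sum>n<Suc (m + M). h ((b(m + M := a m)) n) * x ^ n) = 0"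
    using v b(2) Suc.prems(2) by simp
  then have "\<forall>n<Suc (m + M). (b(m + M := a m)) n = 0" by (rule indep[rotated]) (use b Suc.prems(1) in auto)
  then have am: "a m = 0" by (metis fun_upd_same lessI)
  have "\<theta> 0 = 0" using \<theta>_scale[of 1 0] R by simp
  then have "\<forall>n<m. a n = 0" using Suc.IH Suc.prems am by simp
  then show ?case using am less_Suc_eq by auto
qed simp

end

section \<open>The stages of the deleting derivations algorithm\<close>

declare One_nat_def [simp del]

text \<open>If \<open>x\<close> were in \<open>R\<close>, then (-x) * 1 + 1 * x = 0 would be a
  nontrivial relation between the powers of \<open>x\<close>.\<close>

lemma pow_indep_notin:
  assumes x: "pow_indep R x" and R: "0 \<in> R" "1 \<in> R" "\<And>a. a \<in> R \<Longrightarrow> - a \<in> R"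
  shows "x \<notin> R"
proof
  assume "x \<in> R"
  define a :: "nat \<Rightarrow> 'a" where "a n = (if n = 1 then 1 else if n = 0 then - x else 0)" for n
  have "a 1 = 0"
    by (rule pow_indepD[OF x, of a 2]) (use R \<open>x \<in> R\<close> in \<open>auto simp: a_def numeral_2_eq_2\<close>)
  then show False by (simp add: a_def)
qed

lemma pow_indep_nonzero:
  "pow_indep R x \<Longrightarrow> 0 \<in> R \<Longrightarrow> 1 \<in> R \<Longrightarrow> (\<And>a. a \<in> R \<Longrightarrow> - a \<in> R) \<Longrightarrow> x \<noteq> 0"
  using pow_indep_notin by blast

text \<open>A relation is an expansion of 0, which must coincide with the zero expansion.
  Coefficients beyond \<open>m\<close> are first set to 0 to obtain finite support.\<close>

lemma (in k_algebra) Ore_extension_pow_indep: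
  assumes "Ore_extension s R x \<sigma> \<delta> S"
  shows "pow_indep R x"
  unfolding pow_indep_def
proof (intro allI impI)
  fix m a n assume a: "\<forall>n. a n \<in> R" "(\<Sum>n<m. a n * x ^ n) = 0" "n < m"
  define P where "P f \<longleftrightarrow> finite {n. f n \<noteq> 0} \<and> range f \<subseteq> R \<and> 0 = (\<Sum>n | f n \<noteq> 0. f n * x ^ n)" for f
  note O = assms[unfolded Ore_extension_def]
  have R: "subalg s R" and S: "subalg s S" using O by blast+
  have "\<forall>y\<in>S. \<exists>!f. finite {n. f n \<noteq> 0} \<and> range f \<subseteq> R \<and> y = (\<Sum>n | f n \<noteq> 0. f n * x ^ n)"
    using O by (elim conjE) assumption
  then have ex1: "\<exists>!f. P f" unfolding P_def using subalgD(2)[OF S] by (rule bspec)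
  define f where "f n = (if n < m then a n else 0)" for n
  have "(\<Sum>n | f n \<noteq> 0. f n * x ^ n) = (\<Sum>n<m. f n * x ^ n)"
    by (rule sum_nonzero_index_eq) (auto simp: f_def)
  also have "\<dots> = 0" using a by (simp add: f_def)
  finally have "0 = (\<Sum>n | f n \<noteq> 0. f n * x ^ n)" ..
  moreover have "finite {n. f n \<noteq> 0}" by (rule finite_subset[of _ "{..<m}"]) (auto simp: f_def)
  moreover have "range f \<subseteq> R" using a subalgD(2)[OF R] by (auto simp: f_def)
  ultimately have "P f" by (simp add: P_def)
  moreover have "P (\<lambda>n. 0)" using subalgD(2)[OF R] by (auto simp: P_def)
  ultimately have "f = (\<lambda>n. 0)" using ex1 by blast
  then show "a n = 0" using a(3) by (metis f_def)
qed

locale quantum_nilpotent =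
  fixes D :: "('k::field, 'f::division_ring) qna"
  assumes qna: "quantum_nilpotent_algebra D"
begin

sublocale k_algebra "scal D"
  using qna by unfold_locales (simp add: quantum_nilpotent_algebra_def)

text \<open>The carrier of \<open>alg D j\<close> is \<open>G j (num D)\<close>; the smaller
  \<open>G j i\<close> are needed because generators are adjoined one at a time.\<close>

definition G :: "nat \<Rightarrow> nat \<Rightarrow> 'f set"
  where "G j i = subalg (scal D) hull (gen D j ` {1..i})"

lemma subalg_G [simp]: "subalg (scal D) (G j i)"
  and subalg_base [simp]: "subalg (scal D) (base D i)"
  by (simp_all add: G_def base_def)

lemmas GD = subalgD[OF subalg_G] and baseD = subalgD[OF subalg_base]

lemma gen_in_G: "1 \<le> l \<Longrightarrow> l \<le> i \<Longrightarrow> gen D j l \<in> G j i"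
  unfolding G_def by (rule hull_inc) auto

lemma G_induct [consumes 1, case_names gen one add mult scale]:
  assumes "a \<in> G j i"
    and "\<And>l. 1 \<le> l \<Longrightarrow> l \<le> i \<Longrightarrow> Q (gen D j l)" "Q 1"
    and "\<And>a b. a \<in> G j i \<Longrightarrow> b \<in> G j i \<Longrightarrow> Q a \<Longrightarrow> Q b \<Longrightarrow> Q (a + b)"
    and "\<And>a b. a \<in> G j i \<Longrightarrow> b \<in> G j i \<Longrightarrow> Q a \<Longrightarrow> Q b \<Longrightarrow> Q (a * b)"
    and "\<And>c a. a \<in> G j i \<Longrightarrow> Q a \<Longrightarrow> Q (scal D c a)"
  shows "Q a"
  using assms(1) unfolding G_def
  by (induction rule: subalg_hull_induct) (use assms(2-) in \<open>auto simp: G_def\<close>)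

lemma var_in_base: "1 \<le> l \<Longrightarrow> l \<le> i \<Longrightarrow> var D l \<in> base D i"
  unfolding base_def by (rule hull_inc) auto

lemma G_mono: "i \<le> i' \<Longrightarrow> G j i \<subseteq> G j i'"
  unfolding G_def by (intro hull_mono image_mono) auto

lemma base_mono: "i \<le> i' \<Longrightarrow> base D i \<subseteq> base D i'"
  unfolding base_def by (intro hull_mono image_mono) auto

lemma gen_last: "gen D (Suc (num D)) = var D"
  by (simp add: gen_def)

lemma rev_upt_Suc: "j \<le> n \<Longrightarrow> rev [j..<n + 1] = rev [Suc j..<n + 1] @ [j]"
  using upt_conv_Cons[of j "n + 1"] by simp

lemma gen_step: "j \<le> num D \<Longrightarrow> gen D j = delete_step D j (gen D (Suc j))"
  using rev_upt_Suc[of j "num D"] by (simp add: gen_def del: upt_Suc)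

lemmas qna' = qna[unfolded quantum_nilpotent_algebra_def]

lemma ore: "2 \<le> i \<Longrightarrow> i \<le> num D \<Longrightarrow>
    Ore_extension (scal D) (base D (i - 1)) (var D i) (aut D i) (der D i) (base D i)"
  and ore_1: "Ore_extension (scal D) (base D 0) (var D 1) (\<lambda>r. r) (\<lambda>r. 0) (base D 1)"
  using qna'[THEN conjunct2, THEN conjunct2, THEN conjunct2, THEN conjunct1] qna'[THEN conjunct2, THEN conjunct2, THEN conjunct1] by auto

lemma num_pos: "1 \<le> num D"
  using qna'[THEN conjunct2, THEN conjunct1] .

lemma aut_var: "2 \<le> i \<Longrightarrow> i \<le> num D \<Longrightarrow> 1 \<le> l \<Longrightarrow> l < i \<Longrightarrow> aut D i (var D l) = scal D (lam D i l) (var D l)"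
  using qna'[THEN conjunct2, THEN conjunct2, THEN conjunct2, THEN conjunct2, THEN conjunct1] by auto

lemma lam_nonzero: "1 \<le> i \<Longrightarrow> i \<le> num D \<Longrightarrow> 1 \<le> l \<Longrightarrow> l \<le> num D \<Longrightarrow> lam D i l \<noteq> 0"
  and lam_inverse: "1 \<le> i \<Longrightarrow> i \<le> num D \<Longrightarrow> 1 \<le> l \<Longrightarrow> l \<le> num D \<Longrightarrow> inverse (lam D l i) = lam D i l"
  and lam_diag: "1 \<le> i \<Longrightarrow> i \<le> num D \<Longrightarrow> lam D i i = 1"
  using qna'[THEN conjunct2, THEN conjunct2, THEN conjunct2, THEN conjunct2, THEN conjunct2, THEN conjunct1] qna'[THEN conjunct2, THEN conjunct2, THEN conjunct2, THEN conjunct2, THEN conjunct2, THEN conjunct2, THEN conjunct1] unfolding Ball_def atLeastAtMost_iff by metis+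

lemma qpar: "2 \<le> i \<Longrightarrow> i \<le> num D \<Longrightarrow> qpar D i \<noteq> 0" "2 \<le> i \<Longrightarrow> i \<le> num D \<Longrightarrow> qpar D i \<noteq> 1"
  and hder: "2 \<le> i \<Longrightarrow> i \<le> num D \<Longrightarrow>
      higher_skew_derivation (scal D) (base D (i - 1)) (qpar D i) (aut D i) (der D i) (hder D i)"
    "2 \<le> i \<Longrightarrow> i \<le> num D \<Longrightarrow> locally_nilpotent (base D (i - 1)) (hder D i)"
    "2 \<le> i \<Longrightarrow> i \<le> num D \<Longrightarrow> iterative (scal D) (base D (i - 1)) (qpar D i) (hder D i)"
  using qna'[THEN conjunct2, THEN conjunct2, THEN conjunct2, THEN conjunct2, THEN conjunct2, THEN conjunct2, THEN conjunct2, THEN conjunct1] qna'[THEN conjunct2, THEN conjunct2, THEN conjunct2, THEN conjunct2, THEN conjunct2, THEN conjunct2, THEN conjunct2, THEN conjunct2] by auto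

lemma aut_hder: "2 \<le> i \<Longrightarrow> i < l \<Longrightarrow> l \<le> num D \<Longrightarrow> r \<in> base D (i - 1) \<Longrightarrow>
      aut D l (hder D i n r) = scal D (lam D l i ^ n) (hder D i n (aut D l r))"
  using qna'[THEN conjunct2, THEN conjunct2, THEN conjunct2, THEN conjunct2, THEN conjunct2, THEN conjunct2, THEN conjunct2, THEN conjunct2] by auto

lemma pow_indep_var: "1 \<le> i \<Longrightarrow> i \<le> num D \<Longrightarrow> pow_indep (base D (i - 1)) (var D i)"
  using Ore_extension_pow_indep[OF ore_1] Ore_extension_pow_indep[OF ore[of i]]
  by (cases "i = 1") auto

lemma aut_hom: "2 \<le> i \<Longrightarrow> i \<le> num D \<Longrightarrow> alg_hom (scal D) (base D (i - 1)) (aut D i)"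
  and aut_iso: "2 \<le> i \<Longrightarrow> i \<le> num D \<Longrightarrow> aut D i \<in> ring_iso (ring_of (base D (i - 1))) (ring_of (base D (i - 1)))"
  and aut_lin: "2 \<le> i \<Longrightarrow> i \<le> num D \<Longrightarrow> K_linear_on (scal D) (base D (i - 1)) (aut D i)"
  and var_comm: "2 \<le> i \<Longrightarrow> i \<le> num D \<Longrightarrow> r \<in> base D (i - 1) \<Longrightarrow> var D i * r = aut D i r * var D i + der D i r"
proof -
  fix i assume "2 \<le> i" "i \<le> num D"
  note ore = ore[OF this, unfolded Ore_extension_def]
  show iso: "aut D i \<in> ring_iso (ring_of (base D (i - 1))) (ring_of (base D (i - 1)))" using ore by blast
  show lin: "K_linear_on (scal D) (base D (i - 1)) (aut D i)" using ore by blast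
  show "alg_hom (scal D) (base D (i - 1)) (aut D i)"
    using iso lin by (auto simp: alg_hom_iff ring_iso_def ring_hom_def ring_of_def)
  show "r \<in> base D (i - 1) \<Longrightarrow> var D i * r = aut D i r * var D i + der D i r" using ore by blast
qed

lemma aut_base:
  assumes "2 \<le> i" "i \<le> num D" "l < i" "r \<in> base D l"
  shows "aut D i r \<in> base D l"
  using assms(4) unfolding base_def[of D l]
proof (induction rule: subalg_hull_induct)
  case (gen x)
  then obtain k where "1 \<le> k" "k \<le> l" "x = var D k" by auto
  then show ?case using assms baseD(5)[OF var_in_base[of k l]] by (simp add: aut_var base_def[symmetric])
next
  case one
  then show ?case using aut_hom[OF assms(1,2)] by (auto simp: alg_hom_def base_def[symmetric] intro: baseD)
qed (use aut_hom[OF assms(1,2)] base_mono[of l "i - 1"] assms in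
      \<open>auto simp: alg_hom_def base_def[symmetric] subset_iff intro: baseD\<close>)

text \<open>The PBW-type structure of \<open>A\<^bsup>(j)\<^esup>\<close>: its first \<open>j - 1\<close> generators generate a copy of
  \<open>A\<^bsub>j-1\<^esub>\<close>, embedded by \<open>h\<close>, to which the other generators are adjoined as Ore variables
  without derivation.\<close>

definition stage :: "nat \<Rightarrow> ('f \<Rightarrow> 'f) \<Rightarrow> bool"
  where "stage j h \<longleftrightarrow> alg_hom (scal D) (base D (j - 1)) h \<and> inj_on h (base D (j - 1)) \<and>
    (\<forall>i\<in>{1..<j}. h (var D i) = gen D j i) \<and>
    (\<forall>i\<in>{j..num D}. \<forall>l\<in>{1..<i}. gen D j i * gen D j l = scal D (lam D i l) (gen D j l * gen D j i)) \<and>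
    (\<forall>i\<in>{j..num D}. pow_indep (G j (i - 1)) (gen D j i))"

lemma stage_last: "stage (Suc (num D)) (\<lambda>a. a)"
  by (simp add: stage_def alg_hom_def gen_last)

end

section \<open>One deletion step: the new generators\<close>

locale deletion_step = quantum_nilpotent D for D :: "('k::field, 'f::division_ring) qna" +
  fixes j :: nat and h :: "'f \<Rightarrow> 'f"
  assumes j: "2 \<le> j" "j \<le> num D" and stage: "stage (Suc j) h"
begin

abbreviation X :: 'f where "X \<equiv> gen D (Suc j) j"

lemma h_hom: "alg_hom (scal D) (base D j) h" and h_inj: "inj_on h (base D j)"
  and h_var: "1 \<le> i \<Longrightarrow> i \<le> j \<Longrightarrow> h (var D i) = gen D (Suc j) i"
  and gen_comm: "j < i \<Longrightarrow> i \<le> num D \<Longrightarrow> 1 \<le> l \<Longrightarrow> l < i \<Longrightarrow>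
    gen D (Suc j) i * gen D (Suc j) l = scal D (lam D i l) (gen D (Suc j) l * gen D (Suc j) i)"
  and gen_indep: "j < i \<Longrightarrow> i \<le> num D \<Longrightarrow> pow_indep (G (Suc j) (i - 1)) (gen D (Suc j) i)"
  using stage by (auto simp: stage_def)

lemma base_j: "r \<in> base D (j - 1) \<Longrightarrow> r \<in> base D j"
  using base_mono[of "j - 1" j] by auto

lemma X_nonzero: "X \<noteq> 0"
proof
  assume "X = 0"
  then have "h (var D j) = h 0" using h_var[of j] j alg_hom_zero[OF h_hom] by simp
  then have "var D j = 0" using inj_onD[OF h_inj] var_in_base[of j j] j baseD by auto
  then show False using pow_indep_nonzero[OF pow_indep_var[of j]] j baseD by auto
qed

text \<open>The commutation rule of X_j with A_(j-1) holds inside A_j, on all of which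
  \<open>h\<close> is a homomorphism; \<open>h\<close> carries it to \<open>X\<close>.\<close>

sublocale skew_step "scal D" "base D (j - 1)" "aut D j" "der D j" "hder D j" "qpar D j" h X
proof (unfold_locales, goal_cases)
  case (9) show ?case by (rule alg_hom_subset[OF h_hom base_mono]) simp
next
  case (11 r)
  have r: "r \<in> base D j" "aut D j r \<in> base D j" "var D j \<in> base D j"
    using 11 aut_base[of j "j - 1" r] j base_j var_in_base by auto
  then have "der D j r = var D j * r - aut D j r * var D j" using var_comm[OF j 11] by simp
  then have "der D j r \<in> base D j" using r baseD by auto
  then have "h (var D j * r) = h (aut D j r) * h (var D j) + h (der D j r)"
    unfolding var_comm[OF j 11] using h_hom r baseD by (simp add: alg_hom_def)
  then show ?case using h_hom r h_var[of j] j by (simp add: alg_hom_def)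
qed (use aut_iso aut_lin hder qpar j X_nonzero in auto)

lemma gen_ge: "j \<le> l \<Longrightarrow> gen D j l = gen D (Suc j) l"
  using j by (simp add: gen_step delete_step_def)

text \<open>The description of \<open>transport\<close> is satisfied by \<open>h\<close>, and
  homomorphisms that agree on the generators agree.\<close>

lemma transport_eq:
  assumes "a \<in> base D (j - 1)"
  shows "transport D j (gen D (Suc j)) a = h a"
proof -
  define P where "P g \<longleftrightarrow> g \<in> ring_hom (ring_of (base D (j - 1))) (ring_of UNIV) \<and>
    K_linear_on (scal D) (base D (j - 1)) g \<and> (\<forall>i\<in>{1..<j}. g (var D i) = gen D (Suc j) i)" for g
  have "P h" using h h_var by (auto simp: P_def alg_hom_iff)
  then have "P (transport D j (gen D (Suc j)))"
    unfolding transport_def P_def[symmetric, abs_def] by (rule someI[of P])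
  then have tr: "alg_hom (scal D) (base D (j - 1)) (transport D j (gen D (Suc j)))"
    "\<And>i. i \<in> {1..<j} \<Longrightarrow> transport D j (gen D (Suc j)) (var D i) = gen D (Suc j) i"
    by (simp_all add: P_def alg_hom_iff)
  show ?thesis
  proof (rule alg_hom_eqI[where s = "scal D" and S = "var D ` {1..j - 1}", folded base_def, OF tr(1) h _ assms])
    fix v assume "v \<in> var D ` {1..j - 1}"
    then obtain i where "i \<in> {1..j - 1}" "v = var D i" by auto
    then show "transport D j (gen D (Suc j)) v = h v" using tr(2)[of i] h_var[of i] j by auto
  qed
qed

text \<open>With \<open>transport\<close> replaced by \<open>h\<close>, the formula of the algorithm
  is literally \<open>\<theta>\<close> at an original generator. This is the link between the
  algorithm and the algebra of \<open>\<theta>\<close>.\<close>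

lemma gen_lt:
  assumes l: "1 \<le> l" "l < j"
  shows "gen D j l = \<theta> (var D l)"
proof -
  have v: "var D l \<in> base D (j - 1)" using l by (intro var_in_base) auto
  have "gen D j l = (\<Sum>n | t n (var D l) \<noteq> 0. scal D (c n) (transport D j (gen D (Suc j)) (t n (var D l)) * inverse X ^ n))"
    using l j unfolding gen_step[OF j(2)] delete_step_def Let_def t_def c_def \<sigma>i_def by simp
  also have "\<dots> = \<theta> (var D l)"
    unfolding \<theta>_def using v by (intro sum.cong) (auto simp: transport_eq)
  finally show ?thesis .
qed

text \<open>The derivation is gone: for l < j the relation is \<open>x_\<theta>\<close>, where
  \<open>\<sigma>_j\<close> multiplies X_l by a scalar. For l > j it is inherited from the previous
  stage by antisymmetry of \<open>lam\<close>.\<close>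

lemma X_gen: "1 \<le> l \<Longrightarrow> l \<le> num D \<Longrightarrow> X * gen D j l = scal D (lam D j l) (gen D j l * X)"
proof -
  assume l: "1 \<le> l" "l \<le> num D"
  consider "l < j" | "l = j" | "l > j" by linarith
  then show ?thesis
  proof cases
    case 1
    then have v: "var D l \<in> base D (j - 1)" using l by (intro var_in_base) auto
    show ?thesis using x_\<theta>[OF v] 1 l j v by (simp add: gen_lt aut_var \<theta>_scale mult_scale)
  next
    case 2 then show ?thesis using l by (simp add: gen_ge lam_diag)
  next
    case 3
    then have "scal D (lam D j l) (gen D (Suc j) l * X) = scal D (lam D j l * lam D l j) (X * gen D (Suc j) l)"
      using gen_comm[of l j] l j by simp
    also have "lam D j l * lam D l j = 1"
      using lam_nonzero[of l j] lam_inverse[of j l] l j by (metis le_trans one_le_numeral left_inverse)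
    finally show ?thesis using 3 by (simp add: gen_ge)
  qed
qed

lemma X_power_gen: "1 \<le> l \<Longrightarrow> l \<le> num D \<Longrightarrow> X ^ n * gen D j l = scal D (lam D j l ^ n) (gen D j l * X ^ n)"
  using scale_commute_power[OF X_gen, of l n 1] by simp

lemma conj_gen: "1 \<le> l \<Longrightarrow> l \<le> num D \<Longrightarrow> X ^ n * gen D j l * inverse X ^ n = scal D (lam D j l ^ n) (gen D j l)"
  using X_nonzero by (simp add: X_power_gen mult_scale mult.assoc power_inverse)

lemma conj_inverse_gen:
  assumes l: "1 \<le> l" "l \<le> num D"
  shows "inverse X ^ n * gen D j l * X ^ n = scal D (inverse (lam D j l) ^ n) (gen D j l)"
proof -
  have "gen D j l * X ^ n = scal D (inverse (lam D j l) ^ n) (X ^ n * gen D j l)"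
    using l j lam_nonzero[of j l] by (simp add: X_power_gen power_inverse)
  then show ?thesis using X_nonzero by (simp add: mult_scale mult.assoc) (simp add: power_inverse mult.assoc[symmetric])
qed

lemma conj_prod: "X ^ n * inverse X ^ n = 1" "inverse X ^ n * X ^ n = 1"
  using X_nonzero by (simp_all add: power_inverse)

section \<open>Equality of the localisations before and after a step\<close>

lemma G_conj: "a \<in> G j i \<Longrightarrow> i \<le> num D \<Longrightarrow> X ^ n * a * inverse X ^ n \<in> G j i"
  and G_conj_inverse: "a \<in> G j i \<Longrightarrow> i \<le> num D \<Longrightarrow> inverse X ^ n * a * X ^ n \<in> G j i"
proof -
  have *: "u * a * v \<in> G j i" if a: "a \<in> G j i" and uv: "u * v = 1" "v * u = 1"
    and gen: "\<And>l. 1 \<le> l \<Longrightarrow> l \<le> i \<Longrightarrow> u * gen D j l * v \<in> G j i" for u v a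
    using a
  proof (induction rule: G_induct)
    case (mult a b)
    have "u * (a * b) * v = (u * a * v) * (u * b * v)"
      using uv by (simp add: mult.assoc) (metis mult.assoc mult_1_left)
    then show ?case using mult GD by simp
  qed (use gen GD uv in \<open>auto simp: distrib_left distrib_right mult_scale\<close>)
  assume a: "a \<in> G j i" "i \<le> num D"
  show "X ^ n * a * inverse X ^ n \<in> G j i"
    by (rule *[OF a(1)]) (use a conj_gen GD gen_in_G conj_prod in auto)
  show "inverse X ^ n * a * X ^ n \<in> G j i"
    by (rule *[OF a(1)]) (use a conj_inverse_gen GD gen_in_G conj_prod in auto)
qed

lemma image_\<theta>: "\<theta> ` base D (j - 1) = G j (j - 1)"
proof -
  have "\<theta> ` base D (j - 1) = subalg (scal D) hull (\<theta> ` var D ` {1..j - 1})"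
    using alg_hom_\<theta> unfolding base_def by (rule alg_hom_image_hull)
  also have "\<theta> ` var D ` {1..j - 1} = gen D j ` {1..j - 1}"
    unfolding image_image by (intro image_cong) (use gen_lt in auto)
  finally show ?thesis by (simp add: G_def)
qed

lemma image_h: "h ` base D j = G (Suc j) j"
proof -
  have "h ` base D j = subalg (scal D) hull (h ` var D ` {1..j})"
    using h_hom unfolding base_def by (rule alg_hom_image_hull)
  also have "h ` var D ` {1..j} = gen D (Suc j) ` {1..j}"
    unfolding image_image by (intro image_cong) (use h_var in auto)
  finally show ?thesis by (simp add: G_def)
qed

text \<open>For the generators below \<open>j\<close> the inversion of \<open>\<theta>\<close>
  expresses x_l through values of \<open>\<theta>\<close> and negative powers of \<open>X\<close>.
  Products are handled because conjugation by \<open>X\<close> preserves the new algebra.\<close>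

lemma new_from_old:
  assumes i: "j \<le> i" "i \<le> num D" and b: "b \<in> G (Suc j) i"
  shows "\<exists>n. b * X ^ n \<in> G j i"
  using b
proof (induction rule: G_induct)
  have XG: "X ^ n \<in> G j i" for n using gen_in_G[of j i j] i j gen_ge[of j] GD by auto
  have up: "u * X ^ (n + k) \<in> G j i" if "u * X ^ n \<in> G j i" for u n k
    using GD(4)[OF that XG[of k]] by (simp add: power_add mult.assoc)
  {
    case l: (gen l)
    show ?case
    proof (cases "l < j")
      case True
      let ?V = "{v. \<exists>n. v * X ^ n \<in> G j i}"
      have "h (var D l) \<in> ?V"
      proof (rule h_in_span_\<theta>)
        fix u v assume "u \<in> ?V" "v \<in> ?V"
        then obtain n m where "u * X ^ n \<in> G j i" "v * X ^ m \<in> G j i" by auto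
        then have "u * X ^ (n + m) \<in> G j i" "v * X ^ (n + m) \<in> G j i"
          using up[of u n m] up[of v m n] by (auto simp: add.commute)
        then have "(u + v) * X ^ (n + m) \<in> G j i" unfolding distrib_right by (rule GD)
        then show "u + v \<in> ?V" by blast
      next
        fix k u assume "u \<in> ?V" then show "scal D k u \<in> ?V" by (auto simp: mult_scale) (blast intro: GD(5))
      next
        fix b assume "b \<in> base D (j - 1)"
        moreover have "G j (j - 1) \<subseteq> G j i" using i by (intro G_mono) linarith
        ultimately have "\<theta> b \<in> G j i" using image_\<theta> by blast
        then show "\<theta> b \<in> ?V" by (auto intro!: exI[of _ 0])
      next
        fix u assume "u \<in> ?V"
        then obtain n where "u * X ^ n \<in> G j i" by auto
        moreover have "u * X ^ n = u * inverse X * X ^ Suc n" using X_nonzero by (simp add: mult.assoc) (simp add: mult.assoc[symmetric])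
        ultimately have "u * inverse X * X ^ Suc n \<in> G j i" by (simp only:)
        then show "u * inverse X \<in> ?V" by blast
      qed (use l True in \<open>auto intro: var_in_base\<close>)
      then show ?thesis using l True h_var by auto
    next
      case False
      then show ?thesis using l gen_ge[of l] gen_in_G[of l i j] by (auto intro!: exI[of _ 0])
    qed
  next
    case one show ?case using GD by (auto intro!: exI[of _ 0])
  next
    case (add u v)
    then obtain n m where "u * X ^ n \<in> G j i" "v * X ^ m \<in> G j i" by auto
    then have "u * X ^ (n + m) \<in> G j i" "v * X ^ (n + m) \<in> G j i"
      using up[of u n m] up[of v m n] by (auto simp: add.commute)
    then have "(u + v) * X ^ (n + m) \<in> G j i" unfolding distrib_right by (rule GD)
    then show ?case by blast
  next
    case (mult u v)
    then obtain n m where "u * X ^ n \<in> G j i" "v * X ^ m \<in> G j i" by auto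
    \<comment> \<open>Conjugating the second factor by X^n lets it pass the denominator of the
      first, which gives the common exponent m + n.\<close>
    then have "u * X ^ n * (inverse X ^ n * (v * X ^ m) * X ^ n) \<in> G j i"
      using i by (rule_tac GD(4)) (auto intro: G_conj_inverse)
    also have "u * X ^ n * (inverse X ^ n * (v * X ^ m) * X ^ n) = u * (X ^ n * inverse X ^ n) * v * X ^ (m + n)"
      by (simp only: mult.assoc power_add)
    finally show ?case by (auto simp: conj_prod)
  next
    case (scale k u)
    then show ?case by (auto simp: mult_scale) (blast intro: GD(5))
  }
qed

lemma new_from_old':
  assumes i: "j \<le> i" "i \<le> num D" and b: "b \<in> G (Suc j) i"
  shows "\<exists>n. X ^ n * b \<in> G j i"
proof -
  obtain n where "b * X ^ n \<in> G j i" using new_from_old[OF assms] by auto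
  then have "X ^ n * (b * X ^ n) * inverse X ^ n \<in> G j i" by (rule G_conj) (rule i)
  then have "X ^ n * b * (X ^ n * inverse X ^ n) \<in> G j i" by (simp only: mult.assoc)
  then show ?thesis by (auto simp: conj_prod)
qed

lemma old_from_new_gen:
  assumes i: "j \<le> i" and l: "1 \<le> l" "l \<le> i"
  shows "\<exists>n. gen D j l * X ^ n \<in> G (Suc j) i"
proof (cases "l < j")
  case True
  have XG: "X ^ n \<in> G (Suc j) i" for n using gen_in_G[of j i] i j GD by auto
  have hG: "h r \<in> G (Suc j) i" if "r \<in> base D (j - 1)" for r
    using base_j[OF that] image_h G_mono[of j i "Suc j"] i by blast
  have v: "var D l \<in> base D (j - 1)" using True l by (intro var_in_base) auto
  obtain m where "nilp (var D l) m" using nilp_ex[OF v] by auto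
  then have "\<theta> (var D l) * X ^ m \<in> G (Suc j) i"
    unfolding \<theta>_x_power[OF \<open>nilp (var D l) m\<close>] using v by (auto intro!: subalg_sum GD hG XG)
  then show ?thesis using True l gen_lt by auto
next
  case False
  then show ?thesis using gen_ge[of l] gen_in_G[of l i "Suc j"] l by (auto intro!: exI[of _ 0])
qed

text \<open>The exponent \<open>n\<close> is chosen uniformly for all conjugates of \<open>a\<close> by powers of \<open>X\<close>; this makes
  the property stable under products.\<close>

lemma old_from_new_uniform:
  assumes i: "j \<le> i" "i \<le> num D" and a: "a \<in> G j i"
  shows "\<exists>n. \<forall>k. X powi k * a * X powi (- k) * X ^ n \<in> G (Suc j) i"
  using a
proof (induction rule: G_induct)
  have XG: "X ^ n \<in> G (Suc j) i" for n using gen_in_G[of j i] i j GD by auto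
  have pw: "X powi k * X powi (- k) = 1" "X powi (- k) * X ^ n * X powi (k - int n) = 1"
    "X powi (- (k - int n)) = X powi (- k) * X ^ n" for k n
    using X_nonzero by (simp_all add: power_int_add[symmetric] flip: power_int_of_nat)
  {
    case (gen l)
    obtain n where n: "gen D j l * X ^ n \<in> G (Suc j) i" using old_from_new_gen gen i by blast
    \<comment> \<open>All conjugates of a new generator are scalar multiples of it, so a single
      exponent serves every \<open>k\<close>.\<close>
    have "\<exists>c. X powi k * gen D j l * X powi (- k) = scal D c (gen D j l)" for k
      using conj_gen[of l] conj_inverse_gen[of l] gen i
      by (cases k rule: int_cases2) (auto simp: power_int_minus power_inverse)
    then show ?case using n GD(5) by (metis mult_scale_left)
  next
    case one show ?case using GD pw(1) by (auto intro!: exI[of _ 0])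
  next
    case (add a b)
    then obtain n m where nm: "\<And>k. X powi k * a * X powi (- k) * X ^ n \<in> G (Suc j) i"
      "\<And>k. X powi k * b * X powi (- k) * X ^ m \<in> G (Suc j) i" by blast
    have "X powi k * a * X powi (- k) * X ^ n * X ^ m + X powi k * b * X powi (- k) * X ^ m * X ^ n \<in> G (Suc j) i" for k
      by (intro GD(3,4) nm XG)
    moreover have "X ^ m * X ^ n = X ^ (n + m)" "X ^ n * X ^ m = X ^ (n + m)"
      by (simp_all add: power_add[symmetric] add.commute)
    ultimately have "X powi k * (a + b) * X powi (- k) * X ^ (n + m) \<in> G (Suc j) i" for k
      by (simp add: mult.assoc distrib_left distrib_right)
    then show ?case by blast
  next
    case (mult a b)
    then obtain n m where n: "\<And>k. X powi k * a * X powi (- k) * X ^ n \<in> G (Suc j) i"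
      and m: "\<And>k. X powi k * b * X powi (- k) * X ^ m \<in> G (Suc j) i" by blast
    \<comment> \<open>The second factor is conjugated with exponent k - n, so that the X^n already
      spent on \<open>a\<close> is absorbed. The uniformity in \<open>k\<close> is used
      here.\<close>
    have "X powi k * a * X powi (- k) * X ^ n * (X powi (k - int n) * b * X powi (- (k - int n)) * X ^ m)
       = X powi k * a * (X powi (- k) * X ^ n * X powi (k - int n)) * b * (X powi (- k) * X ^ n) * X ^ m" for k
      by (simp only: mult.assoc pw(3))
    also have "\<dots> k = X powi k * (a * b) * X powi (- k) * X ^ (n + m)" for k
      unfolding pw(2) by (simp only: mult_1_right mult.assoc power_add)
    finally show ?case using GD(4)[OF n m] by metis
  next
    case (scale c a)
    then show ?case by (auto simp: mult_scale) (blast intro: GD(5))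
  }
qed

lemma old_from_new:
  assumes "j \<le> i" "i \<le> num D" "a \<in> G j i"
  shows "\<exists>n. a * X ^ n \<in> G (Suc j) i \<and> X ^ n * a \<in> G (Suc j) i"
proof -
  obtain n where n: "\<And>k. X powi k * a * X powi (- k) * X ^ n \<in> G (Suc j) i"
    using old_from_new_uniform[OF assms] by blast
  then have "X ^ n * a \<in> G (Suc j) i"
    \<comment> \<open>The conjugate with k = n puts the denominator on the left, and k = 0 puts it
      on the right.\<close>
    using n[of "int n"] X_nonzero by (simp add: power_int_minus mult.assoc)
  moreover have "a * X ^ n \<in> G (Suc j) i" using n[of 0] by simp
  ultimately show ?thesis by blast
qed

section \<open>Relations and independence of the new generators\<close>

lemma gen_h:
  assumes i: "j < i" "i \<le> num D" and r: "r \<in> base D (j - 1)"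
  shows "gen D (Suc j) i * h r = h (aut D i r) * gen D (Suc j) i"
  using r unfolding base_def
proof (induction rule: subalg_hull_induct)
  have i2: "2 \<le> i" using j i by simp
  have ar: "aut D i r \<in> base D (j - 1)" if "r \<in> base D (j - 1)" for r
    using aut_base[of i "j - 1" r] i j that by auto
  have A: "alg_hom (scal D) (base D (j - 1)) (aut D i)"
    using aut_hom[OF i2 i(2)] by (rule alg_hom_subset) (use i j base_mono in auto)
  note H = h[unfolded alg_hom_def] A[unfolded alg_hom_def]
  {
    case (gen x)
    then obtain l where "1 \<le> l" "l \<le> j - 1" "x = var D l" by auto
    then show ?case using i i2 j h_var[of l] var_in_base[of l "j - 1"] 
      by (simp add: aut_var gen_comm h_scale mult_scale)
  next
    case one then show ?case using H by simp
  next
    case (add a b)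
    then show ?case using H ar by (simp add: base_def[symmetric] distrib_left distrib_right)
  next
    case (mult a b)
    then show ?case using H ar by (simp add: base_def[symmetric] mult.assoc) (metis mult.assoc)
  next
    case (scale c a)
    then show ?case using H ar by (simp add: base_def[symmetric] mult_scale)
  }
qed

text \<open>For l < j, x_i passes each term of \<open>\<theta>\<close> separately. The compatibility
  of \<open>\<sigma>_i\<close> with d_(j,n) gives a factor lam(i,j)^n, which cancels the factor
  coming from x_j^-n, so every term acquires the same scalar lam(i,l).\<close>

lemma new_comm:
  assumes i: "j < i" "i \<le> num D" and l: "1 \<le> l" "l < i"
  shows "gen D j i * gen D j l = scal D (lam D i l) (gen D j l * gen D j i)"
proof (cases "l < j")
  case False
  then show ?thesis using gen_comm[OF assms] gen_ge[of i] gen_ge[of l] i by simp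
next
  case True
  let ?x = "gen D (Suc j) i"
  have v: "var D l \<in> base D (j - 1)" using True l by (intro var_in_base) auto
  have i2: "2 \<le> i" using j i by simp
  have "?x * inverse X = inverse X * (X * ?x) * inverse X"
    using X_nonzero by (simp add: mult.assoc[symmetric])
  also have "X * ?x = scal D (inverse (lam D i j)) (?x * X)"
    using gen_comm[of i j] lam_nonzero[of i j] i j by simp
  finally have "?x * inverse X = scal D (inverse (lam D i j)) (inverse X * ?x)"
    using X_nonzero by (simp add: mult_scale mult.assoc)
  then have xX: "?x * inverse X ^ n = scal D (inverse (lam D i j) ^ n) (inverse X ^ n * ?x)" for n
    using scale_commute_power[of ?x "inverse X" _ 1 n] by simp
  have av: "(\<sigma>i ^^ n) (var D l) = scal D (inverse (lam D j l) ^ n) (var D l)" for n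
  proof (induction n)
    case (Suc n)
    have "\<sigma>i (var D l) = scal D (inverse (lam D j l)) (var D l)"
    proof (rule \<sigma>i_eqI)
      show "aut D j (scal D (inverse (lam D j l)) (var D l)) = var D l"
        using v True l j lam_nonzero[of j l] by (simp add: \<sigma>_scale aut_var)
    qed (use v R in auto)
    then show ?case using Suc v by (simp add: \<sigma>i_scale mult.commute)
  qed simp
  have at: "aut D i (t n (var D l)) = scal D (lam D i j ^ n * lam D i l) (t n (var D l))" for n
  proof -
    have "aut D i ((\<sigma>i ^^ n) (var D l)) = scal D (lam D i l) ((\<sigma>i ^^ n) (var D l))"
      using aut_hom[OF i2 i(2)] v i i2 l True base_mono[of "j - 1" "i - 1"]
      by (auto simp: av alg_hom_def aut_var subset_iff mult.commute)
    then show ?thesis using aut_hder[of j i "(\<sigma>i ^^ n) (var D l)" n] i j v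
      by (simp add: t_def d_scale)
  qed
  obtain m where m: "nilp (var D l) m" using nilp_ex[OF v] by auto
  have "?x * (h (t n (var D l)) * inverse X ^ n) = scal D (lam D i l) (h (t n (var D l)) * inverse X ^ n * ?x)" for n
  proof -
    have "?x * (h (t n (var D l)) * inverse X ^ n) = h (aut D i (t n (var D l))) * (?x * inverse X ^ n)"
      using gen_h[OF i t_in[OF v]] by (simp add: mult.assoc[symmetric])
    also have "\<dots> = scal D (lam D i j ^ n * lam D i l * inverse (lam D i j) ^ n) (h (t n (var D l)) * inverse X ^ n * ?x)"
      using v by (simp add: xX at h_scale mult_scale mult.assoc)
    also have "lam D i j ^ n * lam D i l * inverse (lam D i j) ^ n = lam D i l"
      using lam_nonzero[of i j] i j by (simp add: power_inverse)
    finally show ?thesis .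
  qed
  then have "?x * \<theta> (var D l) = scal D (lam D i l) (\<theta> (var D l) * ?x)"
    unfolding \<theta>_eq[OF m] sum_distrib_left sum_distrib_right scale_sum_right
    by (intro sum.cong) (auto simp: mult_scale mult.commute)
  then show ?thesis using gen_lt[of l] gen_ge[of i] l True i by simp
qed

lemma h_indep:
  assumes "\<And>n. a n \<in> base D (j - 1)" "(\<Sum>n<m. h (a n) * X ^ n) = 0"
  shows "\<forall>n<m. a n = 0"
proof (intro allI impI)
  fix n assume n: "n < m"
  have v: "var D j \<in> base D j" using j by (intro var_in_base) auto
  have aj: "a n \<in> base D j" for n using assms(1) base_j by auto
  have "h (\<Sum>n<m. a n * var D j ^ n) = (\<Sum>n<m. h (a n * var D j ^ n))"
    by (rule alg_hom_sum[OF h_hom]) (use v aj in \<open>auto intro: baseD\<close>)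
  also have "\<dots> = (\<Sum>n<m. h (a n) * X ^ n)"
    using h_hom v aj h_var[of j] j alg_hom_power[OF h_hom _ v] by (auto simp: alg_hom_def baseD)
  finally have "h (\<Sum>n<m. a n * var D j ^ n) = h 0" using assms(2) alg_hom_zero[OF h_hom] by simp
  then have "(\<Sum>n<m. a n * var D j ^ n) = 0"
    by (rule inj_onD[OF h_inj]) (use v aj in \<open>auto intro!: subalg_sum baseD\<close>)
  then show "a n = 0" using pow_indepD[OF pow_indep_var[of j], of a m n] j assms(1) n by auto
qed

text \<open>For i = j this is the leading coefficient argument for \<open>\<theta>\<close>. For i >
  j the generator itself has not changed: clearing powers of \<open>X\<close> moves the coefficients
  into the old algebra, where independence is known.\<close>

lemma new_indep:
  assumes i: "j \<le> i" "i \<le> num D"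
  shows "pow_indep (G j (i - 1)) (gen D j i)"
  unfolding pow_indep_def
proof (intro allI impI)
  fix m a n assume a: "\<forall>n. a n \<in> G j (i - 1)" "(\<Sum>n<m. a n * gen D j i ^ n) = 0" "n < m"
  show "a n = 0"
  proof (cases "i = j")
    case True
    then have "\<forall>n. \<exists>b. b \<in> base D (j - 1) \<and> a n = \<theta> b" using a(1) image_\<theta> by blast
    then obtain b where b: "\<And>n. b n \<in> base D (j - 1)" "\<And>n. a n = \<theta> (b n)" by metis
    have "\<forall>n<m. b n = 0"
      by (rule \<theta>_indep[OF h_indep]) (use a(2) b True gen_ge[of j] in auto)
    moreover have "\<theta> 0 = 0" using \<theta>_scale[of 1 0] R by simp
    ultimately show ?thesis using b a(3) by simp
  next
    case False
    let ?x = "gen D (Suc j) i"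
    have ij: "j < i" using False i by simp
    have "\<exists>n. a k * X ^ n \<in> G (Suc j) (i - 1)" for k
    proof -
      have "j \<le> i - 1" "i - 1 \<le> num D" using ij i by linarith+
      then show ?thesis using old_from_new[of "i - 1" "a k"] a(1) by blast
    qed
    then obtain f where f: "\<And>k. a k * X ^ f k \<in> G (Suc j) (i - 1)" by metis
    \<comment> \<open>The sum bounds each \<open>f k\<close> with k < m, so one power of
      \<open>X\<close> clears all coefficients.\<close>
    define M where "M = sum f {..<m}"
    have M: "a k * X ^ M \<in> G (Suc j) (i - 1)" if "k < m" for k
    proof -
      have "f k \<le> M" unfolding M_def using that by (intro member_le_sum) auto
      then have "a k * X ^ M = a k * X ^ f k * X ^ (M - f k)" by (simp add: mult.assoc flip: power_add)
      also have "\<dots> \<in> G (Suc j) (i - 1)" by (intro GD(4,8) f gen_in_G) (use ij j in auto)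
      finally show ?thesis .
    qed
    define \<mu> where "\<mu> = lam D i j"
    have \<mu>: "\<mu> \<noteq> 0" using lam_nonzero i j by (auto simp: \<mu>_def)
    have "?x * X = scal D \<mu> (X * ?x)" using gen_comm[of i j] ij i j by (simp add: \<mu>_def)
    note comm = scale_commute_power[OF this, of _ M]
    \<comment> \<open>The scalar comes from moving X^M past x_i^k. The value 0 beyond
      \<open>m\<close> keeps every coefficient in the algebra, as \<open>pow_indep\<close>
      demands.\<close>
    define e where "e k = (if k < m then scal D (\<mu> ^ (k * M)) (a k * X ^ M) else 0)" for k
    have "(\<Sum>k<m. e k * ?x ^ k) = (\<Sum>k<m. a k * ?x ^ k * X ^ M)"
      by (intro sum.cong) (auto simp: e_def mult.assoc comm mult_scale)
    also have "\<dots> = 0" using a(2) gen_ge[of i] i by (simp flip: sum_distrib_right)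
    finally have "e n = 0"
      by (rule pow_indepD[OF gen_indep[OF ij i(2)], rotated]) (use a(3) M GD in \<open>auto simp: e_def\<close>)
    then show ?thesis using a(3) \<mu> X_nonzero by (simp add: e_def)
  qed
qed

lemma stage_new: "stage j \<theta>"
  unfolding stage_def
proof (intro conjI ballI)
  show "alg_hom (scal D) (base D (j - 1)) \<theta>" by (rule alg_hom_\<theta>)
  show "inj_on \<theta> (base D (j - 1))"
  proof (rule inj_onI)
    fix a b assume ab: "a \<in> base D (j - 1)" "b \<in> base D (j - 1)" "\<theta> a = \<theta> b"
    have "\<theta> (a - b) = 0" using ab alg_hom_diff[OF alg_hom_\<theta> subalg] by simp
    then have "\<forall>n<1. (\<lambda>n::nat. a - b) n = 0"
      by (intro \<theta>_indep[OF h_indep]) (use ab R in auto)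
    then show "a = b" by auto
  qed
  show "\<theta> (var D i) = gen D j i" if "i \<in> {1..<j}" for i using that gen_lt by auto
  show "gen D j i * gen D j l = scal D (lam D i l) (gen D j l * gen D j i)"
    if "i \<in> {j..num D}" "l \<in> {1..<i}" for i l
    using that new_comm[of i l] X_gen[of l] gen_ge[of j] by (cases "i = j") auto
  show "pow_indep (G j (i - 1)) (gen D j i)" if "i \<in> {j..num D}" for i
    using that new_indep by auto
qed

end

context quantum_nilpotent
begin

lemma stage_ex:
  assumes "2 \<le> j" "j \<le> Suc (num D)"
  shows "\<exists>h. stage j h"
  using assms(2,1)
proof (induction rule: inc_induct)
  case base then show ?case using stage_last by blast
next
  case (step n)
  then obtain h where "stage (Suc n) h" by auto
  then interpret deletion_step D n h using step by unfold_locales auto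
  show ?case using stage_new by blast
qed

lemma T_comm:
  assumes "1 \<le> i" "i \<le> num D" "1 \<le> l" "l \<le> num D"
  shows "gen D 2 i * gen D 2 l = scal D (lam D i l) (gen D 2 l * gen D 2 i)"
proof -
  obtain h where "stage 2 h" using stage_ex[of 2] num_pos by auto
  then have *: "gen D 2 i * gen D 2 l = scal D (lam D i l) (gen D 2 l * gen D 2 i)"
    if "1 \<le> l" "l < i" "i \<le> num D" for i l
    using that by (auto simp: stage_def)
  consider "l < i" | "l = i" | "l > i" by linarith
  then show ?thesis
  proof cases
    case 3
    have "lam D i l * lam D l i = 1"
      using lam_nonzero[of l i] lam_inverse[of i l] assms by (metis left_inverse)
    then show ?thesis using *[of i l] 3 assms by simp
  qed (use * assms lam_diag in auto)
qed

text \<open>The piece \<open>CSpec_w'\<close> is described by the set of elements T_i in a prime;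
  distinct T_i are needed to read off the indices. Independence keeps T_i outside the algebra of the
  preceding generators.\<close>

lemma T_inj: "inj_on (gen D 2) {1..num D}"
proof -
  obtain h where h: "stage 2 h" using stage_ex[of 2] num_pos by auto
  have "gen D 2 i \<noteq> gen D 2 l" if "1 \<le> l" "l < i" "i \<le> num D" for i l
  proof -
    have "gen D 2 i \<notin> G 2 (i - 1)"
      by (rule pow_indep_notin) (use h that in \<open>auto simp: stage_def intro: GD\<close>)
    then show ?thesis using gen_in_G[of l "i - 1" 2] that by auto
  qed
  then show ?thesis
    by (intro inj_onI) (metis atLeastAtMost_iff linorder_neqE_nat)
qed

end

section \<open>The homomorphisms \<open>g\<^sub>j\<close>\<close>

definition ring_ideal :: "'f::ring_1 set \<Rightarrow> 'f set \<Rightarrow> bool"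
  where "ring_ideal B I \<longleftrightarrow> I \<subseteq> B \<and> 0 \<in> I \<and> (\<forall>u\<in>I. - u \<in> I \<and> (\<forall>v\<in>I. u + v \<in> I)) \<and>
    (\<forall>b\<in>B. \<forall>u\<in>I. b * u \<in> I \<and> u * b \<in> I)"

lemma ring_idealD:
  assumes "ring_ideal B I"
  shows "u \<in> I \<Longrightarrow> u \<in> B" "0 \<in> I" "u \<in> I \<Longrightarrow> - u \<in> I" "u \<in> I \<Longrightarrow> v \<in> I \<Longrightarrow> u + v \<in> I"
    "u \<in> I \<Longrightarrow> v \<in> I \<Longrightarrow> u - v \<in> I"
    "b \<in> B \<Longrightarrow> u \<in> I \<Longrightarrow> b * u \<in> I" "b \<in> B \<Longrightarrow> u \<in> I \<Longrightarrow> u * b \<in> I"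
  using assms unfolding ring_ideal_def by (auto simp: diff_conv_add_uminus simp del: add_uminus_conv_diff)

text \<open>The graph of an algebra homomorphism from \<open>R\<close> to the quotient of \<open>B\<close> by \<open>I\<close>, as a relation
  between elements of \<open>R\<close> and representatives of their images.\<close>

definition hom_mod :: "('k::field \<Rightarrow> 'f::ring_1 \<Rightarrow> 'f) \<Rightarrow> 'f set \<Rightarrow> 'f set \<Rightarrow> 'f set \<Rightarrow> ('f \<Rightarrow> 'f \<Rightarrow> bool) \<Rightarrow> bool"
  where "hom_mod s R B I \<rho> \<longleftrightarrow> (\<forall>a b. \<rho> a b \<longrightarrow> a \<in> R \<and> b \<in> B) \<and>
    (\<forall>a b a' b'. \<rho> a b \<longrightarrow> \<rho> a' b' \<longrightarrow> \<rho> (a + a') (b + b') \<and> \<rho> (a * a') (b * b')) \<and>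
    (\<forall>c. \<rho> (s c 1) (s c 1)) \<and> (\<forall>u\<in>I. \<rho> 0 u) \<and> (\<forall>b. \<rho> 0 b \<longrightarrow> b \<in> I)"

lemma hom_modD:
  assumes "hom_mod s R B I \<rho>"
  shows "\<rho> a b \<Longrightarrow> a \<in> R" "\<rho> a b \<Longrightarrow> b \<in> B"
    "\<rho> a b \<Longrightarrow> \<rho> a' b' \<Longrightarrow> \<rho> (a + a') (b + b')" "\<rho> a b \<Longrightarrow> \<rho> a' b' \<Longrightarrow> \<rho> (a * a') (b * b')"
    "\<rho> (s c 1) (s c 1)" "u \<in> I \<Longrightarrow> \<rho> 0 u" "\<rho> 0 b \<Longrightarrow> b \<in> I"
  using assms unfolding hom_mod_def by blast+

text \<open>The pairs \<open>(\<Sum>\<^sub>n a\<^sub>n y\<^sup>n, \<Sum>\<^sub>n b\<^sub>n z\<^sup>n + u)\<close> with \<open>\<rho> a\<^sub>n b\<^sub>n\<close> and \<open>u \<in> I\<close>, in Horner form.\<close>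

inductive ore_graph for \<rho> :: "'f::ring_1 \<Rightarrow> 'f \<Rightarrow> bool" and I :: "'f set" and y z :: 'f where
  zero: "u \<in> I \<Longrightarrow> ore_graph \<rho> I y z 0 u"
| step: "\<rho> a b \<Longrightarrow> ore_graph \<rho> I y z a' b' \<Longrightarrow> ore_graph \<rho> I y z (a + a' * y) (b + b' * z)"

context k_algebra
begin

lemma hom_mod_scale: "hom_mod s R B I \<rho> \<Longrightarrow> \<rho> a b \<Longrightarrow> \<rho> (s c a) (s c b)"
  using hom_modD(4)[of s R B I \<rho> "s c 1" "s c 1" a b] hom_modD(5)[of s R B I \<rho> c]
  by (simp add: mult_scale)

lemma hom_mod_unique:
  assumes "hom_mod s R B I \<rho>" "\<rho> a b" "\<rho> a b'"
  shows "b - b' \<in> I"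
  using hom_modD(7)[OF assms(1), of "b - b'"] hom_modD(3)[OF assms(1,2) hom_mod_scale[OF assms(1,3), of "-1"]]
  by simp

lemma hom_mod_total:
  assumes "hom_mod s (subalg s hull S) B I \<rho>" "\<And>g. g \<in> S \<Longrightarrow> \<exists>b. \<rho> g b" "a \<in> subalg s hull S"
  shows "\<exists>b. \<rho> a b"
  using assms(3)
proof (induction rule: subalg_hull_induct)
  case one
  then show ?case using hom_modD(5)[OF assms(1), of 1] by auto
qed (use assms(2) hom_modD(3,4)[OF assms(1)] hom_mod_scale[OF assms(1)] in blast)+

text \<open>Extension of a homomorphism modulo \<open>I\<close> by y \<mapsto> z. The twist of
  \<open>y\<close> is written as conjugation in the division ring, and \<open>z\<close> has to
  follow it modulo \<open>I\<close> only. Horner form turns closure under products into inductions,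
  and independence of the powers of \<open>y\<close> makes the relation single valued modulo
  \<open>I\<close>.\<close>

lemma ore_graph_hom_mod:
  assumes \<rho>: "hom_mod s R B I \<rho>" and B: "subalg s B" "ring_ideal B I" "z \<in> B"
    and R: "subalg s R" and S: "subalg s S" "R \<subseteq> S" "y \<in> S" "y \<noteq> 0"
    and y: "pow_indep R y"
    and yz: "\<forall>a b. \<rho> a b \<longrightarrow> (\<exists>b'. \<rho> (y * a * inverse y) b' \<and> z * b - b' * z \<in> I)"
  shows "hom_mod s S B I (ore_graph \<rho> I y z)" "\<rho> a b \<Longrightarrow> ore_graph \<rho> I y z a b" "ore_graph \<rho> I y z y z"
proof -
  note \<rho>D = hom_modD[OF \<rho>] and I = ring_idealD[OF B(2)] and BD = subalgD[OF B(1)] and SD = subalgD[OF S(1)]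
  let ?g = "ore_graph \<rho> I y z"
  have g00: "?g 0 0" by (rule ore_graph.zero) (rule I)
  have \<rho>00: "\<rho> 0 0" by (rule \<rho>D(6)) (rule I)
  show base: "\<rho> a b \<Longrightarrow> ?g a b" for a b using ore_graph.step[OF _ g00, of a b] by simp
  have add_I: "?g a (b + u)" if "?g a b" "u \<in> I" for a b u
    using that(1)
  proof cases
    case zero then show ?thesis using that(2) I by (auto intro: ore_graph.zero)
  next
    case (step a1 b1 a' b')
    have "\<rho> (a1 + 0) (b1 + u)" using step(3) that(2) by (intro \<rho>D(3,6))
    then have "?g (a1 + a' * y) ((b1 + u) + b' * z)" using step by (intro ore_graph.step) auto
    then show ?thesis unfolding step(1,2) by (simp only: add_ac)
  qed
  have add: "?g (a + a') (b + b')" if "?g a b" "?g a' b'" for a b a' b'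
    using that
  proof (induction arbitrary: a' b' rule: ore_graph.induct)
    case (zero u)
    then show ?case using add_I by (simp add: add.commute)
  next
    case (step a b c d)
    note IH = step.IH
    from step.prems show ?case
    proof cases
      case zero
      then show ?thesis using add_I[OF ore_graph.step[OF step.hyps(1,2)]] by simp
    next
      case (step a1 b1 a2 b2)
      have "?g ((a + a1) + (c + a2) * y) ((b + b1) + (d + b2) * z)"
        using step(3,4) \<open>\<rho> a b\<close> by (intro ore_graph.step \<rho>D(3) IH)
      then show ?thesis unfolding step(1,2) by (simp only: distrib_right add_ac)
    qed
  qed
  have shift: "?g (a * y) (b * z)" if "?g a b" for a b
    using ore_graph.step[OF \<rho>00 that] by simp
  have left_\<rho>: "?g (r * a) (t * b)" if "?g a b" "\<rho> r t" for a b r t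
    using that
  proof (induction rule: ore_graph.induct)
    case (zero u)
    then show ?case using \<rho>D(2) by (auto intro: ore_graph.zero I)
  next
    case (step a b a' b')
    then have "?g (r * a + (r * a') * y) (t * b + (t * b') * z)" by (intro ore_graph.step \<rho>D(4))
    then show ?case by (simp add: distrib_left mult.assoc)
  qed
  have left_y: "?g (y * a) (z * b)" if "?g a b" for a b
    using that
  proof (induction rule: ore_graph.induct)
    case (zero u)
    then show ?case using B(3) by (auto intro: ore_graph.zero I)
  next
    case (step a b a' b')
    obtain c where c: "\<rho> (y * a * inverse y) c" "z * b - c * z \<in> I" using yz step(1) by blast
    have "?g ((y * a * inverse y + y * a') * y) ((c + z * b') * z + (z * b - c * z))"
      by (intro add_I shift add base c step.IH)
    moreover have "(y * a * inverse y + y * a') * y = y * (a + a' * y)"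
      using S(4) by (simp add: distrib_left distrib_right mult.assoc)
    moreover have "(c + z * b') * z + (z * b - c * z) = z * (b + b' * z)"
      by (simp add: distrib_left distrib_right mult.assoc)
    ultimately show ?case by simp
  qed
  have mult: "?g (a * a') (b * b')" if "?g a b" "?g a' b'" for a b a' b'
    using that
  proof (induction arbitrary: a' b' rule: ore_graph.induct)
    case (zero u)
    have "b' \<in> B" using zero(2)
      by (induction rule: ore_graph.induct) (auto intro: I BD B(3) \<rho>D(2))
    then show ?case using zero(1) by (auto intro: ore_graph.zero I)
  next
    case (step a b c d)
    have "?g (a * a' + c * (y * a')) (b * b' + d * (z * b'))"
      by (intro add left_\<rho> step left_y)
    then show ?case by (simp add: distrib_right mult.assoc)
  qed
  have carrier: "a \<in> S \<and> b \<in> B" if "?g a b" for a b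
    using that by (induction rule: ore_graph.induct) (use S(2,3) B(3) \<rho>D(1,2) I(1) in \<open>auto intro!: BD SD\<close>)
  \<comment> \<open>Horner forms are unfolded into coefficient sequences so that
    \<open>pow_indep\<close> can be applied to a pair over 0.\<close>
  have sums: "\<exists>m \<alpha> \<beta> u. (\<forall>n. \<rho> (\<alpha> n) (\<beta> n)) \<and> u \<in> I \<and> a = (\<Sum>n<m. \<alpha> n * y ^ n) \<and> b = (\<Sum>n<m. \<beta> n * z ^ n) + u"
    if "?g a b" for a b
    using that
  proof (induction rule: ore_graph.induct)
    case (zero u)
    then show ?case using \<rho>00 by (intro exI[of _ 0] exI[of _ "\<lambda>n. 0"] exI[of _ u]) auto
  next
    case (step a b a' b')
    then obtain m \<alpha> \<beta> u where *: "\<forall>n. \<rho> (\<alpha> n) (\<beta> n)" "u \<in> I"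
      "a' = (\<Sum>n<m. \<alpha> n * y ^ n)" "b' = (\<Sum>n<m. \<beta> n * z ^ n) + u" by auto
    show ?case
    proof (intro exI conjI)
      show "\<forall>n. \<rho> (case_nat a \<alpha> n) (case_nat b \<beta> n)" using * step(1) by (auto split: nat.split)
      show "u * z \<in> I" using * B(3) I by auto
      show "a + a' * y = (\<Sum>n<Suc m. case_nat a \<alpha> n * y ^ n)"
        unfolding sum.lessThan_Suc_shift by (simp add: * sum_distrib_right mult.assoc power_commutes)
      show "b + b' * z = (\<Sum>n<Suc m. case_nat b \<beta> n * z ^ n) + u * z"
        unfolding sum.lessThan_Suc_shift by (simp add: * sum_distrib_right mult.assoc power_commutes distrib_right add_ac)
    qed
  qed
  have zero: "b \<in> I" if b: "?g 0 b" for b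
  proof -
    obtain m \<alpha> \<beta> u where *: "\<forall>n. \<rho> (\<alpha> n) (\<beta> n)" "u \<in> I"
      "0 = (\<Sum>n<m. \<alpha> n * y ^ n)" "b = (\<Sum>n<m. \<beta> n * z ^ n) + u" using sums[OF b] by auto
    have "\<beta> n \<in> I" if "n < m" for n
    proof -
      have "\<alpha> n = 0" by (rule pow_indepD[OF y _ _ that, of \<alpha>]) (use * \<rho>D(1) in auto)
      then show ?thesis using * \<rho>D(7) by metis
    qed
    moreover have sumI: "finite M \<Longrightarrow> (\<And>n. n \<in> M \<Longrightarrow> \<beta> n \<in> I) \<Longrightarrow> (\<Sum>n\<in>M. \<beta> n * z ^ n) \<in> I" for M
      by (induction M rule: finite_induct) (auto intro!: I BD B(3))
    ultimately have "(\<Sum>n<m. \<beta> n * z ^ n) \<in> I" using sumI[of "{..<m}"] by auto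
    then show ?thesis using *(2,4) I(4) by simp
  qed
  show "?g y z" using shift[OF base[OF \<rho>D(5)[of 1]]] by simp
  show "hom_mod s S B I ?g"
    unfolding hom_mod_def using carrier add mult base[OF \<rho>D(5)] zero ore_graph.zero by blast
qed

end

section \<open>Rings, ideals and cosets in elementwise form\<close>

lemma carrier_ring_of [simp]: "carrier (ring_of R) = R"
  and mult_ring_of [simp]: "a \<otimes>\<^bsub>ring_of R\<^esub> b = a * b"
  and add_ring_of [simp]: "a \<oplus>\<^bsub>ring_of R\<^esub> b = a + b"
  and one_ring_of [simp]: "\<one>\<^bsub>ring_of R\<^esub> = 1"
  and zero_ring_of [simp]: "\<zero>\<^bsub>ring_of R\<^esub> = 0"
  by (simp_all add: ring_of_def)

definition ring_closed :: "'f::ring_1 set \<Rightarrow> bool"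
  where "ring_closed R \<longleftrightarrow> 0 \<in> R \<and> 1 \<in> R \<and> (\<forall>a\<in>R. - a \<in> R \<and> (\<forall>b\<in>R. a + b \<in> R \<and> a * b \<in> R))"

lemma (in k_algebra) subalg_ring_closed: "subalg s R \<Longrightarrow> ring_closed R"
  using subalgD[of R] by (auto simp: ring_closed_def)

lemma ring_ring_of:
  assumes "ring_closed R"
  shows "ring (ring_of R)"
proof (rule ringI)
  show "abelian_group (ring_of R)"
    by (rule abelian_groupI) (use assms in \<open>auto simp: ring_closed_def add_ac intro: bexI[of _ "- x" for x]\<close>)
  show "Group.monoid (ring_of R)"
    by (rule monoidI) (use assms in \<open>auto simp: ring_closed_def mult.assoc\<close>)
qed (auto simp: algebra_simps)

lemma ideal_ring_ideal:
  assumes "ring_closed R" "ideal I (ring_of R)"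
  shows "ring_ideal R I"
proof -
  interpret ideal I "ring_of R" by fact
  have "- u \<in> I" if "u \<in> I" for u
    using I_l_closed[of u "- 1"] that assms(1) by (simp add: ring_closed_def)
  then show ?thesis
    using a_subset additive_subgroup.zero_closed[OF is_additive_subgroup]
      additive_subgroup.a_closed[OF is_additive_subgroup] I_l_closed I_r_closed
    by (auto simp: ring_ideal_def)
qed

lemma mem_coset_iff: "c \<in> I +>\<^bsub>ring_of R\<^esub> b \<longleftrightarrow> c - b \<in> I"
  unfolding a_r_coset_def' by (auto simp: ring_of_def algebra_simps) (metis add.commute diff_add_cancel)

lemma coset_eq_iff:
  assumes "ring_ideal R I"
  shows "I +>\<^bsub>ring_of R\<^esub> b = I +>\<^bsub>ring_of R\<^esub> c \<longleftrightarrow> b - c \<in> I"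
proof
  assume "I +>\<^bsub>ring_of R\<^esub> b = I +>\<^bsub>ring_of R\<^esub> c"
  moreover have "b \<in> I +>\<^bsub>ring_of R\<^esub> b" using ring_idealD[OF assms] by (simp add: mem_coset_iff)
  ultimately show "b - c \<in> I" by (simp add: mem_coset_iff)
next
  assume bc: "b - c \<in> I"
  have "d - b \<in> I \<longleftrightarrow> d - c \<in> I" for d
    using ring_idealD(4)[OF assms _ bc, of "d - b"] ring_idealD(5)[OF assms _ bc, of "d - c"] by auto
  then show "I +>\<^bsub>ring_of R\<^esub> b = I +>\<^bsub>ring_of R\<^esub> c" by (auto simp: mem_coset_iff)
qed

lemma (in quantum_nilpotent) alg_eq: "alg D j = ring_of (G j (num D))"
  by (simp add: alg_def G_def)

lemma (in quantum_nilpotent) ring_closed_G [simp]: "ring_closed (G j i)"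
  by (rule subalg_ring_closed) simp

lemma genideal_ring_of:
  assumes "ring_closed R" "a \<in> R"
  shows "ideal (Idl\<^bsub>ring_of R\<^esub> {a}) (ring_of R)" "a \<in> Idl\<^bsub>ring_of R\<^esub> {a}"
proof -
  interpret ring "ring_of R" using assms(1) by (rule ring_ring_of)
  show "ideal (Idl\<^bsub>ring_of R\<^esub> {a}) (ring_of R)" "a \<in> Idl\<^bsub>ring_of R\<^esub> {a}"
    using genideal_ideal[of "{a}"] genideal_self'[of a] assms(2) by auto
qed

context deletion_step
begin

lemma alg_Suc: "alg D (j + 1) = ring_of (G (Suc j) (num D))"
  by (simp add: alg_eq Suc_eq_plus1)

abbreviation I :: "'f set" where "I \<equiv> x_ideal D j"

lemma ideal_I: "ideal I (ring_of (G (Suc j) (num D)))" and X_in_I: "X \<in> I"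
  using genideal_ring_of[OF ring_closed_G gen_in_G[of j "num D" "Suc j"]] j
  by (simp_all only: x_ideal_def alg_eq Suc_eq_plus1[symmetric])

lemma ring_ideal_I: "ring_ideal (G (Suc j) (num D)) I"
  using ideal_ring_ideal[OF ring_closed_G ideal_I] .

text \<open>The map y_l \<mapsto> x_l is extended generator by generator from the image of A_(j-1),
  where it is \<open>h\<close> after the inverse of \<open>\<theta>\<close>. The bound j \<le> i + 1
  makes i = j - 1 the first real case.\<close>

lemma graph_ex:
  assumes "j \<le> Suc i" "i \<le> num D"
  shows "\<exists>\<rho>. hom_mod (scal D) (G j i) (G (Suc j) (num D)) I \<rho> \<and> (\<forall>l\<in>{1..i}. \<rho> (gen D j l) (gen D (Suc j) l))"
  using assms
proof (induction i)
  case 0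
  then show ?case using j by simp
next
  case (Suc i)
  note I = ring_idealD[OF ring_ideal_I]
  show ?case
  proof (cases "j = Suc (Suc i)")
    case True
    have i: "Suc i = j - 1" using True by simp
    \<comment> \<open>The start of the construction. Parametrising by \<open>r\<close> avoids
      inverting \<open>\<theta>\<close>; its injectivity is needed only for the elements related to
      0.\<close>
    define \<rho> where "\<rho> a b \<longleftrightarrow> (\<exists>r\<in>base D (j - 1). \<exists>u\<in>I. a = \<theta> r \<and> b = h r + u)" for a b
    have \<rho>I: "\<rho> (\<theta> r) (h r + u)" if "r \<in> base D (j - 1)" "u \<in> I" for r u
      using that by (auto simp: \<rho>_def)
    have hG: "h r \<in> G (Suc j) (num D)" if "r \<in> base D (j - 1)" for r
      using base_j[OF that] image_h G_mono[of j "num D" "Suc j"] j by blast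
    have "hom_mod (scal D) (G j (j - 1)) (G (Suc j) (num D)) I \<rho>"
      unfolding hom_mod_def
    proof (intro conjI allI impI ballI)
      fix a b assume "\<rho> a b"
      then show "a \<in> G j (j - 1)" "b \<in> G (Suc j) (num D)"
        using image_\<theta> hG I(1) GD(3) by (auto simp: \<rho>_def)
    next
      fix a b a' b' assume "\<rho> a b" "\<rho> a' b'"
      then obtain r u r' u' where *: "r \<in> base D (j - 1)" "u \<in> I" "a = \<theta> r" "b = h r + u"
        "r' \<in> base D (j - 1)" "u' \<in> I" "a' = \<theta> r'" "b' = h r' + u'" by (auto simp: \<rho>_def)
      have "a + a' = \<theta> (r + r')" "b + b' = h (r + r') + (u + u')"
        using * by (simp_all add: \<theta>_add h_add add_ac)
      then show "\<rho> (a + a') (b + b')" using \<rho>I[OF R(3) I(4)] *(1,2,5,6) by presburger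
      have "a * a' = \<theta> (r * r')" "b * b' = h (r * r') + (h r * u' + u * h r' + u * u')"
        using * by (simp_all add: \<theta>_mult h_mult distrib_left distrib_right add_ac)
      moreover have "h r * u' + u * h r' + u * u' \<in> I" using * hG I by auto
      ultimately show "\<rho> (a * a') (b * b')" using \<rho>I[OF R(4)] *(1,5) by presburger
    next
      fix k show "\<rho> (scal D k 1) (scal D k 1)"
        unfolding \<rho>_def using R I by (intro bexI[of _ "scal D k 1"] bexI[of _ 0]) (auto simp: \<theta>_scale h_scale \<theta>_one h_one)
    next
      fix u assume "u \<in> I"
      then show "\<rho> 0 u"
        unfolding \<rho>_def using R h_zero \<theta>_scale[of 1 0] by (intro bexI[of _ 0] bexI[of _ u]) auto
    next
      fix b assume "\<rho> 0 b"
      then obtain r u where *: "r \<in> base D (j - 1)" "u \<in> I" "0 = \<theta> r" "b = h r + u" by (auto simp: \<rho>_def)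
      have "\<theta> 0 = 0" using \<theta>_scale[of 1 0] R by simp
      then have "r = 0" using stage_new * R unfolding stage_def inj_on_def by metis
      then show "b \<in> I" using * h_zero by simp
    qed
    moreover have "\<rho> (gen D j l) (gen D (Suc j) l)" if "l \<in> {1..j - 1}" for l
      unfolding \<rho>_def using that gen_lt[of l] h_var[of l] var_in_base[of l "j - 1"] I j
      by (intro bexI[of _ "var D l"] bexI[of _ 0]) auto
    ultimately show ?thesis unfolding i by blast
  next
    case False
    let ?y = "gen D j (Suc i)" and ?z = "gen D (Suc j) (Suc i)"
    have ij: "j \<le> Suc i" using False Suc.prems by simp
    then obtain \<rho> where \<rho>: "hom_mod (scal D) (G j i) (G (Suc j) (num D)) I \<rho>"
      and \<rho>g: "\<And>l. l \<in> {1..i} \<Longrightarrow> \<rho> (gen D j l) (gen D (Suc j) l)"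
      using Suc by auto
    note \<rho>D = hom_modD[OF \<rho>]
    have yz: "?y = ?z" using ij by (rule gen_ge)
    have indep: "pow_indep (G j i) ?y" using new_indep[of "Suc i"] ij Suc.prems by simp
    have y0: "?y \<noteq> 0" by (rule pow_indep_nonzero[OF indep]) (auto intro: GD)
    have conj: "\<exists>b b'. \<rho> a b \<and> \<rho> (?y * a * inverse ?y) b' \<and> ?z * b - b' * ?z \<in> I" if "a \<in> G j i" for a
      using that
    proof (induction rule: G_induct)
      case l: (gen l)
      have "gen D j (Suc i) * gen D j l = scal D (lam D (Suc i) l) (gen D j l * gen D j (Suc i))"
        using stage_new l ij Suc.prems by (auto simp: stage_def)
      then have ya: "?y * gen D j l * inverse ?y = scal D (lam D (Suc i) l) (gen D j l)" using y0 l by (simp add: mult_scale mult.assoc)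
      show ?case
      proof (intro exI conjI)
        show 1: "\<rho> (gen D j l) (gen D (Suc j) l)" using \<rho>g l by auto
        show "\<rho> (?y * gen D j l * inverse ?y) (scal D (lam D (Suc i) l) (gen D (Suc j) l))"
          unfolding ya by (rule hom_mod_scale[OF \<rho> 1])
        show "?z * gen D (Suc j) l - scal D (lam D (Suc i) l) (gen D (Suc j) l) * ?z \<in> I"
        proof (cases "j = Suc i")
          case True
          \<comment> \<open>For the generator x_j itself the old commutation rule still contains a
            derivation; modulo \<open>I\<close> both products vanish, so nothing has to be
            compared.\<close>
          have "?z \<in> I" using True X_in_I by simp
          moreover have "gen D (Suc j) l \<in> G (Suc j) (num D)" using gen_in_G l Suc.prems by auto
          ultimately show ?thesis using GD by (intro I(5,6,7)) auto
        next
          case False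
          then show ?thesis using gen_comm[of "Suc i" l] l ij Suc.prems I by (simp add: mult_scale)
        qed
      qed
    next
      case one
      have "\<rho> 1 1" using \<rho>D(5)[of 1] by simp
      then show ?case using y0 I by (intro exI[of _ 1]) auto
    next
      case (add a1 a2)
      then obtain b1 b1' b2 b2' where "\<rho> a1 b1" "\<rho> (?y * a1 * inverse ?y) b1'" "?z * b1 - b1' * ?z \<in> I"
        "\<rho> a2 b2" "\<rho> (?y * a2 * inverse ?y) b2'" "?z * b2 - b2' * ?z \<in> I" by blast
      then have "\<rho> (a1 + a2) (b1 + b2)" "\<rho> (?y * (a1 + a2) * inverse ?y) (b1' + b2')"
        "(?z * b1 - b1' * ?z) + (?z * b2 - b2' * ?z) \<in> I"
        using \<rho>D(3) I by (auto simp: distrib_left distrib_right)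
      moreover have "(?z * b1 - b1' * ?z) + (?z * b2 - b2' * ?z) = ?z * (b1 + b2) - (b1' + b2') * ?z"
        by (simp add: algebra_simps)
      ultimately show ?case by metis
    next
      case (mult a1 a2)
      then obtain b1 b1' b2 b2' where *: "\<rho> a1 b1" "\<rho> (?y * a1 * inverse ?y) b1'" "?z * b1 - b1' * ?z \<in> I"
        "\<rho> a2 b2" "\<rho> (?y * a2 * inverse ?y) b2'" "?z * b2 - b2' * ?z \<in> I" by blast
      have "\<rho> ((?y * a1 * inverse ?y) * (?y * a2 * inverse ?y)) (b1' * b2')" using * \<rho>D(4) by blast
      also have "(?y * a1 * inverse ?y) * (?y * a2 * inverse ?y) = ?y * (a1 * a2) * inverse ?y"
        using y0 by (simp add: mult.assoc) (simp add: mult.assoc[symmetric])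
      finally have 1: "\<rho> (?y * (a1 * a2) * inverse ?y) (b1' * b2')" .
      have "(?z * b1 - b1' * ?z) * b2 + b1' * (?z * b2 - b2' * ?z) \<in> I"
        by (rule I(4)[OF I(7)[OF \<rho>D(2)[OF *(4)] *(3)] I(6)[OF \<rho>D(2)[OF *(2)] *(6)]])
      also have "(?z * b1 - b1' * ?z) * b2 + b1' * (?z * b2 - b2' * ?z) = ?z * (b1 * b2) - (b1' * b2') * ?z"
        by (simp add: algebra_simps)
      finally show ?case using 1 \<rho>D(4)[OF *(1,4)] by blast
    next
      case (scale c a)
      then obtain b b' where *: "\<rho> a b" "\<rho> (?y * a * inverse ?y) b'" "?z * b - b' * ?z \<in> I" by blast
      have "scal D c 1 * (?z * b - b' * ?z) \<in> I" by (rule I(6)[OF GD(5)[OF GD(1)] *(3)])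
      then have "?z * scal D c b - scal D c b' * ?z \<in> I" by (simp add: mult_scale scale_right_diff_distrib)
      moreover have "\<rho> (?y * scal D c a * inverse ?y) (scal D c b')"
        using hom_mod_scale[OF \<rho> *(2), of c] by (simp add: mult_scale)
      ultimately show ?case using hom_mod_scale[OF \<rho> *(1), of c] by blast
    qed
    \<comment> \<open>From one representative to all: two representatives of the same image differ
      by an element of \<open>I\<close>, and so do their products with \<open>?z\<close>.\<close>
    have comm: "\<forall>a b. \<rho> a b \<longrightarrow> (\<exists>b'. \<rho> (?y * a * inverse ?y) b' \<and> ?z * b - b' * ?z \<in> I)"
    proof (intro allI impI)
      fix a b assume ab: "\<rho> a b"
      obtain b0 b' where *: "\<rho> a b0" "\<rho> (?y * a * inverse ?y) b'" "?z * b0 - b' * ?z \<in> I"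
        using conj[OF \<rho>D(1)[OF ab]] by blast
      have "?z \<in> G (Suc j) (num D)" using gen_in_G[of "Suc i"] Suc.prems by auto
      then have "?z * (b - b0) + (?z * b0 - b' * ?z) \<in> I"
        using hom_mod_unique[OF \<rho> ab *(1)] *(3) by (rule_tac I(4)[OF I(6)])
      then show "\<exists>b'. \<rho> (?y * a * inverse ?y) b' \<and> ?z * b - b' * ?z \<in> I"
        using *(2) by (auto simp: algebra_simps)
    qed
    have S: "G j i \<subseteq> G j (Suc i)" "?y \<in> G j (Suc i)" "?z \<in> G (Suc j) (num D)"
      using G_mono[of i "Suc i"] gen_in_G Suc.prems by auto
    note * = ore_graph_hom_mod[OF \<rho> subalg_G ring_ideal_I S(3) subalg_G subalg_G S(1,2) y0 indep comm]
    have "ore_graph \<rho> I ?y ?z (gen D j l) (gen D (Suc j) l)" if "l \<in> {1..Suc i}" for l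
      using that *(3) *(2)[OF \<rho>g[of l]] by (cases "l = Suc i") auto
    then show ?thesis using *(1) by blast
  qed
qed

text \<open>\<open>g_map\<close> is a choice, so these properties hold as soon as one such map
  exists. The graph supplies it, by taking the class of any related element.\<close>

lemma g_map_props:
  "g_map D j \<in> ring_hom (alg D j) (alg D (j + 1) Quot I)"
  "g_map D j (scal D k 1) = I +>\<^bsub>alg D (j + 1)\<^esub> scal D k 1"
  "i \<in> {1..num D} \<Longrightarrow> g_map D j (gen D j i) = I +>\<^bsub>alg D (j + 1)\<^esub> gen D (j + 1) i"
proof -
  let ?A = "alg D (j + 1)"
  note IA = ideal_I[folded alg_Suc]
  define P where "P g \<longleftrightarrow> g \<in> ring_hom (alg D j) (?A Quot I) \<and>
    (\<forall>c. g (scal D c 1) = I +>\<^bsub>?A\<^esub> scal D c 1) \<and>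
    (\<forall>i\<in>{1..num D}. g (gen D j i) = I +>\<^bsub>?A\<^esub> gen D (j + 1) i)" for g
  obtain \<rho> where \<rho>: "hom_mod (scal D) (G j (num D)) (G (Suc j) (num D)) I \<rho>"
    and \<rho>g: "\<And>l. l \<in> {1..num D} \<Longrightarrow> \<rho> (gen D j l) (gen D (Suc j) l)"
    using graph_ex[of "num D"] j by auto
  note \<rho>D = hom_modD[OF \<rho>]
  have total: "\<exists>b. \<rho> a b" if "a \<in> G j (num D)" for a
    using hom_mod_total[OF \<rho>[unfolded G_def[of j]] _ that[unfolded G_def]] \<rho>g by blast
  define g where "g a = I +>\<^bsub>?A\<^esub> (SOME b. \<rho> a b)" for a
  have g: "g a = I +>\<^bsub>?A\<^esub> b" if "\<rho> a b" for a b
  proof -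
    have "\<rho> a (SOME b. \<rho> a b)" using that by (rule someI)
    then show ?thesis
      using hom_mod_unique[OF \<rho> _ that] by (simp add: g_def alg_Suc coset_eq_iff[OF ring_ideal_I])
  qed
  have "P g"
    unfolding P_def
  proof (intro conjI allI ballI ring_hom_memI)
    fix a assume "a \<in> carrier (alg D j)"
    then obtain b where "\<rho> a b" using total by (auto simp: alg_eq)
    then show "g a \<in> carrier (?A Quot I)"
      using \<rho>D(2) ideal.rcos_ring_hom[OF IA] by (auto simp: g ring_hom_def alg_eq Suc_eq_plus1)
  next
    fix a a' assume "a \<in> carrier (alg D j)" "a' \<in> carrier (alg D j)"
    then obtain b b' where *: "\<rho> a b" "\<rho> a' b'" using total by (auto simp: alg_eq) blast
    then have b: "b \<in> carrier ?A" "b' \<in> carrier ?A" using \<rho>D(2) by (auto simp: alg_Suc)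
    show "g (a \<otimes>\<^bsub>alg D j\<^esub> a') = g a \<otimes>\<^bsub>?A Quot I\<^esub> g a'"
      using g[OF \<rho>D(4)[OF *]] ideal.rcos_ring_hom[OF IA] b by (auto simp: g[OF *(1)] g[OF *(2)] ring_hom_def alg_eq Suc_eq_plus1)
    show "g (a \<oplus>\<^bsub>alg D j\<^esub> a') = g a \<oplus>\<^bsub>?A Quot I\<^esub> g a'"
      using g[OF \<rho>D(3)[OF *]] ideal.rcos_ring_hom[OF IA] b by (auto simp: g[OF *(1)] g[OF *(2)] ring_hom_def alg_eq Suc_eq_plus1)
  next
    show "g \<one>\<^bsub>alg D j\<^esub> = \<one>\<^bsub>?A Quot I\<^esub>"
      using g[OF \<rho>D(5)[of 1]] by (simp add: FactRing_def alg_eq)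
  next
    fix c show "g (scal D c 1) = I +>\<^bsub>?A\<^esub> scal D c 1" by (rule g[OF \<rho>D(5)])
  next
    fix i assume "i \<in> {1..num D}"
    then show "g (gen D j i) = I +>\<^bsub>?A\<^esub> gen D (j + 1) i" using g[OF \<rho>g[of i]] by (simp add: Suc_eq_plus1)
  qed
  then have "P (g_map D j)"
    unfolding g_map_def P_def[symmetric, abs_def] by (rule someI[of P])
  then show "g_map D j \<in> ring_hom (alg D j) (alg D (j + 1) Quot I)"
    "g_map D j (scal D k 1) = I +>\<^bsub>alg D (j + 1)\<^esub> scal D k 1"
    "i \<in> {1..num D} \<Longrightarrow> g_map D j (gen D j i) = I +>\<^bsub>alg D (j + 1)\<^esub> gen D (j + 1) i"
    by (auto simp: P_def)
qed

end

section \<open>The quotients inside the division ring of fractions\<close>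

text \<open>\<open>\<phi>\<close> is \<open>f\<close> after the projection from \<open>R\<close> to
  R/P. Working with \<open>\<phi>\<close> on elements replaces the descriptions by representatives
  in \<open>ident_step\<close> with plain formulas.\<close>

definition quot_map :: "'f::ring_1 set \<Rightarrow> 'f set \<Rightarrow> ('f \<Rightarrow> 'g::division_ring) \<Rightarrow> ('f set \<Rightarrow> 'g) \<Rightarrow> bool"
  where "quot_map R P \<phi> f \<longleftrightarrow> \<phi> 1 = 1 \<and>
    (\<forall>a\<in>R. \<forall>b\<in>R. \<phi> (a + b) = \<phi> a + \<phi> b \<and> \<phi> (a * b) = \<phi> a * \<phi> b) \<and>
    P = {a \<in> R. \<phi> a = 0} \<and> (\<forall>a\<in>R. f (P +>\<^bsub>ring_of R\<^esub> a) = \<phi> a)"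

lemma quot_mapD:
  assumes "quot_map R P \<phi> f" "ring_closed R"
  shows "\<phi> 1 = 1" "a \<in> R \<Longrightarrow> b \<in> R \<Longrightarrow> \<phi> (a + b) = \<phi> a + \<phi> b"
    "a \<in> R \<Longrightarrow> b \<in> R \<Longrightarrow> \<phi> (a * b) = \<phi> a * \<phi> b" "\<phi> 0 = 0"
    "a \<in> R \<Longrightarrow> \<phi> (- a) = - \<phi> a" "a \<in> R \<Longrightarrow> b \<in> R \<Longrightarrow> \<phi> (a - b) = \<phi> a - \<phi> b"
    "a \<in> R \<Longrightarrow> \<phi> (a ^ n) = \<phi> a ^ n" "a \<in> P \<longleftrightarrow> a \<in> R \<and> \<phi> a = 0"
    "a \<in> R \<Longrightarrow> f (P +>\<^bsub>ring_of R\<^esub> a) = \<phi> a" "ring_ideal R P"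
proof -
  note Q = assms(1)[unfolded quot_map_def] and R = assms(2)[unfolded ring_closed_def]
  show 1: "\<phi> 1 = 1" using Q by blast
  show 2: "a \<in> R \<Longrightarrow> b \<in> R \<Longrightarrow> \<phi> (a + b) = \<phi> a + \<phi> b" for a b using Q by blast
  show 3: "a \<in> R \<Longrightarrow> b \<in> R \<Longrightarrow> \<phi> (a * b) = \<phi> a * \<phi> b" for a b using Q by blast
  show 4: "\<phi> 0 = 0" using 2[of 0 0] R by simp
  show 5: "a \<in> R \<Longrightarrow> \<phi> (- a) = - \<phi> a" for a
    using 2[of a "- a"] R 4 by (simp add: eq_neg_iff_add_eq_0 add.commute)
  show 6: "a \<in> R \<Longrightarrow> b \<in> R \<Longrightarrow> \<phi> (a - b) = \<phi> a - \<phi> b" for a b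
    using 2[of a "- b"] 5[of b] R by simp
  show "a \<in> R \<Longrightarrow> \<phi> (a ^ n) = \<phi> a ^ n"
  proof (induction n)
    case (Suc n)
    have "a ^ n \<in> R" using Suc.prems R by (induction n) auto
    then show ?case using Suc 3 by simp
  qed (simp add: 1)
  show 7: "a \<in> P \<longleftrightarrow> a \<in> R \<and> \<phi> a = 0" for a using Q by blast
  show "a \<in> R \<Longrightarrow> f (P +>\<^bsub>ring_of R\<^esub> a) = \<phi> a" using Q by blast
  show "ring_ideal R P" using R by (auto simp: ring_ideal_def 7 2 3 4 5)
qed

text \<open>Tailored to \<open>ident_step\<close>: a value described through any representative of a
  class is well defined when each representative determines \<phi>(a), since \<open>\<phi>\<close>
  is constant on the classes of its kernel.\<close>

lemma quot_mapI:
  assumes R: "ring_closed R"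
    and hom: "\<phi> 1 = 1" "\<And>a b. a \<in> R \<Longrightarrow> b \<in> R \<Longrightarrow> \<phi> (a + b) = \<phi> a + \<phi> b"
      "\<And>a b. a \<in> R \<Longrightarrow> b \<in> R \<Longrightarrow> \<phi> (a * b) = \<phi> a * \<phi> b"
    and ker: "P = {a \<in> R. \<phi> a = 0}"
    and f: "\<And>C. f C = (THE v. \<exists>a\<in>C. K a v)" "\<And>a v. a \<in> R \<Longrightarrow> K a v \<longleftrightarrow> v = \<phi> a"
  shows "quot_map R P \<phi> f"
proof -
  have "\<phi> 0 = 0" using hom(2)[of 0 0] R by (simp add: ring_closed_def)
  have "f (P +>\<^bsub>ring_of R\<^esub> a0) = \<phi> a0" if a0: "a0 \<in> R" for a0
  proof -
    have "v = \<phi> a0" if "a \<in> P +>\<^bsub>ring_of R\<^esub> a0" "K a v" for a v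
    proof -
      have "a - a0 \<in> R" "\<phi> (a - a0) = 0" using that(1) by (auto simp: mem_coset_iff ker)
      moreover from this have "a - a0 + a0 \<in> R" using a0 R unfolding ring_closed_def by blast
      ultimately have "a \<in> R" "\<phi> a = \<phi> a0" using a0 hom(2)[of "a - a0" a0] by simp_all
      then show ?thesis using f(2) that(2) by simp
    qed
    moreover have "a0 \<in> P +>\<^bsub>ring_of R\<^esub> a0" "K a0 (\<phi> a0)"
      using f(2) a0 R \<open>\<phi> 0 = 0\<close> by (simp_all add: mem_coset_iff ker ring_closed_def)
    ultimately show ?thesis unfolding f(1) by (intro the_equality) blast+
  qed
  then show ?thesis unfolding quot_map_def using hom ker by blast
qed

lemma ring_ideal_ideal:
  assumes "ring_closed R" "ring_ideal R I"
  shows "ideal I (ring_of R)"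
proof (rule idealI)
  interpret ring "ring_of R" using assms(1) by (rule ring_ring_of)
  have inv: "inv\<^bsub>add_monoid (ring_of R)\<^esub> a = - a" if "a \<in> R" for a
    using that assms(1) minus_equality[of "- a" a] by (simp add: ring_closed_def a_inv_def)
  show "subgroup I (add_monoid (ring_of R))"
    by (unfold_locales) (use ring_idealD[OF assms(2)] inv in auto)
  show "ring (ring_of R)" by (rule ring_axioms)
qed (use ring_idealD[OF assms(2)] in auto)

lemma genideal_minimal_ring_of:
  assumes "ring_closed R" "ring_ideal R P" "a \<in> P"
  shows "Idl\<^bsub>ring_of R\<^esub> {a} \<subseteq> P"
proof -
  interpret ring "ring_of R" using assms(1) by (rule ring_ring_of)
  show ?thesis by (rule genideal_minimal[OF ring_ideal_ideal]) (use assms in auto)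
qed

text \<open>Elements of \<open>R\<close> are fractions, on both sides, with numerator in
  \<open>S\<close> and a power of \<open>z\<close> as denominator. Required in both directions, this
  replaces equality of two localisations.\<close>

definition power_cofinal :: "'g::division_ring \<Rightarrow> 'g set \<Rightarrow> 'g set \<Rightarrow> bool"
  where "power_cofinal z R S \<longleftrightarrow> (\<forall>r\<in>R. (\<exists>n. r * z ^ n \<in> S) \<and> (\<exists>n. z ^ n * r \<in> S))"

context deletion_step
begin

abbreviation A where "A \<equiv> G (Suc j) (num D)"
abbreviation A' where "A' \<equiv> G j (num D)"

lemma X_in: "X \<in> A" "X \<in> A'"
  using gen_in_G[of j "num D" "Suc j"] gen_in_G[of j "num D" j] gen_ge[of j] j by auto

text \<open>The ideal \<open>I\<close> lies in \<open>P\<close> because \<open>X\<close> does, so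
  \<open>\<phi>\<close> takes one value on all representatives of g_j(a), and this value is
  \<phi>'(a). The generators have the same images before and after, hence so do the
  algebras.\<close>

lemma quot_map_step_mem:
  assumes \<phi>: "quot_map A P \<phi> f" and X: "X \<in> P"
    and fstep: "\<And>C. f' C = (THE v. \<exists>a\<in>C. \<exists>b\<in>g_map D j a. v = f (P +>\<^bsub>alg D (j + 1)\<^esub> b))"
  shows "\<exists>\<phi>'. quot_map A' (psi_step D j P) \<phi>' f' \<and> (\<forall>k. \<phi>' (scal D k 1) = \<phi> (scal D k 1)) \<and>
    (\<forall>i\<in>{1..num D}. \<phi>' (gen D j i) = \<phi> (gen D (Suc j) i)) \<and> \<phi>' ` A' = \<phi> ` A"
proof -
  note \<phi>D = quot_mapD[OF \<phi> ring_closed_G] and I = ring_idealD[OF ring_ideal_I]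
  have IP: "I \<subseteq> P"
    unfolding x_ideal_def alg_eq Suc_eq_plus1[symmetric] by (rule genideal_minimal_ring_of[OF ring_closed_G \<phi>D(10) X])
  let ?g = "g_map D j"
  note gD = g_map_props[unfolded alg_eq Suc_eq_plus1[symmetric]]
  note rh = ideal.rcos_ring_hom[OF ideal_I]
  have g_ex: "\<exists>b\<in>A. ?g a = I +>\<^bsub>ring_of A\<^esub> b" if "a \<in> A'" for a
    using gD(1) that by (auto simp: ring_hom_def FactRing_def A_RCOSETS_def' Pi_iff)
  define \<phi>' where "\<phi>' a = \<phi> (SOME b. b \<in> ?g a)" for a
  have mem: "b \<in> A \<and> \<phi> b = \<phi>' a" if a: "a \<in> A'" and b: "b \<in> ?g a" for a b
  proof -
    obtain b0 where b0: "b0 \<in> A" "?g a = I +>\<^bsub>ring_of A\<^esub> b0" using g_ex a by blast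
    have *: "b' \<in> A \<and> \<phi> b' = \<phi> b0" if "b' \<in> ?g a" for b'
    proof -
      have u: "b' - b0 \<in> I" using that b0 mem_coset_iff by blast
      then have "b' - b0 \<in> A" using I by blast
      then have b': "b' \<in> A" using GD(3)[of "b' - b0" _ _ b0] b0 by simp
      have "\<phi> (b' - b0) = 0" using u IP \<phi>D(8) by blast
      then show ?thesis using \<phi>D(6) b0 b' by simp
    qed
    moreover have "(SOME b. b \<in> ?g a) \<in> ?g a" using b by (rule someI)
    ultimately show ?thesis using b by (simp add: \<phi>'_def)
  qed
  have \<phi>'_eq: "\<phi>' a = \<phi> b" if "a \<in> A'" "b \<in> A" "?g a = I +>\<^bsub>ring_of A\<^esub> b" for a b
    using mem[OF that(1), of b] that I by (simp add: mem_coset_iff)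
  have hom: "\<phi>' (a + a') = \<phi>' a + \<phi>' a'" "\<phi>' (a * a') = \<phi>' a * \<phi>' a'" if a: "a \<in> A'" "a' \<in> A'" for a a'
  proof -
    obtain b b' where b: "b \<in> A" "?g a = I +>\<^bsub>ring_of A\<^esub> b" "b' \<in> A" "?g a' = I +>\<^bsub>ring_of A\<^esub> b'"
      using g_ex a by metis
    have "?g (a + a') = I +>\<^bsub>ring_of A\<^esub> (b + b')" "?g (a * a') = I +>\<^bsub>ring_of A\<^esub> (b * b')"
      using gD(1) a b rh unfolding ring_hom_def by auto
    then show "\<phi>' (a + a') = \<phi>' a + \<phi>' a'" "\<phi>' (a * a') = \<phi>' a * \<phi>' a'"
      using \<phi>'_eq[OF GD(3)[OF a] GD(3)[OF b(1,3)]] \<phi>'_eq[OF GD(4)[OF a] GD(4)[OF b(1,3)]]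
        \<phi>'_eq[OF a(1) b(1,2)] \<phi>'_eq[OF a(2) b(3,4)] \<phi>D(2,3)[OF b(1,3)] by simp_all
  qed
  have scal: "\<phi>' (scal D k 1) = \<phi> (scal D k 1)" for k
    by (rule \<phi>'_eq) (use GD gD(2) in auto)
  have gens: "\<phi>' (gen D j i) = \<phi> (gen D (Suc j) i)" if "i \<in> {1..num D}" for i
    by (rule \<phi>'_eq) (use that gen_in_G gD(3)[of i] in \<open>auto simp: Suc_eq_plus1\<close>)
  have ker: "psi_step D j P = {a \<in> A'. \<phi>' a = 0}"
  proof -
    have "?g a \<in> {I +>\<^bsub>ring_of A\<^esub> p | p. p \<in> P} \<longleftrightarrow> \<phi>' a = 0" if a: "a \<in> A'" for a
    proof -
      obtain b where b: "b \<in> A" "?g a = I +>\<^bsub>ring_of A\<^esub> b" using g_ex a by blast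
      show ?thesis
      proof
        assume "?g a \<in> {I +>\<^bsub>ring_of A\<^esub> p | p. p \<in> P}"
        then obtain p where "p \<in> P" "?g a = I +>\<^bsub>ring_of A\<^esub> p" by blast
        then show "\<phi>' a = 0" using \<phi>'_eq[of a p] a \<phi>D(8) by auto
      next
        assume "\<phi>' a = 0"
        then have "b \<in> P" using \<phi>'_eq[OF a b] \<phi>D(8) b by simp
        then show "?g a \<in> {I +>\<^bsub>ring_of A\<^esub> p | p. p \<in> P}" using b by blast
      qed
    qed
    then show ?thesis using X unfolding psi_step_def Let_def alg_Suc by (auto simp: alg_eq Suc_eq_plus1)
  qed
  have "quot_map A' (psi_step D j P) \<phi>' f'"
  proof (rule quot_mapI[OF ring_closed_G _ hom ker fstep])
    show "\<phi>' 1 = 1" using scal[of 1] \<phi>D(1) by simp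
    fix a v assume a: "a \<in> A'"
    obtain b where b: "b \<in> A" "?g a = I +>\<^bsub>ring_of A\<^esub> b" using g_ex a by blast
    have "b \<in> ?g a" using b(2) I by (simp add: mem_coset_iff)
    moreover have "f (P +>\<^bsub>alg D (j + 1)\<^esub> b) = \<phi>' a" if "b \<in> ?g a" for b
      using mem[OF a that] \<phi>D(9) by (simp add: alg_Suc)
    ultimately show "(\<exists>b\<in>?g a. v = f (P +>\<^bsub>alg D (j + 1)\<^esub> b)) \<longleftrightarrow> v = \<phi>' a" by metis
  qed
  moreover have "\<phi>' ` A' = \<phi> ` A"
  proof
    show "\<phi>' ` A' \<subseteq> \<phi> ` A"
    proof (rule image_subsetI)
      fix a assume a: "a \<in> A'"
      obtain b where "b \<in> A" "?g a = I +>\<^bsub>ring_of A\<^esub> b" using g_ex a by blast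
      then show "\<phi>' a \<in> \<phi> ` A" using \<phi>'_eq[OF a] by simp
    qed
    have "\<exists>a\<in>A'. \<phi>' a = \<phi> b" if "b \<in> A" for b
      using that
    proof (induction rule: G_induct)
      case (gen i)
      then show ?case using gens[of i] gen_in_G[of i "num D" j] by auto
    next
      case one
      then show ?case using scal[of 1] GD by auto
    next
      case (add b b')
      then obtain a a' where "a \<in> A'" "\<phi>' a = \<phi> b" "a' \<in> A'" "\<phi>' a' = \<phi> b'" by blast
      then show ?case using GD(3) hom(1) \<phi>D(2)[of b b'] add(1,2) by (intro bexI[of _ "a + a'"]) auto
    next
      case (mult b b')
      then obtain a a' where "a \<in> A'" "\<phi>' a = \<phi> b" "a' \<in> A'" "\<phi>' a' = \<phi> b'" by blast
      then show ?case using GD(4) hom(2) \<phi>D(3)[of b b'] mult(1,2) by (intro bexI[of _ "a * a'"]) auto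
    next
      case (scale k b)
      then obtain a where a: "a \<in> A'" "\<phi>' a = \<phi> b" by blast
      have k: "scal D k 1 \<in> A'" "scal D k 1 \<in> A" using GD by auto
      have "scal D k 1 * a \<in> A'" using a k GD by blast
      moreover have "\<phi>' (scal D k 1 * a) = \<phi> (scal D k 1 * b)"
        using scale(1) a k hom(2) \<phi>D(3) scal by simp
      ultimately show ?case by (auto simp: mult_scale)
    qed
    then show "\<phi> ` A \<subseteq> \<phi>' ` A'" by (metis image_subsetI image_eqI)
  qed
  ultimately show ?thesis using scal gens by blast
qed

text \<open>Here \<open>\<phi>\<close> is extended to fractions by \<phi>'(a) = \<phi>(a X^n) z^-n
  for any \<open>n\<close> with a X^n in \<open>A\<close>. The choice of \<open>n\<close> is
  immaterial because two exponents can be compared at their sum.\<close>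

lemma quot_map_step_notin:
  assumes \<phi>: "quot_map A P \<phi> f" and X: "X \<notin> P"
    and fstep: "\<And>C. f' C = (THE v. \<exists>a\<in>C. \<exists>b\<in>carrier (alg D (j + 1)). \<exists>n. a = b * inverse X ^ n \<and>
      v = f (P +>\<^bsub>alg D (j + 1)\<^esub> b) * inverse (f (P +>\<^bsub>alg D (j + 1)\<^esub> X)) ^ n)"
  shows "\<exists>\<phi>'. quot_map A' (psi_step D j P) \<phi>' f' \<and> (\<forall>k. \<phi>' (scal D k 1) = \<phi> (scal D k 1)) \<and>
    (\<forall>i\<in>{j..num D}. \<phi>' (gen D j i) = \<phi> (gen D (Suc j) i)) \<and>
    power_cofinal (\<phi> X) (\<phi> ` A) (\<phi>' ` A') \<and> power_cofinal (\<phi> X) (\<phi>' ` A') (\<phi> ` A)"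
proof -
  note \<phi>D = quot_mapD[OF \<phi> ring_closed_G]
  define z where "z = \<phi> X"
  have z: "z \<noteq> 0" using \<phi>D(8) X X_in by (auto simp: z_def)
  have X0: "X ^ n * inverse X ^ n = 1" "inverse X ^ n * X ^ n = 1" for n by (rule conj_prod)+
  have z0: "z ^ n * inverse z ^ n = 1" "inverse z ^ n * z ^ n = 1" for n
    using z by (simp_all add: power_inverse)
  have XA: "X ^ n \<in> A" "X ^ n \<in> A'" for n using X_in GD by auto
  have \<phi>X: "\<phi> (X ^ n) = z ^ n" for n using \<phi>D(7) X_in by (simp add: z_def)
  have up: "a * X ^ (n + m) \<in> A \<and> \<phi> (a * X ^ (n + m)) = \<phi> (a * X ^ n) * z ^ m" if "a * X ^ n \<in> A" for a n m
    using GD(4)[OF that XA(1)[of m]] \<phi>D(3)[OF that XA(1)[of m]] by (simp add: power_add mult.assoc \<phi>X)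
  have ex: "\<exists>n. a * X ^ n \<in> A" if "a \<in> A'" for a
    using old_from_new[OF j(2) order_refl that] by blast
  define \<phi>' where "\<phi>' a = (let n = SOME n. a * X ^ n \<in> A in \<phi> (a * X ^ n) * inverse z ^ n)" for a
  have \<phi>'_eq: "\<phi>' a = \<phi> (a * X ^ n) * inverse z ^ n" if n: "a * X ^ n \<in> A" for a n
  proof -
    define m where "m = (SOME n. a * X ^ n \<in> A)"
    have m: "a * X ^ m \<in> A" unfolding m_def using n by (rule someI)
    have "\<phi> (a * X ^ m) * z ^ n = \<phi> (a * X ^ n) * z ^ m"
      using up[OF m, of n] up[OF n, of m] by (simp add: add.commute)
    then have "\<phi> (a * X ^ m) * z ^ n * inverse z ^ n * inverse z ^ m = \<phi> (a * X ^ n) * z ^ m * inverse z ^ n * inverse z ^ m"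
      by simp
    also have "\<phi> (a * X ^ n) * z ^ m * inverse z ^ n * inverse z ^ m = \<phi> (a * X ^ n) * (z ^ m * inverse z ^ m) * inverse z ^ n"
      by (simp only: mult.assoc) (metis power_add add.commute)
    finally have "\<phi> (a * X ^ m) * inverse z ^ m = \<phi> (a * X ^ n) * inverse z ^ n"
      by (simp add: z0 mult.assoc[of _ "z ^ n"])
    then show ?thesis by (simp add: \<phi>'_def m_def[symmetric])
  qed
  have \<phi>'_A: "\<phi>' a = \<phi> a" if "a \<in> A" for a using \<phi>'_eq[of a 0] that by simp
  have hom_add: "\<phi>' (a + a') = \<phi>' a + \<phi>' a'" if a: "a \<in> A'" "a' \<in> A'" for a a'
  proof -
    obtain n m where "a * X ^ n \<in> A" "a' * X ^ m \<in> A" using ex a by blast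
    then have *: "a * X ^ (n + m) \<in> A" "a' * X ^ (n + m) \<in> A"
      using up[of a n m] up[of a' m n] by (simp_all add: add.commute)
    then have "(a + a') * X ^ (n + m) \<in> A" using GD by (simp add: distrib_right)
    then show ?thesis using * by (simp add: \<phi>'_eq \<phi>D(2) distrib_right)
  qed
  have hom_mult: "\<phi>' (a * a') = \<phi>' a * \<phi>' a'" if a: "a \<in> A'" "a' \<in> A'" for a a'
  proof -
    obtain n m where n: "a * X ^ n \<in> A" and m: "a' * X ^ m \<in> A" using ex a by blast
    \<comment> \<open>Past X^n the factor a' becomes its conjugate, which lies in the new algebra
      but perhaps not in \<open>A\<close>; a further power X^l brings it there. The summand
      \<open>m\<close> in \<open>b\<close> allows a comparison with \<phi>(a' X^m).\<close>
    obtain l where l: "inverse X ^ n * a' * X ^ n * X ^ l \<in> A" using ex[OF G_conj_inverse[OF a(2) order_refl]] by blast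
    define b where "b = inverse X ^ n * a' * X ^ (n + (l + m))"
    have b: "b \<in> A" using up[OF l, of m] by (simp add: b_def power_add mult.assoc)
    have Xb: "X ^ n * b = a' * X ^ (n + (l + m))"
      by (simp add: b_def mult.assoc[symmetric] X0)
    have "a * a' * X ^ (n + (l + m)) = a * X ^ n * b" by (simp add: mult.assoc Xb)
    moreover have "a * X ^ n * b \<in> A" using n b GD by blast
    ultimately have "\<phi>' (a * a') = \<phi> (a * X ^ n) * \<phi> b * inverse z ^ (n + (l + m))"
      using \<phi>'_eq[of "a * a'" "n + (l + m)"] \<phi>D(3)[OF n b] by simp
    also have "\<phi> b = inverse z ^ n * (\<phi> (a' * X ^ m) * z ^ (n + l))"
    proof -
      have "z ^ n * \<phi> b = \<phi> (X ^ n * b)" using \<phi>D(3)[OF XA(1) b] \<phi>X by simp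
      also have "X ^ n * b = a' * X ^ (m + (n + l))" unfolding Xb by (simp add: add_ac)
      also have "\<phi> \<dots> = \<phi> (a' * X ^ m) * z ^ (n + l)" using up[OF m] by blast
      finally have "inverse z ^ n * (z ^ n * \<phi> b) = inverse z ^ n * (\<phi> (a' * X ^ m) * z ^ (n + l))" by simp
      then show ?thesis by (simp add: mult.assoc[symmetric] z0)
    qed
    also have "\<phi> (a * X ^ n) * (inverse z ^ n * (\<phi> (a' * X ^ m) * z ^ (n + l))) * inverse z ^ (n + (l + m))
        = \<phi> (a * X ^ n) * inverse z ^ n * \<phi> (a' * X ^ m) * (z ^ (n + l) * inverse z ^ (n + l)) * inverse z ^ m"
      by (simp only: mult.assoc power_add)
    also have "\<dots> = \<phi>' a * \<phi>' a'" using \<phi>'_eq[OF n] \<phi>'_eq[OF m] by (simp add: z0 mult.assoc)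
    finally show ?thesis .
  qed
  have \<phi>'X: "\<phi>' (X ^ n) = z ^ n" for n using \<phi>'_A[OF XA(1)] \<phi>X by simp
  have ker: "psi_step D j P = {a \<in> A'. \<phi>' a = 0}"
  proof -
    have "(\<exists>p n. a = p * inverse X ^ n \<and> p \<in> P) \<longleftrightarrow> \<phi>' a = 0" if a: "a \<in> A'" for a
    proof
      assume "\<exists>p n. a = p * inverse X ^ n \<and> p \<in> P"
      then obtain p n where p: "a = p * inverse X ^ n" "p \<in> P" by blast
      then have "a * X ^ n = p" by (simp add: mult.assoc X0)
      then show "\<phi>' a = 0" using \<phi>'_eq[of a n] p \<phi>D(8) by simp
    next
      assume 0: "\<phi>' a = 0"
      obtain n where n: "a * X ^ n \<in> A" using ex a by blast
      then have "a * X ^ n \<in> P" using 0 \<phi>'_eq[OF n] \<phi>D(8) z by simp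
      moreover have "a = a * X ^ n * inverse X ^ n" by (simp add: mult.assoc X0)
      ultimately show "\<exists>p n. a = p * inverse X ^ n \<and> p \<in> P" by blast
    qed
    then show ?thesis using X unfolding psi_step_def Let_def by (auto simp: alg_eq Suc_eq_plus1)
  qed
  have "quot_map A' (psi_step D j P) \<phi>' f'"
  proof (rule quot_mapI[OF ring_closed_G _ hom_add hom_mult ker fstep])
    show "\<phi>' 1 = 1" using \<phi>'_A[of 1] GD \<phi>D(1) by simp
    fix a v assume a: "a \<in> A'"
    obtain n where n: "a * X ^ n \<in> A" using ex a by blast
    have *: "f (P +>\<^bsub>alg D (j + 1)\<^esub> b) * inverse (f (P +>\<^bsub>alg D (j + 1)\<^esub> X)) ^ n = \<phi>' a"
      if "b \<in> A" "a = b * inverse X ^ n" for b n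
    proof -
      have "a * X ^ n = b" using that(2) by (simp add: mult.assoc X0)
      then show ?thesis using \<phi>'_eq[of a n] that(1) \<phi>D(9) X_in by (simp add: alg_Suc z_def)
    qed
    moreover have "a = a * X ^ n * inverse X ^ n" by (simp add: mult.assoc X0)
    ultimately show "(\<exists>b\<in>carrier (alg D (j + 1)). \<exists>n. a = b * inverse X ^ n \<and>
        v = f (P +>\<^bsub>alg D (j + 1)\<^esub> b) * inverse (f (P +>\<^bsub>alg D (j + 1)\<^esub> X)) ^ n) \<longleftrightarrow> v = \<phi>' a"
      unfolding alg_Suc carrier_ring_of using n by metis
  qed
  moreover have "\<phi>' (scal D k 1) = \<phi> (scal D k 1)" for k
    by (rule \<phi>'_A) (auto intro: GD)
  moreover have "\<phi>' (gen D j i) = \<phi> (gen D (Suc j) i)" if "i \<in> {j..num D}" for i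
    using \<phi>'_A[of "gen D (Suc j) i"] gen_ge[of i] gen_in_G[of i "num D" "Suc j"] that j by auto
  moreover have "power_cofinal z (\<phi> ` A) (\<phi>' ` A')"
    unfolding power_cofinal_def
  proof (intro ballI conjI)
    fix r assume "r \<in> \<phi> ` A"
    then obtain b where b: "b \<in> A" "r = \<phi> b" by blast
    obtain n where n: "b * X ^ n \<in> A'" using new_from_old[OF j(2) order_refl b(1)] by blast
    have "r * z ^ n = \<phi>' (b * X ^ n)"
      using \<phi>'_A[OF GD(4)[OF b(1) XA(1)]] \<phi>D(3)[OF b(1) XA(1)] \<phi>X b by simp
    then show "\<exists>n. r * z ^ n \<in> \<phi>' ` A'" using n by blast
    obtain n where n: "X ^ n * b \<in> A'" using new_from_old'[OF j(2) order_refl b(1)] by blast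
    have "z ^ n * r = \<phi>' (X ^ n * b)"
      using \<phi>'_A[OF GD(4)[OF XA(1) b(1)]] \<phi>D(3)[OF XA(1) b(1)] \<phi>X b by simp
    then show "\<exists>n. z ^ n * r \<in> \<phi>' ` A'" using n by blast
  qed
  moreover have "power_cofinal z (\<phi>' ` A') (\<phi> ` A)"
    unfolding power_cofinal_def
  proof (intro ballI conjI)
    fix r assume "r \<in> \<phi>' ` A'"
    then obtain a where a: "a \<in> A'" "r = \<phi>' a" by blast
    obtain n where n: "a * X ^ n \<in> A" using ex a by blast
    have "r * z ^ n = \<phi> (a * X ^ n)" using \<phi>'_eq[OF n] a by (simp add: mult.assoc z0)
    then show "\<exists>n. r * z ^ n \<in> \<phi> ` A" using n by blast
    obtain n where n: "X ^ n * a \<in> A" using old_from_new[OF j(2) order_refl a(1)] by blast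
    have "z ^ n * r = \<phi> (X ^ n * a)" using hom_mult[OF XA(2) a(1)] \<phi>'X \<phi>'_A[OF n] a by simp
    then show "\<exists>n. z ^ n * r \<in> \<phi> ` A" using n by blast
  qed
  ultimately show ?thesis unfolding z_def by blast
qed

end

context quantum_nilpotent
begin

lemma prime_at_last: "prime_at D P (Suc (num D)) = P"
  by (simp add: prime_at_def)

lemma prime_at_step: "j \<le> num D \<Longrightarrow> prime_at D P j = psi_step D j (prime_at D P (Suc j))"
  using rev_upt_Suc[of j "num D"] by (simp add: prime_at_def del: upt_Suc)

definition ident_at :: "'f set \<Rightarrow> ('f set \<Rightarrow> 'g::division_ring) \<Rightarrow> nat \<Rightarrow> 'f set \<Rightarrow> 'g"
  where "ident_at P f j = fold (ident_step D P) (rev [j..<num D + 1]) f"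

lemma ident_at_last: "ident_at P f (Suc (num D)) = f"
  by (simp add: ident_at_def)

lemma ident_at_step: "j \<le> num D \<Longrightarrow> ident_at P f j = ident_step D P j (ident_at P f (Suc j))"
  using rev_upt_Suc[of j "num D"] by (simp add: ident_at_def del: upt_Suc)

text \<open>The case \<open>z = 1\<close> stands for \<open>x\<^sub>j \<in> P\<^bsub>j+1\<^esub>\<close>, when the two images are equal.\<close>

lemma quot_map_step:
  assumes j: "2 \<le> j" "j \<le> num D"
    and \<phi>: "quot_map (G (Suc j) (num D)) (prime_at D P (Suc j)) \<phi> (ident_at P f (Suc j))"
  shows "\<exists>\<phi>' z. quot_map (G j (num D)) (prime_at D P j) \<phi>' (ident_at P f j) \<and>
    (\<forall>k. \<phi>' (scal D k 1) = \<phi> (scal D k 1)) \<and>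
    (\<forall>i\<in>{j..num D}. \<phi>' (gen D j i) = \<phi> (gen D (Suc j) i)) \<and>
    (z = 1 \<or> z = \<phi>' (gen D j j) \<and> z \<noteq> 0) \<and>
    power_cofinal z (\<phi> ` G (Suc j) (num D)) (\<phi>' ` G j (num D)) \<and>
    power_cofinal z (\<phi>' ` G j (num D)) (\<phi> ` G (Suc j) (num D))"
proof -
  obtain h where "stage (Suc j) h" using stage_ex[of "Suc j"] j by auto
  then interpret deletion_step D j h using j by unfold_locales auto
  note \<phi>D = quot_mapD[OF \<phi> ring_closed_G]
  let ?P = "prime_at D P (Suc j)"
  note step = prime_at_step[OF j(2), of P] ident_at_step[OF j(2), of P f]
  show ?thesis
  proof (cases "X \<in> ?P")
    case True
    have "ident_step D P j (ident_at P f (Suc j)) C =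
        (THE v. \<exists>a\<in>C. \<exists>b\<in>g_map D j a. v = ident_at P f (Suc j) (?P +>\<^bsub>alg D (j + 1)\<^esub> b))" for C
      using True by (simp add: ident_step_def Let_def Suc_eq_plus1)
    from quot_map_step_mem[OF \<phi> True this] obtain \<phi>' where
      *: "quot_map A' (psi_step D j ?P) \<phi>' (ident_step D P j (ident_at P f (Suc j)))"
      "\<forall>k. \<phi>' (scal D k 1) = \<phi> (scal D k 1)" "\<forall>i\<in>{1..num D}. \<phi>' (gen D j i) = \<phi> (gen D (Suc j) i)" "\<phi>' ` A' = \<phi> ` A"
      by blast
    have "power_cofinal 1 (\<phi> ` A) (\<phi> ` A)" by (simp add: power_cofinal_def)
    then show ?thesis using * j unfolding step by (intro exI[of _ \<phi>'] exI[of _ 1]) auto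
  next
    case False
    have "ident_step D P j (ident_at P f (Suc j)) C =
        (THE v. \<exists>a\<in>C. \<exists>b\<in>carrier (alg D (j + 1)). \<exists>n. a = b * inverse X ^ n \<and>
      v = ident_at P f (Suc j) (?P +>\<^bsub>alg D (j + 1)\<^esub> b) * inverse (ident_at P f (Suc j) (?P +>\<^bsub>alg D (j + 1)\<^esub> X)) ^ n)" for C
      using False by (simp add: ident_step_def Let_def Suc_eq_plus1)
    from quot_map_step_notin[OF \<phi> False this] obtain \<phi>' where
      *: "quot_map A' (psi_step D j ?P) \<phi>' (ident_step D P j (ident_at P f (Suc j)))"
      "\<forall>k. \<phi>' (scal D k 1) = \<phi> (scal D k 1)" "\<forall>i\<in>{j..num D}. \<phi>' (gen D j i) = \<phi> (gen D (Suc j) i)"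
      "power_cofinal (\<phi> X) (\<phi> ` A) (\<phi>' ` A')" "power_cofinal (\<phi> X) (\<phi>' ` A') (\<phi> ` A)"
      by blast
    moreover have "\<phi> X \<noteq> 0" using False \<phi>D(8) X_in by blast
    moreover have "\<phi> X = \<phi>' (gen D j j)" using *(3) j by auto
    ultimately show ?thesis unfolding step by blast
  qed
qed

end

section \<open>Rings embedded in a division ring\<close>

locale embedded_ring =
  fixes B :: "('b, 'm) ring_scheme" (structure) and f :: "'b \<Rightarrow> 'g::division_ring"
  assumes ring: "ring B" and f_hom: "f \<in> ring_hom B (ring_of UNIV)" and f_inj: "inj_on f (carrier B)"
begin

lemma f_mult: "a \<in> carrier B \<Longrightarrow> b \<in> carrier B \<Longrightarrow> f (a \<otimes> b) = f a * f b"
  and f_add: "a \<in> carrier B \<Longrightarrow> b \<in> carrier B \<Longrightarrow> f (a \<oplus> b) = f a + f b"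
  and f_one: "f \<one> = 1"
  using f_hom by (auto simp: ring_hom_def)

lemma f_zero: "f \<zero> = 0"
proof -
  interpret ring B by (rule ring)
  show ?thesis using f_add[of "\<zero>" "\<zero>"] by simp
qed

lemma f_eq_iff: "a \<in> carrier B \<Longrightarrow> b \<in> carrier B \<Longrightarrow> f a = f b \<longleftrightarrow> a = b"
  using f_inj by (auto dest: inj_onD)

lemma f_eq_0_iff: "a \<in> carrier B \<Longrightarrow> f a = 0 \<longleftrightarrow> a = \<zero>"
proof -
  interpret ring B by (rule ring)
  assume "a \<in> carrier B" then show ?thesis using f_eq_iff[of a "\<zero>"] f_zero by simp
qed

lemma mult_closed: "a \<in> carrier B \<Longrightarrow> b \<in> carrier B \<Longrightarrow> a \<otimes> b \<in> carrier B"
  and one_closed: "\<one> \<in> carrier B"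
proof -
  interpret ring B by (rule ring)
  show "a \<in> carrier B \<Longrightarrow> b \<in> carrier B \<Longrightarrow> a \<otimes> b \<in> carrier B" "\<one> \<in> carrier B" by auto
qed

lemma f_uminus: "a \<in> carrier B \<Longrightarrow> f (\<ominus> a) = - f a"
proof -
  interpret ring B by (rule ring)
  assume a: "a \<in> carrier B"
  then have "f a + f (\<ominus> a) = 0" using f_add[of a "\<ominus> a"] by (simp add: r_neg f_zero)
  then show ?thesis by (simp add: eq_neg_iff_add_eq_0 add.commute)
qed

lemma regular_eltI: "a \<in> carrier B \<Longrightarrow> f a \<noteq> 0 \<Longrightarrow> regular_elt B a"
proof -
  interpret ring B by (rule ring)
  assume a: "a \<in> carrier B" "f a \<noteq> 0"
  have "b = \<zero>" if "b \<in> carrier B" "f a * f b = 0 \<or> f b * f a = 0" for b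
    using that a f_eq_0_iff[of b] by auto
  then show ?thesis using a unfolding regular_elt_def by (metis f_mult f_zero)
qed

lemma normal_eltI:
  assumes a: "a \<in> carrier B" "f a \<noteq> 0"
    and conj: "\<And>b. b \<in> carrier B \<Longrightarrow> f a * f b * inverse (f a) \<in> f ` carrier B"
    and conj_inverse: "\<And>b. b \<in> carrier B \<Longrightarrow> inverse (f a) * f b * f a \<in> f ` carrier B"
  shows "normal_elt B a"
proof -
  have 1: "\<exists>b'\<in>carrier B. a \<otimes> b = b' \<otimes> a" if b: "b \<in> carrier B" for b
  proof -
    obtain b' where b': "b' \<in> carrier B" "f a * f b * inverse (f a) = f b'" using conj[OF b] by blast
    then have "f (b' \<otimes> a) = f (a \<otimes> b)" using a b by (simp add: f_mult b'(2)[symmetric] mult.assoc)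
    then show ?thesis using f_eq_iff mult_closed a b b' by metis
  qed
  have 2: "\<exists>b'\<in>carrier B. b \<otimes> a = a \<otimes> b'" if b: "b \<in> carrier B" for b
  proof -
    obtain b' where b': "b' \<in> carrier B" "inverse (f a) * f b * f a = f b'" using conj_inverse[OF b] by blast
    then have "f (a \<otimes> b') = f (b \<otimes> a)" using a b by (simp add: f_mult b'(2)[symmetric] mult.assoc[symmetric])
    then show ?thesis using f_eq_iff mult_closed a b b' by metis
  qed
  have "{a \<otimes> r | r. r \<in> carrier B} = {r \<otimes> a | r. r \<in> carrier B}"
    using 1 2 by (intro subset_antisym subsetI; clarsimp; blast)
  then show ?thesis using a(1) by (simp add: normal_elt_def)
qed

lemma submonoid_vimage:
  assumes "1 \<in> U" "\<And>u v. u \<in> U \<Longrightarrow> v \<in> U \<Longrightarrow> u * v \<in> U"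
  shows "submonoid {b \<in> carrier B. f b \<in> U} B"
  by unfold_locales (use assms mult_closed one_closed f_mult f_one in auto)

text \<open>Inside a division ring, a t = s b means s^-1 a = b t^-1. The Ore conditions thus say
  that left fractions are right fractions and conversely.\<close>

lemma two_sided_OreI:
  assumes \<Gamma>: "\<Gamma> = {b \<in> carrier B. f b \<in> U}" "0 \<notin> U"
    and right: "\<And>r u. r \<in> f ` carrier B \<Longrightarrow> u \<in> U \<Longrightarrow> u \<in> f ` carrier B \<Longrightarrow>
      \<exists>r'\<in>f ` carrier B. \<exists>u'\<in>f ` carrier B \<inter> U. inverse u * r = r' * inverse u'"
    and left: "\<And>r u. r \<in> f ` carrier B \<Longrightarrow> u \<in> U \<Longrightarrow> u \<in> f ` carrier B \<Longrightarrow>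
      \<exists>r'\<in>f ` carrier B. \<exists>u'\<in>f ` carrier B \<inter> U. r * inverse u = inverse u' * r'"
  shows "two_sided_Ore B \<Gamma>"
  unfolding two_sided_Ore_def
proof (intro ballI conjI)
  fix a s assume a: "a \<in> carrier B" and s: "s \<in> \<Gamma>"
  then have s': "s \<in> carrier B" "f s \<in> U" "f s \<noteq> 0" using \<Gamma> by auto
  obtain b t where b: "b \<in> carrier B" "t \<in> carrier B" "f t \<in> U" "inverse (f s) * f a = f b * inverse (f t)"
    using right[of "f a" "f s"] a s' by blast
  have t0: "f t \<noteq> 0" using b \<Gamma>(2) by auto
  have "f a * f t = f s * (inverse (f s) * f a) * f t" using s' by (simp add: mult.assoc[symmetric])
  also have "\<dots> = f s * (f b * inverse (f t)) * f t" by (simp only: b(4))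
  finally have "f a * f t = f s * f b" using t0 by (simp add: mult.assoc)
  then have "a \<otimes> t = s \<otimes> b" using a s' b mult_closed f_eq_iff[of "a \<otimes> t" "s \<otimes> b"] by (simp add: f_mult)
  then show "\<exists>b\<in>carrier B. \<exists>t\<in>\<Gamma>. a \<otimes> t = s \<otimes> b" using b \<Gamma> by blast
  obtain b t where b: "b \<in> carrier B" "t \<in> carrier B" "f t \<in> U" "f a * inverse (f s) = inverse (f t) * f b"
    using left[of "f a" "f s"] a s' by blast
  have t0: "f t \<noteq> 0" using b \<Gamma>(2) by auto
  have "f t * f a = f t * (f a * inverse (f s)) * f s" using s' by (simp add: mult.assoc)
  also have "\<dots> = f t * (inverse (f t) * f b) * f s" by (simp only: b(4))
  finally have "f t * f a = f b * f s" using t0 by (simp add: mult.assoc[symmetric])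
  then have "t \<otimes> a = b \<otimes> s" using a s' b mult_closed f_eq_iff[of "t \<otimes> a" "b \<otimes> s"] by (simp add: f_mult)
  then show "\<exists>b\<in>carrier B. \<exists>t\<in>\<Gamma>. t \<otimes> a = b \<otimes> s" using b \<Gamma> by blast
qed

end

lemma mult_generated_induct [consumes 3, case_names gen one mult]:
  assumes x: "x \<in> mult_generated R S" and R: "Group.monoid R" and "S \<subseteq> carrier R"
    and "\<And>x. x \<in> S \<Longrightarrow> P x" "P \<one>\<^bsub>R\<^esub>"
    "\<And>x y. x \<in> mult_generated R S \<Longrightarrow> y \<in> mult_generated R S \<Longrightarrow>
      x \<in> carrier R \<Longrightarrow> y \<in> carrier R \<Longrightarrow> P x \<Longrightarrow> P y \<Longrightarrow> P (x \<otimes>\<^bsub>R\<^esub> y)"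
  shows "P x"
proof -
  interpret Group.monoid R by (rule R)
  have closed: "\<one>\<^bsub>R\<^esub> \<in> mult_generated R S"
    "\<And>x y. x \<in> mult_generated R S \<Longrightarrow> y \<in> mult_generated R S \<Longrightarrow> x \<otimes>\<^bsub>R\<^esub> y \<in> mult_generated R S"
    "S \<subseteq> mult_generated R S"
    by (auto simp: mult_generated_def hull_def submonoid_def)
  have "submonoid {x \<in> mult_generated R S. x \<in> carrier R \<and> P x} R"
    by unfold_locales (use closed assms in auto)
  then have "mult_generated R S \<subseteq> {x \<in> mult_generated R S. x \<in> carrier R \<and> P x}"
    unfolding mult_generated_def[of R S] using assms closed
    by (intro hull_minimal) (auto simp: mult_generated_def[symmetric])
  then show ?thesis using x by blast
qed

lemma submonoid_mult_generated:
  assumes R: "Group.monoid R" and S: "S \<subseteq> carrier R"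
  shows "submonoid (mult_generated R S) R" "S \<subseteq> mult_generated R S"
proof -
  interpret Group.monoid R by (rule R)
  have "submonoid (carrier R) R" by unfold_locales auto
  then have "mult_generated R S \<subseteq> carrier R"
    unfolding mult_generated_def using S by (intro hull_minimal)
  then show "submonoid (mult_generated R S) R"
    by unfold_locales (auto simp: mult_generated_def hull_def submonoid_def)
  show "S \<subseteq> mult_generated R S" unfolding mult_generated_def by (rule hull_subset)
qed

lemma ring_Quot:
  assumes "ring_closed R" "ring_ideal R P"
  shows "ring (ring_of R Quot P)" "carrier (ring_of R Quot P) = (\<lambda>a. P +>\<^bsub>ring_of R\<^esub> a) ` R"
    "(\<lambda>a. P +>\<^bsub>ring_of R\<^esub> a) \<in> ring_hom (ring_of R) (ring_of R Quot P)"
proof -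
  note I = ring_ideal_ideal[OF assms]
  show "ring (ring_of R Quot P)" using I by (rule ideal.quotient_is_ring)
  show "carrier (ring_of R Quot P) = (\<lambda>a. P +>\<^bsub>ring_of R\<^esub> a) ` R"
    by (auto simp: FactRing_def A_RCOSETS_def')
  show "(\<lambda>a. P +>\<^bsub>ring_of R\<^esub> a) \<in> ring_hom (ring_of R) (ring_of R Quot P)"
    using I by (rule ideal.rcos_ring_hom)
qed

lemma quot_map_embedded:
  assumes \<phi>: "quot_map R P \<phi> f" and R: "ring_closed R"
  shows "embedded_ring (ring_of R Quot P) f" "f ` carrier (ring_of R Quot P) = \<phi> ` R"
proof -
  note \<phi>D = quot_mapD[OF assms] and Q = ring_Quot[OF R quot_mapD(10)[OF assms]]
  have R': "1 \<in> R" "\<And>a b. a \<in> R \<Longrightarrow> b \<in> R \<Longrightarrow> a + b \<in> R" "\<And>a b. a \<in> R \<Longrightarrow> b \<in> R \<Longrightarrow> a * b \<in> R"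
    "\<And>a b. a \<in> R \<Longrightarrow> b \<in> R \<Longrightarrow> a - b \<in> R"
    using R by (auto simp: ring_closed_def diff_conv_add_uminus simp del: add_uminus_conv_diff)
  show "f ` carrier (ring_of R Quot P) = \<phi> ` R"
    unfolding Q(2) image_image by (intro image_cong) (auto simp: \<phi>D(9))
  have hom: "P +>\<^bsub>ring_of R\<^esub> (a * b) = (P +>\<^bsub>ring_of R\<^esub> a) \<otimes>\<^bsub>ring_of R Quot P\<^esub> (P +>\<^bsub>ring_of R\<^esub> b)"
    "P +>\<^bsub>ring_of R\<^esub> (a + b) = (P +>\<^bsub>ring_of R\<^esub> a) \<oplus>\<^bsub>ring_of R Quot P\<^esub> (P +>\<^bsub>ring_of R\<^esub> b)"
    "P +>\<^bsub>ring_of R\<^esub> 1 = \<one>\<^bsub>ring_of R Quot P\<^esub>" if "a \<in> R" "b \<in> R" for a b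
    using Q(3) that by (auto simp: ring_hom_def)
  have "f \<in> ring_hom (ring_of R Quot P) (ring_of UNIV)"
  proof (rule ring_hom_memI)
    fix C C' assume "C \<in> carrier (ring_of R Quot P)" "C' \<in> carrier (ring_of R Quot P)"
    then obtain a b where ab: "a \<in> R" "b \<in> R" "C = P +>\<^bsub>ring_of R\<^esub> a" "C' = P +>\<^bsub>ring_of R\<^esub> b"
      unfolding Q(2) by blast
    show "f (C \<otimes>\<^bsub>ring_of R Quot P\<^esub> C') = f C \<otimes>\<^bsub>ring_of UNIV\<^esub> f C'"
      unfolding ab(3,4) hom(1)[OF ab(1,2), symmetric] using ab R' by (simp add: \<phi>D)
    show "f (C \<oplus>\<^bsub>ring_of R Quot P\<^esub> C') = f C \<oplus>\<^bsub>ring_of UNIV\<^esub> f C'"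
      unfolding ab(3,4) hom(2)[OF ab(1,2), symmetric] using ab R' by (simp add: \<phi>D)
  next
    show "f \<one>\<^bsub>ring_of R Quot P\<^esub> = \<one>\<^bsub>ring_of UNIV\<^esub>"
      unfolding hom(3)[OF R'(1) R'(1), symmetric] using R' by (simp add: \<phi>D)
  qed simp
  moreover have "inj_on f (carrier (ring_of R Quot P))"
  proof (rule inj_onI)
    fix C C' assume "C \<in> carrier (ring_of R Quot P)" "C' \<in> carrier (ring_of R Quot P)" "f C = f C'"
    then obtain a b where ab: "a \<in> R" "b \<in> R" "C = P +>\<^bsub>ring_of R\<^esub> a" "C' = P +>\<^bsub>ring_of R\<^esub> b" "\<phi> a = \<phi> b"
      unfolding Q(2) using \<phi>D(9) by auto
    then have "a - b \<in> P" using R' by (simp add: \<phi>D)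
    then show "C = C'" using ab coset_eq_iff[OF \<phi>D(10)] by simp
  qed
  ultimately show "embedded_ring (ring_of R Quot P) f"
    using Q(1) by (intro embedded_ring.intro)
qed

lemma quot_map_intro:
  assumes R: "ring_closed R" and P: "ideal P (ring_of R)"
    and f: "f \<in> ring_hom (ring_of R Quot P) (ring_of UNIV)" "inj_on f (carrier (ring_of R Quot P))"
  shows "quot_map R P (\<lambda>a. f (P +>\<^bsub>ring_of R\<^esub> a)) f"
proof -
  note I = ideal_ring_ideal[OF R P]
  note Q = ring_Quot[OF R I]
  have hom: "(\<lambda>a. f (P +>\<^bsub>ring_of R\<^esub> a)) \<in> ring_hom (ring_of R) (ring_of UNIV)"
    using ring_hom_trans[OF Q(3) f(1)] by (simp add: o_def)
  have R0: "0 \<in> R" using R by (simp add: ring_closed_def)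
  have "f (P +>\<^bsub>ring_of R\<^esub> 0) + f (P +>\<^bsub>ring_of R\<^esub> 0) = f (P +>\<^bsub>ring_of R\<^esub> 0)"
    using ring_hom_add[OF hom, of 0 0] R0 by simp
  then have f0: "f (P +>\<^bsub>ring_of R\<^esub> 0) = 0" by simp
  have "a \<in> P \<longleftrightarrow> f (P +>\<^bsub>ring_of R\<^esub> a) = 0" if "a \<in> R" for a
  proof -
    have "f (P +>\<^bsub>ring_of R\<^esub> a) = f (P +>\<^bsub>ring_of R\<^esub> 0) \<longleftrightarrow> P +>\<^bsub>ring_of R\<^esub> a = P +>\<^bsub>ring_of R\<^esub> 0"
      using inj_on_eq_iff[OF f(2)] that R0 Q(2) by auto
    then show ?thesis using coset_eq_iff[OF I, of a 0] f0 by simp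
  qed
  then show ?thesis using hom ring_idealD(1)[OF I] by (auto simp: quot_map_def ring_hom_def)
qed

section \<open>The standard identity\<close>

inductive_set central_span :: "'g::division_ring set \<Rightarrow> 'g set" for E where
  zero: "0 \<in> central_span E"
| step: "z \<in> centre UNIV \<Longrightarrow> e \<in> E \<Longrightarrow> v \<in> central_span E \<Longrightarrow> z * e + v \<in> central_span E"

text \<open>The standard polynomial of degree \<open>n\<close>, with permutations written as words,
  the form in which \<open>PI_ring\<close> presents monomials.\<close>

definition std_poly :: "nat \<Rightarrow> (nat \<Rightarrow> 'g::division_ring) \<Rightarrow> 'g"
  where "std_poly n r = (\<Sum>\<pi> | \<pi> permutes {..<n}. of_int (sign \<pi>) * prod_list (map r (map \<pi> [0..<n])))"

text \<open>Composition with the transposition of \<open>a\<close> and \<open>b\<close> keeps each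
  monomial and matches even permutations with odd ones.\<close>

lemma std_poly_eq_args:
  assumes ab: "a < n" "b < n" "a \<noteq> b" "r a = r b"
  shows "std_poly n r = 0"
proof -
  define w where "w \<pi> = prod_list (map r (map \<pi> [0..<n]))" for \<pi> :: "nat \<Rightarrow> nat"
  let ?\<tau> = "transpose a b"
  let ?S = "{\<pi>. \<pi> permutes {..<n}}"
  have \<tau>: "?\<tau> permutes {..<n}" using ab by (intro permutes_swap_id) auto
  have perm: "permutation \<pi>" if "\<pi> \<in> ?S" for \<pi>
    using that permutation_permutes by blast
  have w: "w (?\<tau> \<circ> \<pi>) = w \<pi>" for \<pi>
  proof -
    have "r (?\<tau> k) = r k" for k using ab by (auto simp: transpose_def)
    then show ?thesis by (simp add: w_def o_def)
  qed
  have ev: "evenperm (?\<tau> \<circ> \<pi>) \<longleftrightarrow> \<not> evenperm \<pi>" if "\<pi> \<in> ?S" for \<pi>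
    using perm[OF that] ab by (simp add: evenperm_comp permutation_swap_id evenperm_swap)
  have fin: "finite ?S" by (simp add: finite_permutations)
  have "std_poly n r = (\<Sum>\<pi>\<in>?S. of_int (sign \<pi>) * w \<pi>)" by (simp add: std_poly_def w_def)
  also have "\<dots> = (\<Sum>\<pi>\<in>?S. if evenperm \<pi> then w \<pi> else - w \<pi>)"
    by (intro sum.cong) (auto simp: sign_def)
  also have "\<dots> = (\<Sum>\<pi>\<in>{\<pi> \<in> ?S. evenperm \<pi>}. w \<pi>) + (\<Sum>\<pi>\<in>{\<pi> \<in> ?S. \<not> evenperm \<pi>}. - w \<pi>)"
    by (simp add: sum.If_cases fin Int_def Compl_eq)
  also have "(\<Sum>\<pi>\<in>{\<pi> \<in> ?S. \<not> evenperm \<pi>}. - w \<pi>) = (\<Sum>\<pi>\<in>{\<pi> \<in> ?S. evenperm \<pi>}. - w \<pi>)"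
  proof (rule sum.reindex_bij_witness[of _ "(\<circ>) ?\<tau>" "(\<circ>) ?\<tau>"])
    fix \<pi> :: "nat \<Rightarrow> nat"
    have "?\<tau> \<circ> (?\<tau> \<circ> \<pi>) = \<pi>" by (simp add: o_assoc)
    then show "?\<tau> \<circ> (?\<tau> \<circ> \<pi>) = \<pi>" "?\<tau> \<circ> (?\<tau> \<circ> \<pi>) = \<pi>" by auto
    show "?\<tau> \<circ> \<pi> \<in> {\<pi> \<in> ?S. evenperm \<pi>}" if "\<pi> \<in> {\<pi> \<in> ?S. \<not> evenperm \<pi>}"
      using that ev permutes_compose[OF _ \<tau>] by auto
    show "?\<tau> \<circ> \<pi> \<in> {\<pi> \<in> ?S. \<not> evenperm \<pi>}" if "\<pi> \<in> {\<pi> \<in> ?S. evenperm \<pi>}"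
      using that ev permutes_compose[OF _ \<tau>] by auto
    show "- w (?\<tau> \<circ> \<pi>) = - w \<pi>" using w by simp
  qed
  finally show ?thesis by (simp add: sum_negf)
qed

lemma prod_list_slot:
  assumes "distinct u" "k \<in> set u" "z \<in> centre UNIV"
  shows "prod_list (map (r(k := z * a + b)) u) = z * prod_list (map (r(k := a)) u) + prod_list (map (r(k := b)) u)"
  using assms(1,2)
proof (induction u)
  case (Cons i u)
  have z: "z * d = d * z" for d using assms(3) by (simp add: centre_iff)
  show ?case
  proof (cases "i = k")
    case True
    then have *: "map (r(k := v)) u = map r u" for v using Cons.prems by auto
    show ?thesis
      unfolding True list.map prod_list.Cons * fun_upd_same by (simp add: distrib_right mult.assoc)
  next
    case False
    have zr: "r i * (z * d) = z * (r i * d)" for d by (metis z mult.assoc)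
    show ?thesis using Cons False by (simp add: distrib_left zr)
  qed
qed simp

text \<open>Linearity over the centre in each argument: the entries of a permutation are distinct,
  so the slot \<open>k\<close> occurs exactly once in every monomial.\<close>

lemma std_poly_slot:
  assumes "k < n" "z \<in> centre UNIV"
  shows "std_poly n (r(k := z * a + b)) = z * std_poly n (r(k := a)) + std_poly n (r(k := b))"
proof -
  have z: "of_int i * (z * d) = z * (of_int i * d)" for i :: int and d :: 'a
    using assms(2) by (metis centre_iff mult.assoc)
  have "prod_list (map (r(k := z * a + b)) (map \<pi> [0..<n])) =
      z * prod_list (map (r(k := a)) (map \<pi> [0..<n])) + prod_list (map (r(k := b)) (map \<pi> [0..<n]))"
    if "\<pi> permutes {..<n}" for \<pi>
  proof (rule prod_list_slot[OF _ _ assms(2)])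
    show "distinct (map \<pi> [0..<n])" using permutes_inj_on[OF that] by (simp add: distinct_map)
    show "k \<in> set (map \<pi> [0..<n])"
      using permutes_image[OF that] assms(1) by (simp add: atLeast0LessThan)
  qed
  then have "std_poly n (r(k := z * a + b)) =
    (\<Sum>\<pi> | \<pi> permutes {..<n}. z * (of_int (sign \<pi>) * prod_list (map (r(k := a)) (map \<pi> [0..<n]))) +
      of_int (sign \<pi>) * prod_list (map (r(k := b)) (map \<pi> [0..<n])))"
    unfolding std_poly_def by (intro sum.cong) (auto simp: distrib_left z simp del: map_map)
  then show ?thesis by (simp add: std_poly_def sum.distrib sum_distrib_left del: map_map)
qed

text \<open>An alternating multilinear map vanishes on more arguments than there are spanning
  elements.\<close>

lemma std_poly_vanishes:
  assumes E: "finite E" "card E < n" and r: "\<And>k. k < n \<Longrightarrow> r k \<in> central_span E"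
  shows "std_poly n r = 0"
proof -
  \<comment> \<open>The first \<open>m\<close> arguments are still arbitrary in the span, the others
    already belong to \<open>E\<close>. At m = 0 the pigeonhole principle gives a
    repetition.\<close>
  have "std_poly n r = 0"
    if "m \<le> n" "\<And>k. k < m \<Longrightarrow> r k \<in> central_span E" "\<And>k. m \<le> k \<Longrightarrow> k < n \<Longrightarrow> r k \<in> E" for m r
    using that
  proof (induction m arbitrary: r)
    case 0
    then have "r ` {..<n} \<subseteq> E" by auto
    then have "\<not> inj_on r {..<n}" using card_inj_on_le[of r "{..<n}" E] E by auto
    then obtain a b where "a < n" "b < n" "a \<noteq> b" "r a = r b" by (auto simp: inj_on_def)
    then show ?case by (rule std_poly_eq_args)
  next
    case (Suc m)
    have m: "m < n" using Suc.prems by simp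
    have "std_poly n (r(m := v)) = 0" if "v \<in> central_span E" for v
      using that
    proof (induction rule: central_span.induct)
      case zero
      have "(1::'a) \<in> centre UNIV" by (simp add: centre_iff)
      from std_poly_slot[OF m this, of r 0 0] show ?case by (simp add: fun_upd_def)
    next
      case (step z e v)
      have "std_poly n (r(m := e)) = 0" by (rule Suc.IH) (use Suc.prems step in auto)
      then show ?case using step std_poly_slot[OF m step(1)] by (simp add: fun_upd_def)
    qed
    from this[of "r m"] show ?case using Suc.prems by simp
  qed
  from this[of n] show ?thesis using r by simp
qed

context embedded_ring
begin

lemma f_finsum:
  "finite U \<Longrightarrow> (\<And>u. u \<in> U \<Longrightarrow> h u \<in> carrier B) \<Longrightarrow> f (\<Oplus>u\<in>U. h u) = (\<Sum>u\<in>U. f (h u))"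
proof -
  interpret ring B by (rule ring)
  show "finite U \<Longrightarrow> (\<And>u. u \<in> U \<Longrightarrow> h u \<in> carrier B) \<Longrightarrow> f (\<Oplus>u\<in>U. h u) = (\<Sum>u\<in>U. f (h u))"
    by (induction U rule: finite_induct) (auto simp: f_zero f_add Pi_iff)
qed

lemma f_add_pow: "a \<in> carrier B \<Longrightarrow> f ([k] \<cdot> a) = of_int k * f a \<and> [k] \<cdot> a \<in> carrier B" for k :: int
proof -
  interpret ring B by (rule ring)
  assume a: "a \<in> carrier B"
  have nat: "f ([n] \<cdot> a) = of_nat n * f a" for n :: nat
    by (induction n) (use a in \<open>auto simp: f_zero f_add algebra_simps\<close>)
  show ?thesis
    by (cases "k \<ge> 0") (use a nat in \<open>auto simp: add_pow_int_ge add_pow_int_lt f_uminus\<close>)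
qed

lemma f_foldr:
  assumes "range r \<subseteq> carrier B"
  shows "f (foldr (\<lambda>i a. r i \<otimes> a) u \<one>) = prod_list (map (\<lambda>i. f (r i)) u) \<and> foldr (\<lambda>i a. r i \<otimes> a) u \<one> \<in> carrier B"
  by (induction u) (use assms in \<open>auto simp: f_one f_mult one_closed image_subset_iff intro: mult_closed\<close>)

text \<open>The standard identity of degree one more than the size of \<open>E\<close> holds. The
  span is over the centre of the whole division ring, so neither \<open>E\<close> nor the
  coefficients have to come from \<open>B\<close>. The identity permutation has coefficient 1 and
  all monomials have equal length, so the polynomial is monic.\<close>

lemma PI_ringI:
  assumes E: "finite E" "f ` carrier B \<subseteq> central_span E"
  shows "PI_ring B"
proof -
  interpret ring B by (rule ring)
  define n where "n = Suc (card E)"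
  let ?S = "{\<pi>. \<pi> permutes {..<n}}"
  define wrd where "wrd \<pi> = map \<pi> [0..<n]" for \<pi> :: "nat \<Rightarrow> nat"
  \<comment> \<open>Summing over permutations avoids choosing, for a word, the permutation that it
    comes from.\<close>
  define p :: "nat list \<Rightarrow> int" where "p u = (\<Sum>\<pi>\<in>?S. if wrd \<pi> = u then sign \<pi> else 0)" for u
  have fin: "finite ?S" by (simp add: finite_permutations)
  have inj: "inj_on wrd ?S"
  proof (rule inj_onI)
    fix \<pi> \<rho> assume *: "\<pi> \<in> ?S" "\<rho> \<in> ?S" "wrd \<pi> = wrd \<rho>"
    show "\<pi> = \<rho>"
    proof
      fix k show "\<pi> k = \<rho> k"
        using * by (cases "k < n") (auto simp: wrd_def permutes_def)
    qed
  qed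
  have p_wrd: "p (wrd \<pi>) = sign \<pi>" if "\<pi> \<in> ?S" for \<pi>
  proof -
    have "p (wrd \<pi>) = (\<Sum>\<rho>\<in>?S. if \<rho> = \<pi> then sign \<rho> else 0)"
      unfolding p_def by (intro sum.cong) (use inj_on_eq_iff[OF inj _ that] in auto)
    then show ?thesis using fin that by simp
  qed
  have supp: "{u. p u \<noteq> 0} = wrd ` ?S"
  proof
    show "{u. p u \<noteq> 0} \<subseteq> wrd ` ?S" unfolding p_def by (force elim: sum.not_neutral_contains_not_neutral split: if_splits)
    show "wrd ` ?S \<subseteq> {u. p u \<noteq> 0}" by (auto simp: p_wrd sign_def split: if_splits)
  qed
  show ?thesis
    unfolding PI_ring_def
  proof (intro exI[of _ p] conjI allI impI)
    show "finite {u. p u \<noteq> 0}" using fin supp by simp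
    show "\<exists>u. p u = 1 \<and> (\<forall>v. p v \<noteq> 0 \<longrightarrow> length v \<le> length u)"
    proof (intro exI[of _ "wrd id"] conjI allI impI)
      show "p (wrd id) = 1" using p_wrd[of id] by (simp add: permutes_id)
      fix v assume "p v \<noteq> 0"
      then have "v \<in> wrd ` ?S" using supp by blast
      then show "length v \<le> length (wrd id)" by (auto simp: wrd_def)
    qed
  next
    fix r :: "nat \<Rightarrow> 'b" assume r: "range r \<subseteq> carrier B"
    let ?h = "\<lambda>u. [p u] \<cdot> foldr (\<lambda>i a. r i \<otimes> a) u \<one>"
    have h: "f (?h u) = of_int (p u) * prod_list (map (\<lambda>i. f (r i)) u) \<and> ?h u \<in> carrier B" for u
      using f_foldr[OF r, of u] f_add_pow by metis
    have "f (\<Oplus>u\<in>{u. p u \<noteq> 0}. ?h u) = (\<Sum>u\<in>wrd ` ?S. of_int (p u) * prod_list (map (\<lambda>i. f (r i)) u))"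
      unfolding supp using h fin by (subst f_finsum) auto
    also have "\<dots> = (\<Sum>\<pi>\<in>?S. of_int (sign \<pi>) * prod_list (map (\<lambda>i. f (r i)) (wrd \<pi>)))"
      unfolding sum.reindex[OF inj] o_def by (intro sum.cong) (use p_wrd in auto)
    also have "\<dots> = std_poly n (\<lambda>i. f (r i))"
      unfolding std_poly_def wrd_def ..
    also have "\<dots> = 0"
      by (rule std_poly_vanishes[OF E(1)]) (use E(2) r in \<open>auto simp: n_def\<close>)
    finally have "f (\<Oplus>u\<in>{u. p u \<noteq> 0}. ?h u) = 0" .
    moreover have "(\<Oplus>u\<in>{u. p u \<noteq> 0}. ?h u) \<in> carrier B" by (rule finsum_closed) (use h in blast)
    ultimately show "(\<Oplus>u\<in>{u. p u \<noteq> 0}. ?h u) = \<zero>" by (simp only: f_eq_0_iff)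
  qed
qed

end

section \<open>Quantum tori at roots of unity\<close>

lemma central_span_base: "e \<in> E \<Longrightarrow> e \<in> central_span E"
  using central_span.step[OF centre_closed(2) _ central_span.zero] by fastforce

lemma central_span_add:
  "u \<in> central_span E \<Longrightarrow> v \<in> central_span E \<Longrightarrow> u + v \<in> central_span E"
  by (induction rule: central_span.induct) (auto simp: add.assoc intro: central_span.step)

lemma central_span_scale:
  assumes "z \<in> centre UNIV" "v \<in> central_span E"
  shows "z * v \<in> central_span E"
  using assms(2)
proof (induction rule: central_span.induct)
  case (step y e v)
  then have "(z * y) * e + z * v \<in> central_span E"
    using assms(1) by (intro central_span.step centre_closed)
  then show ?case by (simp add: distrib_left mult.assoc)
qed (simp add: central_span.zero)

lemma central_span_subset:
  assumes "E \<subseteq> central_span F"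
  shows "central_span E \<subseteq> central_span F"
proof
  fix v assume "v \<in> central_span E"
  then show "v \<in> central_span F"
    by (induction rule: central_span.induct)
      (use assms in \<open>auto intro: central_span.zero central_span_add central_span_scale\<close>)
qed

lemma central_span_mult:
  assumes "\<And>e e'. e \<in> E \<Longrightarrow> e' \<in> E' \<Longrightarrow> e * e' \<in> central_span F"
    and "u \<in> central_span E" "v \<in> central_span E'"
  shows "u * v \<in> central_span F"
proof -
  have *: "e * v \<in> central_span F" if "e \<in> E" for e
    using assms(3)
  proof (induction rule: central_span.induct)
    case (step z e' v)
    then show ?case
      using assms(1)[OF that] centre_left_commute[OF step(1)]
      by (simp add: distrib_left central_span_add central_span_scale)
  qed (simp add: central_span.zero)
  show ?thesis
    using assms(2)
    by (induction rule: central_span.induct)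
      (auto simp: distrib_right mult.assoc intro: central_span.zero central_span_add central_span_scale *)
qed

definition ordered_monomial :: "(nat \<Rightarrow> 'g::division_ring) \<Rightarrow> nat list \<Rightarrow> (nat \<Rightarrow> nat) \<Rightarrow> 'g"
  where "ordered_monomial \<tau> L e = prod_list (map (\<lambda>i. \<tau> i ^ e i) L)"

definition q_commuting :: "(nat \<Rightarrow> 'g::division_ring) \<Rightarrow> nat set \<Rightarrow> bool"
  where "q_commuting \<tau> W \<longleftrightarrow> (\<forall>i\<in>W. \<forall>l\<in>W. \<exists>z\<in>centre UNIV. \<tau> i * \<tau> l = z * (\<tau> l * \<tau> i))"

lemma ordered_monomial_commute:
  assumes q: "q_commuting \<tau> W" "set L \<subseteq> W" "a \<in> W"
  shows "\<exists>z\<in>centre UNIV. ordered_monomial \<tau> L e * \<tau> a = z * (\<tau> a * ordered_monomial \<tau> L e)"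
proof -
  have pow: "\<exists>z\<in>centre UNIV. \<tau> i ^ n * \<tau> a = z * (\<tau> a * \<tau> i ^ n)" if i: "i \<in> W" for i n
  proof -
    obtain y where "y \<in> centre UNIV" "\<tau> i * \<tau> a = y * (\<tau> a * \<tau> i)"
      using q(1,3) i by (auto simp: q_commuting_def)
    then show ?thesis using q_commute_power[of "\<tau> i" "\<tau> a" y n 1] centre_closed(4)[of y n] by auto
  qed
  show ?thesis
    using q(2)
  proof (induction L)
    case Nil show ?case by (intro bexI[of _ 1] centre_closed) (simp add: ordered_monomial_def)
  next
    case (Cons i L)
    then obtain z where z: "z \<in> centre UNIV" "ordered_monomial \<tau> L e * \<tau> a = z * (\<tau> a * ordered_monomial \<tau> L e)" by auto
    obtain y where y: "y \<in> centre UNIV" "\<tau> i ^ e i * \<tau> a = y * (\<tau> a * \<tau> i ^ e i)"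
      using pow[of i] Cons.prems by auto
    have "ordered_monomial \<tau> (i # L) e * \<tau> a = z * (\<tau> i ^ e i * \<tau> a * ordered_monomial \<tau> L e)"
      using centre_left_commute[OF z(1)] by (simp add: ordered_monomial_def mult.assoc z(2)[unfolded ordered_monomial_def])
    also have "\<dots> = (z * y) * (\<tau> a * ordered_monomial \<tau> (i # L) e)" by (simp add: y ordered_monomial_def mult.assoc)
    finally show ?case using y(1) z(1) centre_closed(3) by blast
  qed
qed

text \<open>Bringing \<tau>(a) from the right end to its place in the ordered product costs one
  central factor.\<close>

lemma ordered_monomial_mult_var:
  assumes "q_commuting \<tau> W" "set L \<subseteq> W" "distinct L" "a \<in> set L"
  shows "\<exists>z\<in>centre UNIV. ordered_monomial \<tau> L e * \<tau> a = z * ordered_monomial \<tau> L (e(a := Suc (e a)))"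
  using assms(2-)
proof (induction L)
  case (Cons i L)
  show ?case
  proof (cases "a = i")
    case True
    have "a \<in> W" using Cons.prems True by simp
    then obtain z where z: "z \<in> centre UNIV" "ordered_monomial \<tau> L e * \<tau> a = z * (\<tau> a * ordered_monomial \<tau> L e)"
      using ordered_monomial_commute[OF assms(1), of L a e] Cons.prems by auto
    have *: "ordered_monomial \<tau> L (e(a := Suc (e a))) = ordered_monomial \<tau> L e"
      unfolding ordered_monomial_def using Cons.prems True by (intro arg_cong[where f = prod_list] map_cong) auto
    have "ordered_monomial \<tau> (i # L) e * \<tau> a = \<tau> a ^ e a * (z * (\<tau> a * ordered_monomial \<tau> L e))"
      using z(2) True by (simp add: ordered_monomial_def mult.assoc)
    also have "\<dots> = z * (\<tau> a ^ e a * \<tau> a * ordered_monomial \<tau> L e)"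
      using centre_left_commute[OF z(1)] by (simp add: mult.assoc)
    also have "\<tau> a ^ e a * \<tau> a = \<tau> a ^ Suc (e a)" by (simp add: power_commutes)
    also have "\<tau> a ^ Suc (e a) * ordered_monomial \<tau> L e = ordered_monomial \<tau> (i # L) (e(a := Suc (e a)))"
      using True * by (simp add: ordered_monomial_def)
    finally show ?thesis using z(1) by blast
  next
    case False
    then have "set L \<subseteq> W" "distinct L" "a \<in> set L" using Cons.prems by auto
    then obtain z where z: "z \<in> centre UNIV" "ordered_monomial \<tau> L e * \<tau> a = z * ordered_monomial \<tau> L (e(a := Suc (e a)))"
      using Cons.IH by blast
    have "ordered_monomial \<tau> (i # L) e' = \<tau> i ^ e' i * ordered_monomial \<tau> L e'" for e' by (simp add: ordered_monomial_def)
    then have "ordered_monomial \<tau> (i # L) e * \<tau> a = z * ordered_monomial \<tau> (i # L) (e(a := Suc (e a)))"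
      using centre_left_commute[OF z(1)] False by (simp only: mult.assoc z(2) fun_upd_other)
    then show ?thesis using z(1) by blast
  qed
qed simp

text \<open>Exponents can be reduced modulo \<open>N\<close>, since the N-th powers are central;
  finitely many exponent vectors remain.\<close>

lemma ordered_monomial_finite_span:
  assumes "N > 0" "\<And>i. i \<in> set L \<Longrightarrow> \<tau> i ^ N \<in> centre UNIV"
  shows "\<exists>E. finite E \<and> range (ordered_monomial \<tau> L) \<subseteq> central_span E"
proof -
  have "\<exists>E. finite E \<and> (\<forall>e. \<exists>z\<in>centre UNIV. \<exists>m\<in>E. ordered_monomial \<tau> L e = z * m)"
    using assms(2)
  proof (induction L)
    case Nil
    then show ?case by (intro exI[of _ "{1}"]) (auto simp: ordered_monomial_def intro: bexI[of _ 1] centre_closed)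
  next
    case (Cons a L)
    then obtain E where E: "finite E" "\<And>e. \<exists>z\<in>centre UNIV. \<exists>m\<in>E. ordered_monomial \<tau> L e = z * m"
      by (metis list.set_intros(2))
    let ?E = "(\<lambda>(n, m). \<tau> a ^ n * m) ` ({..<N} \<times> E)"
    have "\<exists>z\<in>centre UNIV. \<exists>m\<in>?E. ordered_monomial \<tau> (a # L) e = z * m" for e
    proof -
      obtain z m where z: "z \<in> centre UNIV" "m \<in> E" "ordered_monomial \<tau> L e = z * m" using E(2) by blast
      define y where "y = (\<tau> a ^ N) ^ (e a div N)"
      have y: "y \<in> centre UNIV" using Cons.prems by (auto simp: y_def intro: centre_closed)
      have "\<tau> a ^ e a = \<tau> a ^ (N * (e a div N) + e a mod N)" by simp
      also have "\<dots> = y * \<tau> a ^ (e a mod N)" by (simp only: power_add power_mult y_def)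
      finally have "ordered_monomial \<tau> (a # L) e = y * \<tau> a ^ (e a mod N) * (z * m)" by (simp add: ordered_monomial_def z(3)[unfolded ordered_monomial_def])
      also have "\<dots> = (y * z) * (\<tau> a ^ (e a mod N) * m)" using centre_left_commute[OF z(1)] by (simp add: mult.assoc)
      finally have "ordered_monomial \<tau> (a # L) e = (y * z) * (\<tau> a ^ (e a mod N) * m)" .
      moreover have "\<tau> a ^ (e a mod N) * m \<in> ?E" using z(2) assms(1) by force
      ultimately show ?thesis using centre_closed(3)[OF y z(1)] by blast
    qed
    then show ?case using E(1) by (intro exI[of _ ?E]) auto
  qed
  then obtain E where "finite E" and E: "\<And>e. \<exists>z\<in>centre UNIV. \<exists>m\<in>E. ordered_monomial \<tau> L e = z * m" by blast
  moreover have "ordered_monomial \<tau> L e \<in> central_span E" for e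
  proof -
    obtain z m where "z \<in> centre UNIV" "m \<in> E" "ordered_monomial \<tau> L e = z * m" using E by blast
    then show ?thesis by (simp add: central_span_scale central_span_base)
  qed
  ultimately show ?thesis by blast
qed

text \<open>\<open>V\<close> is the span of all ordered monomials over the centre, a subring because
  multiplication by a variable permutes monomials up to central factors. Only its closure properties
  are exported, which is enough to place rings generated by the \<tau>(i) inside a finite
  span.\<close>

lemma torus_span:
  assumes W: "finite W" and q: "q_commuting \<tau> W"
    and N: "N > 0" "\<And>i. i \<in> W \<Longrightarrow> \<tau> i ^ N \<in> centre UNIV"
  shows "\<exists>V E. finite E \<and> V \<subseteq> central_span E \<and> centre UNIV \<subseteq> V \<and> \<tau> ` W \<subseteq> V \<and>
    (\<forall>u\<in>V. \<forall>v\<in>V. u + v \<in> V \<and> u * v \<in> V)"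
proof -
  obtain L where L: "set L = W" "distinct L" using finite_distinct_list[OF W] by blast
  obtain E where E: "finite E" "range (ordered_monomial \<tau> L) \<subseteq> central_span E"
    using ordered_monomial_finite_span[of N L \<tau>] N L by auto
  let ?V = "central_span (range (ordered_monomial \<tau> L))"
  have "ordered_monomial \<tau> L (\<lambda>i. 0) = 1" for L by (induction L) (simp_all add: ordered_monomial_def)
  then have one: "1 \<in> ?V" using central_span_base[of "ordered_monomial \<tau> L (\<lambda>i. 0)"] by (metis rangeI)
  have var: "v * \<tau> a \<in> ?V" if v: "v \<in> ?V" and a: "a \<in> W" for v a
  proof (rule central_span_mult[OF _ v])
    show "\<tau> a \<in> central_span {\<tau> a}" by (rule central_span_base) simp
    fix e e' assume "e \<in> range (ordered_monomial \<tau> L)" "e' \<in> {\<tau> a}"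
    then obtain k where k: "e = ordered_monomial \<tau> L k" "e' = \<tau> a" by blast
    obtain z where "z \<in> centre UNIV" "ordered_monomial \<tau> L k * \<tau> a = z * ordered_monomial \<tau> L (k(a := Suc (k a)))"
      using ordered_monomial_mult_var[OF q, of L a k] L a by blast
    then show "e * e' \<in> ?V" unfolding k by (simp add: central_span_scale central_span_base)
  qed
  have varn: "v * \<tau> a ^ n \<in> ?V" if "v \<in> ?V" "a \<in> W" for v a n
    using that(1)
  proof (induction n arbitrary: v)
    case (Suc n)
    then show ?case using var[of v a] that(2) by (simp add: mult.assoc[symmetric])
  qed simp
  have "v * prod_list (map (\<lambda>i. \<tau> i ^ k i) M) \<in> ?V" if "v \<in> ?V" "set M \<subseteq> W" for v k M
    using that
  proof (induction M arbitrary: v)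
    case (Cons i M)
    then show ?case using varn[of v i "k i"] by (simp add: mult.assoc[symmetric])
  qed simp
  then have monV: "v * ordered_monomial \<tau> L k \<in> ?V" if "v \<in> ?V" for v k
    using that L by (simp add: ordered_monomial_def)
  have mult: "u * v \<in> ?V" if "u \<in> ?V" "v \<in> ?V" for u v
    using that by (rule central_span_mult[rotated]) (auto intro: monV central_span_base)
  have "centre UNIV \<subseteq> ?V" using central_span_scale[OF _ one] by auto
  moreover have "\<tau> ` W \<subseteq> ?V" using var[OF one] by auto
  moreover have "\<forall>u\<in>?V. \<forall>v\<in>?V. u + v \<in> ?V \<and> u * v \<in> ?V"
    using central_span_add mult by auto
  ultimately show ?thesis
    by (intro exI[of _ ?V] exI[of _ E] conjI E(1) central_span_subset[OF E(2)])
qed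

section \<open>Localisations inside a division ring\<close>

definition invertibles :: "'g::division_ring set \<Rightarrow> 'g set"
  where "invertibles M = {u \<in> M. u \<noteq> 0 \<and> inverse u \<in> M}"

text \<open>The denominators are all elements of \<open>R\<close> that are units of
  \<open>M\<close>, not a given set, so \<open>R\<close> can be exchanged while \<open>M\<close>
  stays fixed. For M = UNIV this describes the division ring of fractions.\<close>

definition localises :: "'g::division_ring set \<Rightarrow> 'g set \<Rightarrow> bool"
  where "localises R M \<longleftrightarrow> R \<subseteq> M \<and> (\<forall>m\<in>M.
    (\<exists>r\<in>R. \<exists>u\<in>R \<inter> invertibles M. m = r * inverse u) \<and>
    (\<exists>r\<in>R. \<exists>u\<in>R \<inter> invertibles M. m = inverse u * r))"

definition mult_closed :: "'g::division_ring set \<Rightarrow> bool"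
  where "mult_closed R \<longleftrightarrow> 1 \<in> R \<and> (\<forall>a\<in>R. \<forall>b\<in>R. a * b \<in> R)"

lemma mult_closedD: "mult_closed R \<Longrightarrow> 1 \<in> R" "mult_closed R \<Longrightarrow> a \<in> R \<Longrightarrow> b \<in> R \<Longrightarrow> a * b \<in> R"
  by (auto simp: mult_closed_def)

lemma mult_closed_power: "mult_closed R \<Longrightarrow> a \<in> R \<Longrightarrow> a ^ n \<in> R"
  by (induction n) (auto simp: mult_closed_def)

lemma mult_closed_invertibles: "mult_closed M \<Longrightarrow> mult_closed (invertibles M)"
  by (auto simp: mult_closed_def invertibles_def nonzero_inverse_mult_distrib)

lemma cofinal_common:
  assumes "power_cofinal z R S" "mult_closed S" "z \<in> S" "r \<in> R" "u \<in> R"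
  shows "\<exists>n. r * z ^ n \<in> S \<and> u * z ^ n \<in> S" "\<exists>n. z ^ n * r \<in> S \<and> z ^ n * u \<in> S"
proof -
  note z = mult_closed_power[OF assms(2,3)] and S = mult_closedD(2)[OF assms(2)]
  obtain n m where "r * z ^ n \<in> S" "u * z ^ m \<in> S" using assms unfolding power_cofinal_def by blast
  then have "r * z ^ n * z ^ m \<in> S" "u * z ^ m * z ^ n \<in> S" using S z by blast+
  then have "r * z ^ (n + m) \<in> S" "u * z ^ (m + n) \<in> S" by (simp_all only: mult.assoc power_add)
  then show "\<exists>n. r * z ^ n \<in> S \<and> u * z ^ n \<in> S" by (metis add.commute)
  obtain n m where "z ^ n * r \<in> S" "z ^ m * u \<in> S" using assms unfolding power_cofinal_def by blast
  then have "z ^ m * (z ^ n * r) \<in> S" "z ^ n * (z ^ m * u) \<in> S" using S z by blast+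
  then have "z ^ (m + n) * r \<in> S" "z ^ (n + m) * u \<in> S" by (simp_all only: mult.assoc power_add)
  then show "\<exists>n. z ^ n * r \<in> S \<and> z ^ n * u \<in> S" by (metis add.commute)
qed

lemma fraction_extend:
  fixes z :: "'g::division_ring"
  assumes "z \<noteq> 0" "u \<noteq> 0"
  shows "r * inverse u = (r * z ^ n) * inverse (u * z ^ n)" "inverse u * r = inverse (z ^ n * u) * (z ^ n * r)"
proof -
  have "z ^ n \<noteq> 0" using assms by simp
  then show "r * inverse u = (r * z ^ n) * inverse (u * z ^ n)" "inverse u * r = inverse (z ^ n * u) * (z ^ n * r)"
    using assms(2) by (simp_all add: nonzero_inverse_mult_distrib mult.assoc)
      (simp_all add: mult.assoc[symmetric])
qed

text \<open>A fraction is extended by z^n until numerator and denominator both lie in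
  \<open>S\<close>. The new denominator is still a unit of \<open>M\<close> because \<open>z\<close>
  is one.\<close>

lemma localises_cofinal:
  assumes RM: "localises R M" and M: "mult_closed M" and S: "mult_closed S"
    and z: "z \<in> invertibles M" "z \<in> S" and RS: "power_cofinal z R S" and SR: "power_cofinal z S R"
  shows "localises S M"
  unfolding localises_def
proof (intro conjI ballI subsetI)
  have z0: "z \<noteq> 0" "inverse z \<in> M" using z by (auto simp: invertibles_def)
  have zU: "z ^ n \<in> invertibles M" for n
    by (rule mult_closed_power[OF mult_closed_invertibles[OF M] z(1)])
  note U = mult_closedD(2)[OF mult_closed_invertibles[OF M]]
  {
    fix s assume "s \<in> S"
    then obtain n where "s * z ^ n \<in> R" using SR by (auto simp: power_cofinal_def)
    then have "s * z ^ n * inverse z ^ n \<in> M"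
      using RM mult_closed_power[OF M z0(2)] mult_closedD(2)[OF M] by (auto simp: localises_def)
    then show "s \<in> M" using z0(1) by (simp add: mult.assoc power_inverse)
  next
    fix m assume "m \<in> M"
    then obtain r u where ru: "r \<in> R" "u \<in> R" "u \<in> invertibles M" "m = r * inverse u"
      using RM by (auto simp: localises_def)
    obtain n where n: "r * z ^ n \<in> S" "u * z ^ n \<in> S" using cofinal_common(1)[OF RS S z(2) ru(1,2)] by blast
    have "u \<noteq> 0" using ru(3) by (simp add: invertibles_def)
    then have "m = (r * z ^ n) * inverse (u * z ^ n)" using fraction_extend(1)[OF z0(1)] ru(4) by simp
    then show "\<exists>r\<in>S. \<exists>u\<in>S \<inter> invertibles M. m = r * inverse u" using n U[OF ru(3) zU[of n]] by blast
  next
    fix m assume "m \<in> M"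
    then obtain r u where ru: "r \<in> R" "u \<in> R" "u \<in> invertibles M" "m = inverse u * r"
      using RM by (auto simp: localises_def)
    obtain n where n: "z ^ n * r \<in> S" "z ^ n * u \<in> S" using cofinal_common(2)[OF RS S z(2) ru(1,2)] by blast
    have "u \<noteq> 0" using ru(3) by (simp add: invertibles_def)
    then have "m = inverse (z ^ n * u) * (z ^ n * r)" using fraction_extend(2)[OF z0(1)] ru(4) by simp
    then show "\<exists>r\<in>S. \<exists>u\<in>S \<inter> invertibles M. m = inverse u * r" using n U[OF zU[of n] ru(3)] by blast
  }
qed

lemma (in embedded_ring) is_Frac_iff: "is_Frac B f \<longleftrightarrow> localises (f ` carrier B) UNIV"
proof -
  have "carrier B - {\<zero>} = {s \<in> carrier B. f s \<noteq> 0}" using f_eq_0_iff by auto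
  then show ?thesis
    unfolding is_Frac_def Frac_in_def loc_def localises_def invertibles_def using f_hom f_inj
    by (simp add: set_eq_iff Bex_def image_iff) (auto; metis)
qed

lemma (in embedded_ring) loc_eq: "loc B f \<Gamma> = {r * inverse u | r u. r \<in> f ` carrier B \<and> u \<in> f ` \<Gamma>}"
  by (auto simp: loc_def)

text \<open>Conjugation by \<open>S\<close> preserves \<open>R\<close>, so every denominator can be
  moved past a numerator without changing the denominator.\<close>

lemma normalised_localisation:
  assumes R: "mult_closed R" and S: "mult_closed S" "S \<subseteq> R" "0 \<notin> S"
    and conj: "\<And>s r. s \<in> S \<Longrightarrow> r \<in> R \<Longrightarrow> s * r * inverse s \<in> R \<and> inverse s * r * s \<in> R"
    and M: "M = {r * inverse s | r s. r \<in> R \<and> s \<in> S}"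
  shows "mult_closed M" "S \<subseteq> invertibles M" "localises R M"
proof -
  have RM: "R \<subseteq> M" unfolding M using mult_closedD(1)[OF S(1)] by force
  show "mult_closed M"
    unfolding mult_closed_def
  proof (intro conjI ballI)
    show "1 \<in> M" using RM mult_closedD(1)[OF R] by blast
    fix a b assume "a \<in> M" "b \<in> M"
    then obtain r s r' s' where *: "r \<in> R" "s \<in> S" "a = r * inverse s" "r' \<in> R" "s' \<in> S" "b = r' * inverse s'"
      unfolding M by blast
    have s: "s \<noteq> 0" "s' \<noteq> 0" using * S(3) by auto
    \<comment> \<open>The inner pair s^-1 r' is rewritten as (s^-1 r' s) s^-1, which collects both
      denominators on the right in reversed order.\<close>
    have "a * b = (r * (inverse s * r' * s)) * inverse (s' * s)"
      using s by (simp add: * nonzero_inverse_mult_distrib mult.assoc) (simp add: mult.assoc[symmetric])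
    moreover have "r * (inverse s * r' * s) \<in> R" "s' * s \<in> S"
      using * conj mult_closedD(2)[OF R] mult_closedD(2)[OF S(1)] by blast+
    ultimately show "a * b \<in> M" unfolding M by blast
  qed
  show SU: "S \<subseteq> invertibles M"
  proof
    fix s assume s: "s \<in> S"
    have "1 * inverse s \<in> M" unfolding M using s mult_closedD(1)[OF R] by blast
    then show "s \<in> invertibles M" using s S RM by (auto simp: invertibles_def)
  qed
  show "localises R M"
    unfolding localises_def
  proof (intro conjI ballI RM)
    fix m assume "m \<in> M"
    then obtain r s where *: "r \<in> R" "s \<in> S" "m = r * inverse s" unfolding M by blast
    then show "\<exists>r\<in>R. \<exists>u\<in>R \<inter> invertibles M. m = r * inverse u" using SU S(2) by blast
    have "m = inverse s * (s * r * inverse s)" using * S(3) by (auto simp: mult.assoc[symmetric])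
    then show "\<exists>r\<in>R. \<exists>u\<in>R \<inter> invertibles M. m = inverse u * r" using * conj SU S(2) by blast
  qed
qed

section \<open>Ore localisation of the quotients\<close>

lemma quot_map_cong:
  assumes "quot_map R P \<phi> f" "ring_closed R" "\<And>a. a \<in> R \<Longrightarrow> \<psi> a = \<phi> a"
  shows "quot_map R P \<psi> f"
  using assms unfolding quot_map_def ring_closed_def by auto

lemma quot_map_canonical:
  assumes "quot_map R P \<phi> f" "ring_closed R"
  shows "quot_map R P (\<lambda>a. f (P +>\<^bsub>ring_of R\<^esub> a)) f"
  by (rule quot_map_cong[OF assms]) (use quot_mapD(9)[OF assms] in simp)

lemma quot_map_mult_closed:
  assumes "quot_map R P \<phi> f" "ring_closed R"
  shows "mult_closed (\<phi> ` R)"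
proof -
  note D = quot_mapD[OF assms]
  have R: "1 \<in> R" "\<And>a b. a \<in> R \<Longrightarrow> b \<in> R \<Longrightarrow> a * b \<in> R" using assms(2) by (auto simp: ring_closed_def)
  show ?thesis
    unfolding mult_closed_def
  proof (intro conjI ballI)
    show "1 \<in> \<phi> ` R" using D(1) R(1) by force
    fix u v assume "u \<in> \<phi> ` R" "v \<in> \<phi> ` R"
    then obtain a b where "a \<in> R" "b \<in> R" "u = \<phi> a" "v = \<phi> b" by blast
    then show "u * v \<in> \<phi> ` R" using D(3)[of a b] R(2)[of a b] by force
  qed
qed

lemma common_order:
  fixes c :: "'i \<Rightarrow> 'i \<Rightarrow> 'k::field"
  assumes W: "finite W" and c: "\<And>i j. i \<in> W \<Longrightarrow> j \<in> W \<Longrightarrow> root_of_unity (c i j)"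
  shows "\<exists>N>0. \<forall>i\<in>W. \<forall>j\<in>W. c i j ^ N = 1"
proof -
  obtain n where n: "\<And>i j. i \<in> W \<Longrightarrow> j \<in> W \<Longrightarrow> n i j > 0 \<and> c i j ^ n i j = 1"
    using c unfolding root_of_unity_def by metis
  let ?N = "\<Prod>p\<in>W \<times> W. n (fst p) (snd p)"
  have "c i j ^ ?N = 1" if "i \<in> W" "j \<in> W" for i j
  proof -
    have "n (fst (i, j)) (snd (i, j)) dvd ?N" by (rule dvd_prodI) (use W that in auto)
    then obtain k where "?N = n i j * k" by auto
    then show ?thesis using n that by (simp add: power_mult)
  qed
  moreover have "?N > 0" by (rule prod_pos) (use n in auto)
  ultimately show ?thesis by blast
qed

section \<open>Comparison of A/P with A'/Q inside Frac(A/P)\<close>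

locale prime_quotient = quantum_nilpotent D for D :: "('k::field, 'f::division_ring) qna" +
  fixes P :: "'f set" and w :: "nat set" and f :: "'f set \<Rightarrow> 'g::division_ring"
  assumes w: "w \<subseteq> {1..num D}" and P: "P \<in> CSpec_w D w"
    and Frac: "is_Frac (alg D (num D + 1) Quot P) f"
begin

definition \<phi> :: "nat \<Rightarrow> 'f \<Rightarrow> 'g"
  where "\<phi> j a = ident_at P f j (prime_at D P j +>\<^bsub>ring_of (G j (num D))\<^esub> a)"

text \<open>The algebra B^(j) as a subring of Frac(A/P).\<close>

definition quot_image :: "nat \<Rightarrow> 'g set" where "quot_image j = \<phi> j ` G j (num D)"

definition \<tau> :: "nat \<Rightarrow> 'g" where "\<tau> i = \<phi> 2 (gen D 2 i)"

abbreviation wbar where "wbar \<equiv> {1..num D} - w"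
abbreviation B where "B \<equiv> ring_of (G (Suc (num D)) (num D)) Quot P"
abbreviation B' where "B' \<equiv> ring_of (G 2 (num D)) Quot psi D P"
abbreviation f' where "f' \<equiv> ident D P f"

lemma psi_eq: "prime_at D P 2 = psi D P" and f'_eq: "ident_at P f 2 = f'"
  by (simp_all add: psi_def ident_at_def ident_def)

lemma quot_map_\<phi>:
  assumes "2 \<le> j" "j \<le> Suc (num D)"
  shows "quot_map (G j (num D)) (prime_at D P j) (\<phi> j) (ident_at P f j)"
  using assms(2,1)
proof (induction rule: inc_induct)
  case base
  have "ideal P (ring_of (G (Suc (num D)) (num D)))"
    using P by (simp add: CSpec_w_def CSpec_def alg_eq Suc_eq_plus1)
  moreover have "f \<in> ring_hom B (ring_of UNIV)" "inj_on f (carrier B)"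
    using Frac by (simp_all add: is_Frac_def alg_eq Suc_eq_plus1)
  ultimately have "quot_map (G (Suc (num D)) (num D)) P
      (\<lambda>a. f (P +>\<^bsub>ring_of (G (Suc (num D)) (num D))\<^esub> a)) f"
    by (intro quot_map_intro) auto
  then show ?case by (simp add: \<phi>_def[abs_def] prime_at_last ident_at_last)
next
  case (step n)
  then have "quot_map (G (Suc n) (num D)) (prime_at D P (Suc n)) (\<phi> (Suc n)) (ident_at P f (Suc n))" by simp
  moreover have n: "2 \<le> n" "n \<le> num D" using step by auto
  ultimately obtain \<psi> where "quot_map (G n (num D)) (prime_at D P n) \<psi> (ident_at P f n)"
    using quot_map_step[OF n] by blast
  then show ?case unfolding \<phi>_def[abs_def] by (rule quot_map_canonical) simp
qed

lemma \<phi>_step: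
  assumes j: "2 \<le> j" "j \<le> num D"
  shows "\<exists>z. (\<forall>i\<in>{j..num D}. \<phi> j (gen D j i) = \<phi> (Suc j) (gen D (Suc j) i)) \<and>
    (z = 1 \<or> z = \<phi> j (gen D j j) \<and> z \<noteq> 0) \<and>
    power_cofinal z (quot_image (Suc j)) (quot_image j) \<and> power_cofinal z (quot_image j) (quot_image (Suc j))"
proof -
  have "quot_map (G (Suc j) (num D)) (prime_at D P (Suc j)) (\<phi> (Suc j)) (ident_at P f (Suc j))"
    using j by (intro quot_map_\<phi>) auto
  then obtain \<psi> z where *: "quot_map (G j (num D)) (prime_at D P j) \<psi> (ident_at P f j)"
    "\<forall>i\<in>{j..num D}. \<psi> (gen D j i) = \<phi> (Suc j) (gen D (Suc j) i)"
    "z = 1 \<or> z = \<psi> (gen D j j) \<and> z \<noteq> 0"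
    "power_cofinal z (\<phi> (Suc j) ` G (Suc j) (num D)) (\<psi> ` G j (num D))"
    "power_cofinal z (\<psi> ` G j (num D)) (\<phi> (Suc j) ` G (Suc j) (num D))"
    using quot_map_step[OF j] by blast
  have eq: "\<phi> j a = \<psi> a" if "a \<in> G j (num D)" for a
    using quot_mapD(9)[OF *(1) ring_closed_G that] by (simp add: \<phi>_def)
  have im: "\<psi> ` G j (num D) = quot_image j" unfolding quot_image_def by (intro image_cong) (auto simp: eq)
  have "\<phi> j (gen D j i) = \<psi> (gen D j i)" if "i \<in> {j..num D}" for i
    using that j by (intro eq gen_in_G) auto
  then show ?thesis using *(2-) j unfolding im quot_image_def[of "Suc j", symmetric] by auto
qed

text \<open>Step \<open>j\<close> does not change the images of the generators of index at least
  \<open>j\<close>, so \<tau>(i) is present up to stage i + 1. Stages \<open>i\<close> and i + 1 are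
  the two that step \<open>i\<close> compares, hence the element it inverts is \<tau>(i) and lies in
  both.\<close>

lemma \<phi>_gen_eq_\<tau>:
  assumes "2 \<le> k" "k \<le> Suc i" "1 \<le> i" "i \<le> num D"
  shows "\<phi> k (gen D k i) = \<tau> i"
  using assms(1,2)
proof (induction rule: dec_induct)
  case base then show ?case by (simp add: \<tau>_def)
next
  case (step n)
  then show ?case using \<phi>_step[of n] assms by auto
qed

lemma quot_map_2: "quot_map (G 2 (num D)) (psi D P) (\<phi> 2) f'"
  using quot_map_\<phi>[of 2] num_pos by (simp add: psi_eq f'_eq)

lemmas \<phi>2 = quot_mapD[OF quot_map_2 ring_closed_G]

lemma embedded: "embedded_ring B f" "f ` carrier B = quot_image (Suc (num D))"
  "embedded_ring B' f'" "f' ` carrier B' = quot_image 2"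
  using quot_map_embedded[OF quot_map_\<phi>[of "Suc (num D)"] ring_closed_G] quot_map_embedded[OF quot_map_2 ring_closed_G] num_pos
  by (simp_all add: quot_image_def prime_at_last ident_at_last)

lemma mult_closed_quot_image: "2 \<le> j \<Longrightarrow> j \<le> Suc (num D) \<Longrightarrow> mult_closed (quot_image j)"
  unfolding quot_image_def by (rule quot_map_mult_closed[OF quot_map_\<phi>]) auto

lemma T_in: "i \<in> {1..num D} \<Longrightarrow> gen D 2 i \<in> G 2 (num D)"
  by (intro gen_in_G) auto

lemma \<tau>_eq_0_iff: "i \<in> {1..num D} \<Longrightarrow> \<tau> i = 0 \<longleftrightarrow> i \<in> w"
proof -
  assume i: "i \<in> {1..num D}"
  have Q: "psi D P \<inter> gen D 2 ` {1..num D} = gen D 2 ` w"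
    using P by (simp add: CSpec_w_def CSpec_w'_def)
  have "\<tau> i = 0 \<longleftrightarrow> gen D 2 i \<in> psi D P" using \<phi>2(8) T_in[OF i] by (simp add: \<tau>_def)
  also have "\<dots> \<longleftrightarrow> gen D 2 i \<in> gen D 2 ` w" using Q i by blast
  also have "\<dots> \<longleftrightarrow> i \<in> w" using inj_on_image_mem_iff[OF T_inj i w] .
  finally show ?thesis .
qed

text \<open>The element inverted at step \<open>j\<close> is the image of \<open>x\<^sub>j = T\<^sub>j\<close>, and it is nonzero exactly when
  \<open>j \<in> wbar\<close>. So it is a unit of \<open>M\<close>, and \<open>M\<close> stays a localisation of each successive quotient.\<close>

lemma localises_image:
  assumes M: "mult_closed M" "\<tau> ` wbar \<subseteq> invertibles M" and loc: "localises (quot_image 2) M"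
    and j: "2 \<le> j" "j \<le> Suc (num D)"
  shows "localises (quot_image j) M"
  using j
proof (induction rule: dec_induct)
  case base show ?case by (rule loc)
next
  case (step n)
  then have n: "2 \<le> n" "n \<le> num D" by auto
  obtain z where z: "z = 1 \<or> z = \<tau> n \<and> z \<noteq> 0"
    "power_cofinal z (quot_image (Suc n)) (quot_image n)" "power_cofinal z (quot_image n) (quot_image (Suc n))"
    using \<phi>_step[OF n] \<phi>_gen_eq_\<tau>[of n n] n by auto
  have mc: "mult_closed (quot_image (Suc n))" using n by (intro mult_closed_quot_image) auto
  have "z \<in> invertibles M \<and> z \<in> quot_image (Suc n)"
  proof (cases "z = 1")
    case True
    then show ?thesis using M(1) mc by (auto simp: mult_closed_def invertibles_def)
  next
    case False
    then have "n \<in> wbar" "z = \<tau> n" using z(1) \<tau>_eq_0_iff[of n] n by auto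
    moreover have "\<tau> n \<in> invertibles M" using M(2) \<open>n \<in> wbar\<close> by blast
    moreover have "\<tau> n = \<phi> (Suc n) (gen D (Suc n) n)" using \<phi>_gen_eq_\<tau>[of "Suc n" n] n by simp
    ultimately show ?thesis using n gen_in_G[of n "num D" "Suc n"] by (auto simp: quot_image_def)
  qed
  then show ?case using localises_cofinal[OF step.IH M(1) mc] z n by auto
qed

text \<open>The induction descends from A/P, whose fractions are given, to A'/Q. Any nonzero
  \<open>z\<close> is a unit here, so no knowledge of \<open>w\<close> enters.\<close>

lemma localises_image_UNIV:
  assumes j: "2 \<le> j" "j \<le> Suc (num D)"
  shows "localises (quot_image j) UNIV"
  using j(2,1)
proof (induction rule: inc_induct)
  case base
  have "is_Frac B f" using Frac by (simp add: alg_eq Suc_eq_plus1)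
  then show ?case using embedded_ring.is_Frac_iff[OF embedded(1)] embedded(2) by simp
next
  case (step n)
  then have n: "2 \<le> n" "n \<le> num D" by auto
  obtain z where z: "z = 1 \<or> z = \<phi> n (gen D n n) \<and> z \<noteq> 0"
    "power_cofinal z (quot_image (Suc n)) (quot_image n)" "power_cofinal z (quot_image n) (quot_image (Suc n))"
    using \<phi>_step[OF n] by auto
  have mc: "mult_closed (quot_image n)" using n by (intro mult_closed_quot_image) auto
  have "z \<in> quot_image n" "z \<noteq> 0"
    using z(1) mc gen_in_G[of n "num D" n] n by (auto simp: quot_image_def mult_closed_def)
  then show ?case
    using localises_cofinal[OF step.IH _ mc _ _ z(2,3)] n by (auto simp: mult_closed_def invertibles_def)
qed

abbreviation t where "t i \<equiv> psi D P +>\<^bsub>ring_of (G 2 (num D))\<^esub> gen D 2 i"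

definition \<Sigma> where "\<Sigma> = mult_generated B' (t ` wbar)"

lemma t_in: "i \<in> wbar \<Longrightarrow> t i \<in> carrier B'"
  using ring_Quot(2)[OF ring_closed_G \<phi>2(10)] T_in by auto

lemma t_subset: "t ` wbar \<subseteq> carrier B'"
  using t_in by blast

lemma f'_t: "i \<in> wbar \<Longrightarrow> f' (t i) = \<tau> i"
  using \<phi>2(9) T_in by (simp add: \<tau>_def)

lemma monoid_B': "Group.monoid B'"
  using embedded_ring.ring[OF embedded(3)] by (rule ring.is_monoid)

lemma submonoid_\<Sigma>: "submonoid \<Sigma> B'" and t_\<Sigma>: "t ` wbar \<subseteq> \<Sigma>"
  unfolding \<Sigma>_def using submonoid_mult_generated[OF monoid_B' t_subset] by auto

text \<open>Each T_i commutes with the generators of A' up to scalars, hence is normal there. The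
  relations are proved in A' and pushed to the quotient, where \<tau>(i) is nonzero and can be
  divided out.\<close>

lemma \<tau>_conj:
  assumes i: "i \<in> wbar" and r: "r \<in> quot_image 2"
  shows "\<tau> i * r * inverse (\<tau> i) \<in> quot_image 2" "inverse (\<tau> i) * r * \<tau> i \<in> quot_image 2"
proof -
  let ?T = "gen D 2 i"
  have iN: "1 \<le> i" "i \<le> num D" "i \<in> {1..num D}" using i by auto
  have \<tau>0: "\<tau> i \<noteq> 0" using \<tau>_eq_0_iff iN i by auto
  have *: "\<exists>b\<in>G 2 (num D). \<exists>c\<in>G 2 (num D). ?T * a = b * ?T \<and> a * ?T = ?T * c" if "a \<in> G 2 (num D)" for a
    using that
  proof (induction rule: G_induct)
    case (gen l)
    have "?T * gen D 2 l = scal D (lam D i l) (gen D 2 l) * ?T" "gen D 2 l * ?T = ?T * scal D (lam D l i) (gen D 2 l)"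
      using T_comm[OF iN(1,2) gen] T_comm[OF gen iN(1,2)] by (simp_all add: mult_scale)
    then show ?case using GD(5)[OF gen_in_G[OF gen]] by blast
  next
    case one
    then show ?case using GD(1) by (intro bexI[of _ 1]) auto
  next
    case (add x y)
    then obtain b c b' c' where "b \<in> G 2 (num D)" "c \<in> G 2 (num D)" "b' \<in> G 2 (num D)" "c' \<in> G 2 (num D)"
      "?T * x = b * ?T" "x * ?T = ?T * c" "?T * y = b' * ?T" "y * ?T = ?T * c'"
      by blast
    then show ?case
      by (intro bexI[of _ "b + b'"] bexI[of _ "c + c'"]) (auto simp: distrib_left distrib_right intro: GD)
  next
    case (mult x y)
    then obtain b c b' c' where *: "b \<in> G 2 (num D)" "c \<in> G 2 (num D)" "b' \<in> G 2 (num D)" "c' \<in> G 2 (num D)"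
      "?T * x = b * ?T" "x * ?T = ?T * c" "?T * y = b' * ?T" "y * ?T = ?T * c'"
      by blast
    have "?T * (x * y) = b * b' * ?T" using *(5,7) by (metis mult.assoc)
    moreover have "x * y * ?T = ?T * (c * c')" using *(6,8) by (metis mult.assoc)
    ultimately show ?case using * GD(4) by blast
  next
    case (scale k x)
    then obtain b c where "b \<in> G 2 (num D)" "c \<in> G 2 (num D)" "?T * x = b * ?T" "x * ?T = ?T * c"
      by blast
    then show ?case
      by (intro bexI[of _ "scal D k b"] bexI[of _ "scal D k c"]) (auto simp: mult_scale intro: GD)
  qed
  obtain a where a: "a \<in> G 2 (num D)" "r = \<phi> 2 a" using r by (auto simp: quot_image_def)
  obtain b c where bc: "b \<in> G 2 (num D)" "c \<in> G 2 (num D)" "?T * a = b * ?T" "a * ?T = ?T * c" using *[OF a(1)] by blast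
  have "\<tau> i * r = \<phi> 2 b * \<tau> i" "r * \<tau> i = \<tau> i * \<phi> 2 c"
    using \<phi>2(3)[OF T_in[OF iN(3)] a(1)] \<phi>2(3)[OF a(1) T_in[OF iN(3)]]
      \<phi>2(3)[OF bc(1) T_in[OF iN(3)]] \<phi>2(3)[OF T_in[OF iN(3)] bc(2)] bc(3,4) a(2)
    by (simp_all add: \<tau>_def)
  then have "\<tau> i * r * inverse (\<tau> i) = \<phi> 2 b" "inverse (\<tau> i) * r * \<tau> i = \<phi> 2 c"
    using \<tau>0 by (simp_all add: mult.assoc) (simp add: mult.assoc[symmetric])
  then show "\<tau> i * r * inverse (\<tau> i) \<in> quot_image 2" "inverse (\<tau> i) * r * \<tau> i \<in> quot_image 2"
    using bc by (auto simp: quot_image_def)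
qed

lemma \<Sigma>_props:
  assumes "s \<in> \<Sigma>"
  shows "s \<in> carrier B'" "f' s \<noteq> 0"
    "r \<in> quot_image 2 \<Longrightarrow> f' s * r * inverse (f' s) \<in> quot_image 2 \<and> inverse (f' s) * r * f' s \<in> quot_image 2"
proof -
  interpret embedded_ring B' f' by (rule embedded(3))
  show "s \<in> carrier B'" using assms submonoid_\<Sigma> by (auto simp: submonoid_def)
  have "f' s \<noteq> 0 \<and> (\<forall>r\<in>quot_image 2. f' s * r * inverse (f' s) \<in> quot_image 2 \<and> inverse (f' s) * r * f' s \<in> quot_image 2)"
    using assms unfolding \<Sigma>_def using monoid_B' t_subset
  proof (induction rule: mult_generated_induct)
    case (gen s)
    then obtain i where i: "i \<in> wbar" "s = t i" by blast
    then show ?case using \<tau>_conj \<tau>_eq_0_iff[of i] f'_t by auto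
  next
    case (mult s s')
    have *: "f' (s \<otimes>\<^bsub>B'\<^esub> s') = f' s * f' s'" using mult by (intro f_mult)
    have "f' s * f' s' * r * inverse (f' s * f' s') = f' s * (f' s' * r * inverse (f' s')) * inverse (f' s)"
      "inverse (f' s * f' s') * r * (f' s * f' s') = inverse (f' s') * (inverse (f' s) * r * f' s) * f' s'" for r
      using mult by (simp_all add: nonzero_inverse_mult_distrib mult.assoc)
    then show ?case unfolding * using mult by simp
  qed (use f_one in auto)
  then show "f' s \<noteq> 0" "r \<in> quot_image 2 \<Longrightarrow> f' s * r * inverse (f' s) \<in> quot_image 2 \<and> inverse (f' s) * r * f' s \<in> quot_image 2"
    by auto
qed

lemma \<Sigma>_regular_normal:
  assumes "s \<in> \<Sigma>"
  shows "regular_elt B' s" "normal_elt B' s"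
proof -
  interpret embedded_ring B' f' by (rule embedded(3))
  note s = \<Sigma>_props[OF assms]
  show "regular_elt B' s" using s(1,2) by (rule regular_eltI)
  show "normal_elt B' s" by (rule normal_eltI[OF s(1,2)]) (use s(3) embedded(4) in blast)+
qed

definition M where "M = {r * inverse s | r s. r \<in> quot_image 2 \<and> s \<in> f' ` \<Sigma>}"

lemma M_props: "mult_closed M" "f' ` \<Sigma> \<subseteq> invertibles M" "localises (quot_image 2) M"
proof -
  interpret embedded_ring B' f' by (rule embedded(3))
  have 1: "mult_closed (quot_image 2)" using num_pos by (intro mult_closed_quot_image) auto
  have "mult_closed (f' ` \<Sigma>)"
    unfolding mult_closed_def
  proof (intro conjI ballI)
    show "1 \<in> f' ` \<Sigma>" using f_one submonoid.one_closed[OF submonoid_\<Sigma>] by force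
    fix u v assume "u \<in> f' ` \<Sigma>" "v \<in> f' ` \<Sigma>"
    then obtain a b where ab: "a \<in> \<Sigma>" "b \<in> \<Sigma>" "u = f' a" "v = f' b" by blast
    then show "u * v \<in> f' ` \<Sigma>"
      using f_mult[of a b] \<Sigma>_props(1) submonoid.m_closed[OF submonoid_\<Sigma> ab(1,2)] by (metis imageI)
  qed
  moreover have "f' ` \<Sigma> \<subseteq> quot_image 2" using \<Sigma>_props(1) embedded(4) by blast
  moreover have "0 \<notin> f' ` \<Sigma>" using \<Sigma>_props(2) by force
  moreover have "s * r * inverse s \<in> quot_image 2 \<and> inverse s * r * s \<in> quot_image 2" if "s \<in> f' ` \<Sigma>" "r \<in> quot_image 2" for s r
    using that \<Sigma>_props(3) by blast
  ultimately show "mult_closed M" "f' ` \<Sigma> \<subseteq> invertibles M" "localises (quot_image 2) M"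
    using normalised_localisation[OF 1, of "f' ` \<Sigma>" M] M_def by blast+
qed

lemma localises_A: "localises (quot_image (Suc (num D))) M"
proof (rule localises_image[OF M_props(1) _ M_props(3)])
  show "\<tau> ` wbar \<subseteq> invertibles M"
  proof
    fix u assume "u \<in> \<tau> ` wbar"
    then obtain i where "i \<in> wbar" "u = f' (t i)" using f'_t by auto
    then show "u \<in> invertibles M" using t_\<Sigma> M_props(2) by blast
  qed
qed (use num_pos in auto)

text \<open>For a unit \<open>u\<close> of \<open>M\<close> and \<open>r\<close> in A/P, both u^-1 r
  and r u^-1 lie in \<open>M\<close>, and every element of \<open>M\<close> is a fraction on either
  side with a unit of \<open>M\<close> as denominator. This gives the Ore conditions and the
  equality of localisations together.\<close>

lemma Gamma_ex:
  "\<exists>\<Gamma>. submonoid \<Gamma> B \<and> (\<forall>s\<in>\<Gamma>. regular_elt B s) \<and> two_sided_Ore B \<Gamma> \<and> loc B f \<Gamma> = loc B' f' \<Sigma>"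
proof -
  interpret embedded_ring B f by (rule embedded(1))
  let ?U = "invertibles M"
  define \<Gamma> where "\<Gamma> = {b \<in> carrier B. f b \<in> ?U}"
  note U = mult_closed_invertibles[OF M_props(1)]
  note loc = localises_A[unfolded localises_def embedded(2)[symmetric]]
  have U0: "0 \<notin> ?U" by (simp add: invertibles_def)
  have "submonoid \<Gamma> B"
    unfolding \<Gamma>_def using U by (intro submonoid_vimage) (auto simp: mult_closed_def)
  moreover have "regular_elt B s" if "s \<in> \<Gamma>" for s
    using that U0 by (intro regular_eltI) (auto simp: \<Gamma>_def)
  moreover have "two_sided_Ore B \<Gamma>"
  proof (rule two_sided_OreI[OF \<Gamma>_def U0])
    fix r u assume r: "r \<in> f ` carrier B" and u: "u \<in> ?U"
    have "inverse u * r \<in> M" "r * inverse u \<in> M"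
      using r u loc mult_closedD(2)[OF M_props(1)] by (auto simp: invertibles_def subset_iff)
    then show "\<exists>r'\<in>f ` carrier B. \<exists>u'\<in>f ` carrier B \<inter> ?U. inverse u * r = r' * inverse u'"
      "\<exists>r'\<in>f ` carrier B. \<exists>u'\<in>f ` carrier B \<inter> ?U. r * inverse u = inverse u' * r'"
      using loc by blast+
  qed
  moreover have "loc B f \<Gamma> = M"
  proof -
    have \<Gamma>: "f ` \<Gamma> = f ` carrier B \<inter> ?U" by (auto simp: \<Gamma>_def)
    have "r * inverse u \<in> M" if "r \<in> f ` carrier B" "u \<in> ?U" for r u
      using that loc mult_closedD(2)[OF M_props(1)] by (auto simp: invertibles_def subset_iff)
    then show ?thesis using loc unfolding loc_eq \<Gamma> by blast
  qed
  moreover have "loc B' f' \<Sigma> = M"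
    using embedded_ring.loc_eq[OF embedded(3)] embedded(4) by (simp add: M_def)
  ultimately show ?thesis by blast
qed

lemma is_Frac_B': "is_Frac B' f'"
  using embedded_ring.is_Frac_iff[OF embedded(3)] localises_image_UNIV[of 2] embedded(4) num_pos by simp

section \<open>The root of unity case\<close>

text \<open>An element that commutes with \<open>u\<close> commutes with u^-1, hence with all
  fractions. Centrality in Frac(A/P) can therefore be tested on A'/Q.\<close>

lemma centre_image:
  assumes z: "\<And>r. r \<in> quot_image 2 \<Longrightarrow> z * r = r * z"
  shows "z \<in> centre UNIV"
  unfolding centre_iff
proof
  fix x :: 'g
  have "localises (quot_image 2) UNIV" using num_pos by (intro localises_image_UNIV) auto
  then obtain r u where ru: "r \<in> quot_image 2" "u \<in> quot_image 2" "u \<noteq> 0" "x = r * inverse u"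
    unfolding localises_def invertibles_def by blast
  have "z * inverse u = inverse u * (u * z) * inverse u" using ru(3) by (simp add: mult.assoc[symmetric])
  also have "\<dots> = inverse u * (z * u) * inverse u" using z[OF ru(2)] by simp
  also have "\<dots> = inverse u * z" using ru(3) by (simp add: mult.assoc)
  finally show "z * x = x * z" using z[OF ru(1)] ru(4) by (metis mult.assoc)
qed

text \<open>The division ring of fractions has no declared scalar multiplication, so the images of
  the multiples of 1 play the role of the scalars.\<close>

lemma scalar_central: "\<phi> 2 (scal D k 1) \<in> centre UNIV"
proof (rule centre_image)
  fix r assume "r \<in> quot_image 2"
  then obtain a where a: "a \<in> G 2 (num D)" "r = \<phi> 2 a" by (auto simp: quot_image_def)
  have k: "scal D k 1 \<in> G 2 (num D)" by (intro GD)
  have "scal D k 1 * a = a * scal D k 1" by (simp add: mult_scale)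
  then show "\<phi> 2 (scal D k 1) * r = r * \<phi> 2 (scal D k 1)" using \<phi>2(3)[OF k a(1)] \<phi>2(3)[OF a(1) k] a(2) by simp
qed

lemma \<phi>_scale: "a \<in> G 2 (num D) \<Longrightarrow> \<phi> 2 (scal D k a) = \<phi> 2 (scal D k 1) * \<phi> 2 a"
  using \<phi>2(3)[of "scal D k 1" a] GD by (simp add: mult_scale)

lemma \<tau>_comm:
  assumes "i \<in> {1..num D}" "l \<in> {1..num D}"
  shows "\<tau> i * \<tau> l = \<phi> 2 (scal D (lam D i l) 1) * (\<tau> l * \<tau> i)"
  using T_comm[of i l] assms \<phi>2(3)[OF T_in T_in, of i l] \<phi>2(3)[OF T_in T_in, of l i] \<phi>_scale[OF GD(4)[OF T_in T_in], of l i]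
  by (simp add: \<tau>_def)

lemma PI:
  assumes roots: "\<And>i j. i \<in> wbar \<Longrightarrow> j \<in> wbar \<Longrightarrow> root_of_unity (lam D i j)"
  shows "PI_ring B" "PI_ring B'"
proof -
  obtain n where n: "n > 0" "\<And>i j. i \<in> wbar \<Longrightarrow> j \<in> wbar \<Longrightarrow> lam D i j ^ n = 1"
    using common_order[of wbar "lam D"] roots by auto
  let ?k = "\<lambda>c. \<phi> 2 (scal D c 1)"
  have q: "q_commuting \<tau> wbar"
    unfolding q_commuting_def using \<tau>_comm scalar_central by blast
  have k_power: "?k c ^ m = ?k (c ^ m)" for c m
    using \<phi>2(7)[of "scal D c 1" m] GD by (simp add: scale_power)
  have \<tau>n: "\<tau> i ^ n \<in> centre UNIV" if i: "i \<in> wbar" for i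
  proof (rule centre_image)
    have \<tau>l: "\<tau> i ^ n * \<tau> l = \<tau> l * \<tau> i ^ n" if l: "l \<in> {1..num D}" for l
    \<comment> \<open>For \<open>l\<close> in \<open>w\<close> the image \<tau>(l) is zero, which is
      why only the parameters with both indices in \<open>wbar\<close> have to be roots of
      unity.\<close>
    proof (cases "l \<in> w")
      case True
      then show ?thesis using \<tau>_eq_0_iff[OF l] by simp
    next
      case False
      have "?k (lam D i l) ^ n = 1" using k_power n(2)[OF i, of l] l False \<phi>2(1) by simp
      then show ?thesis
        using q_commute_power[OF \<tau>_comm[of i l] scalar_central, of n 1] i l by simp
    qed
    fix r assume "r \<in> quot_image 2"
    then obtain a where a: "a \<in> G 2 (num D)" "r = \<phi> 2 a" by (auto simp: quot_image_def)
    have "\<tau> i ^ n * \<phi> 2 a = \<phi> 2 a * \<tau> i ^ n"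
      using a(1)
    proof (induction rule: G_induct)
      case (gen l) then show ?case using \<tau>l by (auto simp: \<tau>_def)
    next
      case one then show ?case using \<phi>2(1) by simp
    next
      case (add a b)
      then show ?case using \<phi>2(2)[of a b] by (simp add: distrib_left distrib_right)
    next
      case (mult a b)
      then have ab: "\<phi> 2 (a * b) = \<phi> 2 a * \<phi> 2 b" using \<phi>2(3)[of a b] by simp
      have "\<tau> i ^ n * \<phi> 2 (a * b) = \<phi> 2 a * (\<tau> i ^ n * \<phi> 2 b)"
        unfolding ab mult.assoc[symmetric] by (simp only: mult(3))
      also have "\<dots> = \<phi> 2 (a * b) * \<tau> i ^ n" by (simp only: mult(4) ab mult.assoc)
      finally show ?case .
    next
      case (scale k a)
      then show ?case
        using \<phi>_scale[of a k] centre_left_commute[OF scalar_central[of k]] by (simp add: mult.assoc)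
    qed
    then show "\<tau> i ^ n * r = r * \<tau> i ^ n" using a by simp
  qed
  obtain V E where V: "finite E" "V \<subseteq> central_span E" "centre UNIV \<subseteq> V" "\<tau> ` wbar \<subseteq> V"
    "\<And>u v. u \<in> V \<Longrightarrow> v \<in> V \<Longrightarrow> u + v \<in> V \<and> u * v \<in> V"
    using torus_span[OF _ q n(1) \<tau>n] by auto
  have R2: "quot_image 2 \<subseteq> V"
  proof
    fix r assume "r \<in> quot_image 2"
    then obtain a where a: "a \<in> G 2 (num D)" "r = \<phi> 2 a" by (auto simp: quot_image_def)
    have "\<phi> 2 a \<in> V"
      using a(1)
    proof (induction rule: G_induct)
      case (gen l)
      then have "l \<in> {1..num D}" by simp
      then show ?case
        using V(3,4) \<tau>_eq_0_iff[of l] centre_closed(1) by (cases "l \<in> w") (auto simp: \<tau>_def)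
    next
      case one then show ?case using \<phi>2(1) V(3) centre_closed(2) by auto
    next
      case (add a b)
      then show ?case using \<phi>2(2)[of a b] V(5) by simp
    next
      case (mult a b)
      then show ?case using \<phi>2(3)[of a b] V(5) by simp
    next
      case (scale k a)
      then show ?case using \<phi>_scale[of a k] V(3,5) scalar_central[of k] by auto
    qed
    then show "r \<in> V" using a by simp
  qed
  have Vpow: "v ^ m \<in> V" if "v \<in> V" for v m
    using that V(3,5) centre_closed(2) by (induction m) auto
  have inv: "inverse (f' s) \<in> V" if "s \<in> \<Sigma>" for s
    using that unfolding \<Sigma>_def using monoid_B' t_subset
  proof (induction rule: mult_generated_induct)
    case (gen s)
    then obtain i where i: "i \<in> wbar" "s = t i" by blast
    have "\<tau> i \<noteq> 0" using \<tau>_eq_0_iff[of i] i by auto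
    moreover have "\<tau> i ^ n = \<tau> i * \<tau> i ^ (n - 1)" using n(1) by (simp flip: power_Suc)
    \<comment> \<open>The inverse is a power of \<tau>(i) times a central element, so
      \<open>V\<close> contains it although \<open>V\<close> was built from nonnegative
      powers.\<close>
    ultimately have "inverse (\<tau> i) = \<tau> i ^ (n - 1) * inverse (\<tau> i ^ n)"
      by (simp add: nonzero_inverse_mult_distrib mult.assoc[symmetric])
    moreover have "\<tau> i ^ (n - 1) \<in> V" "inverse (\<tau> i ^ n) \<in> V"
      using V(3,4) Vpow centre_closed(5)[OF \<tau>n[OF i(1)]] i(1) by blast+
    ultimately show ?case using i f'_t V(5) by simp
  next
    case one
    then show ?case using embedded_ring.f_one[OF embedded(3)] V(3) centre_closed(2) by auto
  next
    case (mult s s')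
    have "f' (s \<otimes>\<^bsub>B'\<^esub> s') = f' s * f' s'" using mult by (intro embedded_ring.f_mult[OF embedded(3)])
    moreover have "f' s \<noteq> 0" "f' s' \<noteq> 0" using \<Sigma>_props(2) mult(1,2) by (auto simp: \<Sigma>_def)
    ultimately show ?case using mult V(5) by (simp add: nonzero_inverse_mult_distrib)
  qed
  \<comment> \<open>The ring A/P enters only here: it lies in \<open>M\<close>, hence in the same
    finite span as A'/Q.\<close>
  have "M \<subseteq> V" unfolding M_def using R2 inv V(5) by blast
  then have "quot_image (Suc (num D)) \<subseteq> V" using localises_A by (auto simp: localises_def)
  then show "PI_ring B" using V(1,2) embedded(2) by (intro embedded_ring.PI_ringI[OF embedded(1)]) auto
  show "PI_ring B'" using V(1,2) embedded(4) R2 by (intro embedded_ring.PI_ringI[OF embedded(3)]) auto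
qed

lemma main:
  "let A = alg D (num D + 1); A' = alg D 2; Q = psi D P; B = A Quot P; B' = A' Quot Q;
     \<Sigma> = mult_generated B' ((\<lambda>i. Q +>\<^bsub>A'\<^esub> gen D 2 i) ` wbar) in
    (submonoid \<Sigma> B' \<and> (\<forall>s\<in>\<Sigma>. regular_elt B' s \<and> normal_elt B' s)) \<and>
    (\<exists>\<Gamma>. submonoid \<Gamma> B \<and> (\<forall>s\<in>\<Gamma>. regular_elt B s) \<and> two_sided_Ore B \<Gamma> \<and> loc B f \<Gamma> = loc B' f' \<Sigma>) \<and>
    (is_Frac B' f' \<and> Frac_in B f = Frac_in B' f' \<and>
      ((\<forall>i\<in>wbar. \<forall>j\<in>wbar. root_of_unity (lam D i j)) \<longrightarrow>
        PI_ring B \<and> PI_ring B' \<and> PI_deg B f = PI_deg B' f'))"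
proof -
  \<comment> \<open>Both sides are the whole division ring, and the PI degree depends on nothing but
    this ring.\<close>
  have "Frac_in B f = Frac_in B' f'"
    using Frac is_Frac_B' by (simp add: is_Frac_def alg_eq Suc_eq_plus1)
  moreover from this have "PI_deg B f = PI_deg B' f'" by (simp add: PI_deg_def)
  ultimately show ?thesis
    unfolding Let_def alg_eq Suc_eq_plus1[symmetric] \<Sigma>_def[symmetric]
    using submonoid_\<Sigma> \<Sigma>_regular_normal Gamma_ex is_Frac_B' PI by blast
qed

end

theorem theorem3p19:
  fixes D :: "('k::field, 'f::division_ring) qna"
    and w :: "nat set" and P :: "'f set"
    and f :: "'f set \<Rightarrow> 'g::division_ring"
  defines "A \<equiv> alg D (num D + 1)" and "A' \<equiv> alg D 2"
  defines "Q \<equiv> psi D P"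
  defines "B \<equiv> A Quot P" and "B' \<equiv> A' Quot Q"
  defines "f' \<equiv> ident D P f"
  defines "wbar \<equiv> {1..num D} - w"
  defines "t \<equiv> (\<lambda>i. Q +>\<^bsub>A'\<^esub> gen D 2 i)"
  defines "\<Sigma> \<equiv> mult_generated B' (t ` wbar)"
  assumes "quantum_nilpotent_algebra D"
    and "is_Frac A (\<lambda>a. a)"
    and "w \<in> W' D" and "P \<in> CSpec_w D w"
    and "is_Frac B f"
  shows
    "(submonoid \<Sigma> B' \<and> (\<forall>s\<in>\<Sigma>. regular_elt B' s \<and> normal_elt B' s)) \<and>
     (\<exists>\<Gamma>. submonoid \<Gamma> B \<and> (\<forall>s\<in>\<Gamma>. regular_elt B s) \<and> two_sided_Ore B \<Gamma> \<and>
        loc B f \<Gamma> = loc B' f' \<Sigma>) \<and>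
     (is_Frac B' f' \<and> Frac_in B f = Frac_in B' f' \<and>
      ((\<forall>i\<in>wbar. \<forall>j\<in>wbar. root_of_unity (lam D i j)) \<longrightarrow>
         PI_ring B \<and> PI_ring B' \<and> PI_deg B f = PI_deg B' f'))"
proof -
  \<comment> \<open>The first nine facts in \<open>assms\<close> are the defining equations.\<close>
  have "prime_quotient D P w f"
    using assms(10-) by unfold_locales (auto simp: W'_def B_def A_def)
  from prime_quotient.main[OF this] show ?thesis
    unfolding Let_def A_def A'_def Q_def B_def B'_def f'_def wbar_def t_def \<Sigma>_def .
qed

end
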